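(* Let $N\geq2$ and let $z_0,C_0,A_0,\tilde C_0$ be the constants fixed in the context. There exist a constant $\tilde A$, depending on $N$ only, and, for every $\tau>0$, a constant $C_3(\tau)$, depending on $\tau$ only, such that the following holds. Let $0<R<R_0$, let $1<B_0<B_1$ with $B_0\geq3\mathrm{e}\tilde C_0/2$, and let $k_0>0$ be such that $k_0R_0\geq z_0$. For each $k\geq k_0$ let $u^s=u^s_k$ be a radiating solution of $\Delta u^s+k^2u^s=0$ in $\mathbb{R}^N\setminus\overline{B_R}$ with far-field pattern $u^s_\infty$, and let $\varepsilon=\|u^s_\infty\|_{L^2(\mathbb{S}^{N-1})}>0$, $M=\|u^s\|_{L^2(\partial B_{R_0})}>0$. Assume that for some $\tau>0$ and some constant $C_2$ we have, for any $k\geq k_0$, $$M\leq C_2k^{\tau}.$$ If $k\geq k_0$, $\varepsilon\leq1/\mathrm{e}$ and $$k\geq\frac{\tilde C_0}{\log(4/3)B_0R_0}\log(1/\varepsilon),$$ then, for any $r$ with $B_0R_0\leq r\leq B_1R_0$, $$\|u^s\|_{L^2(\partial B_r)}\leq\left(\tilde AB_1\left(1+C_2^2\left(\frac{\tilde C_0}{B_0R_0}\right)^{2\tau}C_3(\tau)\right)\right)^{1/2}\varepsilon.$$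
   Context: $B_s$ is the open ball of radius $s$ centred at the origin of $\mathbb{R}^N$. A solution $u^s$ of the Helmholtz equation $\Delta u^s+k^2u^s=0$ in $\mathbb{R}^N\setminus\overline{B_R}$ is radiating if $\lim_{\rho\to\infty}\rho^{(N-1)/2}(\partial u^s/\partial \rho-\mathrm{i}ku^s)=0$, $\rho=\|x\|$, uniformly in all directions $\hat x=x/\|x\|$. Its far-field pattern $u^s_\infty$ is the function on $\mathbb{S}^{N-1}$ such that $u^s(x)=\frac{\mathrm{e}^{\mathrm{i}k\|x\|}}{\|x\|^{(N-1)/2}}\{u^s_\infty(\hat x)+O(1/\|x\|)\}$ as $\|x\|\to\infty$, uniformly in $\hat x$. The quantities $u^s$, $\varepsilon$ and $M$ depend on $k$. Constants $z_0,C_0,A_0,\tilde C_0$. Fixed once and for all (depending on $N$ only) are constants $z_0\geq1$, $C_0>0$, $A_0\geq1$ such that the Hankel functions of the first kind satisfy, for every $z\geq z_0$ and $\nu\geq0$: (i) if $\nu=0$, or $\nu>0$ and $z-\nu\geq C_0\nu^{1/3}$, then $A_0^{-1}(z^2-\nu^2)^{-1/4}\leq|H^{(1)}_\nu(z)|\leq A_0(z^2-\nu^2)^{-1/4}$; (ii) if $\nu>0$ and $|z-\nu|\leq C_0\nu^{1/3}$, then $A_0^{-1}\nu^{-1/3}\leq|H^{(1)}_\nu(z)|\leq A_0\nu^{-1/3}$; (iii) if $\nu>0$ and $\nu-z\geq C_0\nu^{1/3}$, then $A_0^{-1}\mathrm{e}^{\eta_2}(\nu^2-z^2)^{-1/4}\leq|H^{(1)}_\nu(z)|\leq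 A_0\mathrm{e}^{\eta_2}(\nu^2-z^2)^{-1/4}$, with $\eta_2=\nu\log\left(\frac{\nu}{z}+((\nu/z)^2-1)^{1/2}\right)-(\nu^2-z^2)^{1/2}$. Moreover $\tilde C_0\geq 2$ depends on $C_0$ only and is such that $\nu+C_0\nu^{1/3}\leq\tilde C_0\nu$ for all $\nu\geq1/2$, and $z_0$ is taken large enough that $z_0\geq\tilde C_0\max\{2,(N-2)/2\}$, $1-C_0z_0^{-2/3}>0$, and, for every $\nu$, $z_0\leq\tilde C_0\nu$ implies $C_0\nu^{1/3}\leq\nu/2$. Such constants exist. *)

theory Defs
  imports "HOL-Analysis.Analysis"
begin

section \<open>Bessel and Hankel functions of real order and positive argument\<close>

text \<open>The reciprocal Gamma function is entire, so the power series defines \<open>J\<^sub>\<nu>\<close> also for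
  negative (in particular negative integer) orders.\<close>

definition bessel_J :: "real \<Rightarrow> real \<Rightarrow> real" where
  "bessel_J \<nu> z = (\<Sum>m. (-1) ^ m * rGamma (\<nu> + real m + 1) / fact m * (z / 2) powr (\<nu> + 2 * real m))"

text \<open>At integer orders the defining quotient is replaced by its limit in the order.\<close>

definition bessel_Y :: "real \<Rightarrow> real \<Rightarrow> real" where
  "bessel_Y \<nu> z =
     (let q = (\<lambda>\<mu>. (bessel_J \<mu> z * cos (\<mu> * pi) - bessel_J (- \<mu>) z) / sin (\<mu> * pi))
      in if \<nu> \<in> \<int> then Lim (at \<nu>) q else q \<nu>)"

definition hankel1 :: "real \<Rightarrow> real \<Rightarrow> complex" where
  "hankel1 \<nu> z = Complex (bessel_J \<nu> z) (bessel_Y \<nu> z)"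

definition hankel_eta2 :: "real \<Rightarrow> real \<Rightarrow> real" where
  "hankel_eta2 \<nu> z = \<nu> * ln (\<nu> / z + sqrt ((\<nu> / z)\<^sup>2 - 1)) - sqrt (\<nu>\<^sup>2 - z\<^sup>2)"

text \<open>The last argument \<open>Ct\<close> is \<open>\<tilde>C\<^sub>0\<close>.\<close>

definition hankel_constants :: "nat \<Rightarrow> real \<Rightarrow> real \<Rightarrow> real \<Rightarrow> real \<Rightarrow> bool" where
  "hankel_constants N z\<^sub>0 C\<^sub>0 A\<^sub>0 Ct \<longleftrightarrow>
     z\<^sub>0 \<ge> 1 \<and> C\<^sub>0 > 0 \<and> A\<^sub>0 \<ge> 1 \<and>
     (\<forall>z\<ge>z\<^sub>0. \<forall>\<nu>\<ge>0.
        (\<nu> = 0 \<or> \<nu> > 0 \<and> z - \<nu> \<ge> C\<^sub>0 * \<nu> powr (1/3) \<longrightarrow>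
           inverse A\<^sub>0 * (z\<^sup>2 - \<nu>\<^sup>2) powr (-1/4) \<le> norm (hankel1 \<nu> z) \<and>
           norm (hankel1 \<nu> z) \<le> A\<^sub>0 * (z\<^sup>2 - \<nu>\<^sup>2) powr (-1/4)) \<and>
        (\<nu> > 0 \<and> \<bar>z - \<nu>\<bar> \<le> C\<^sub>0 * \<nu> powr (1/3) \<longrightarrow>
           inverse A\<^sub>0 * \<nu> powr (-1/3) \<le> norm (hankel1 \<nu> z) \<and>
           norm (hankel1 \<nu> z) \<le> A\<^sub>0 * \<nu> powr (-1/3)) \<and>
        (\<nu> > 0 \<and> \<nu> - z \<ge> C\<^sub>0 * \<nu> powr (1/3) \<longrightarrow>
           inverse A\<^sub>0 * exp (hankel_eta2 \<nu> z) * (\<nu>\<^sup>2 - z\<^sup>2) powr (-1/4) \<le> norm (hankel1 \<nu> z) \<and>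
           norm (hankel1 \<nu> z) \<le> A\<^sub>0 * exp (hankel_eta2 \<nu> z) * (\<nu>\<^sup>2 - z\<^sup>2) powr (-1/4))) \<and>
     Ct \<ge> 2 \<and> (\<forall>\<nu>\<ge>1/2. \<nu> + C\<^sub>0 * \<nu> powr (1/3) \<le> Ct * \<nu>) \<and>
     z\<^sub>0 \<ge> Ct * max 2 ((real N - 2) / 2) \<and>
     1 - C\<^sub>0 * z\<^sub>0 powr (-2/3) > 0 \<and>
     (\<forall>\<nu>. z\<^sub>0 \<le> Ct * \<nu> \<longrightarrow> C\<^sub>0 * \<nu> powr (1/3) \<le> \<nu> / 2)"

section \<open>Euclidean space with the dimension as a number\<close>

text \<open>
  A constant that must not depend on the dimension has to be quantified before the dimension,
  which is impossible when the dimension is a type. So \<open>\<real>\<^sup>N\<close> is represented by the functions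
  on \<open>{..<N}\<close>, extensional as elements of \<^typ>\<open>nat \<Rightarrow> real\<close>; on this set the topology of
  \<^typ>\<open>nat \<Rightarrow> real\<close> (the product topology) is the Euclidean one.
\<close>

definition Rn :: "nat \<Rightarrow> (nat \<Rightarrow> real) set" where
  "Rn N = {..<N} \<rightarrow>\<^sub>E UNIV"

definition enorm :: "nat \<Rightarrow> (nat \<Rightarrow> real) \<Rightarrow> real" where
  "enorm N x = L2_set x {..<N}"

definition escale :: "nat \<Rightarrow> real \<Rightarrow> (nat \<Rightarrow> real) \<Rightarrow> nat \<Rightarrow> real" where
  "escale N t x = (\<lambda>i\<in>{..<N}. t * x i)"

definition esphere :: "nat \<Rightarrow> real \<Rightarrow> (nat \<Rightarrow> real) set" where
  "esphere N r = {x \<in> Rn N. enorm N x = r}"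

definition exterior_ball :: "nat \<Rightarrow> real \<Rightarrow> (nat \<Rightarrow> real) set" where
  "exterior_ball N r = {x \<in> Rn N. enorm N x > r}"

definition lebN :: "nat \<Rightarrow> (nat \<Rightarrow> real) measure" where
  "lebN N = Pi\<^sub>M {..<N} (\<lambda>_. lborel)"

section \<open>Surface measure and \<open>L\<^sup>2\<close> norm on spheres\<close>

text \<open>
  Surface measure on the sphere of radius \<open>r\<close>: a set \<open>A\<close> has measure \<open>N / r\<close> times the volume of
  the cone \<open>{t x | 0 < t \<le> 1, x \<in> A}\<close>, which is the preimage of \<open>A\<close> under the radial projection
  of the punctured closed ball (see \<open>emeasure_sphere_measure\<close>).
\<close>

definition sphere_measure :: "nat \<Rightarrow> real \<Rightarrow> (nat \<Rightarrow> real) measure" where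
  "sphere_measure N r =
     scale_measure (ennreal (real N / r))
       (distr (restrict_space (lebN N) {x \<in> Rn N. 0 < enorm N x \<and> enorm N x \<le> r})
              (restrict_space (lebN N) (esphere N r))
              (\<lambda>x. escale N (r / enorm N x) x))"

definition L2_norm_sphere :: "nat \<Rightarrow> real \<Rightarrow> ((nat \<Rightarrow> real) \<Rightarrow> complex) \<Rightarrow> real" where
  "L2_norm_sphere N r f = sqrt (\<integral>x. (norm (f x))\<^sup>2 \<partial>sphere_measure N r)"

lemma space_lebN: "space (lebN N) = Rn N"
  by (simp add: lebN_def Rn_def space_PiM)

lemma enorm_measurable [measurable]: "enorm N \<in> borel_measurable (lebN N)"
  unfolding lebN_def enorm_def L2_set_def by measurable

lemma esphere_sets: "esphere N r \<in> sets (lebN N)"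
proof -
  have "esphere N r = {x \<in> space (lebN N). enorm N x = r}"
    by (simp add: esphere_def space_lebN)
  then show ?thesis by simp
qed

lemma enorm_escale: "enorm N (escale N t x) = \<bar>t\<bar> * enorm N x"
  unfolding enorm_def escale_def L2_set_def
  by (simp add: power_mult_distrib flip: sum_distrib_left) (simp add: real_sqrt_mult)

lemma radial_projection_measurable:
  assumes "r > 0"
  shows "(\<lambda>x. escale N (r / enorm N x) x)
           \<in> measurable (restrict_space (lebN N) {x \<in> Rn N. 0 < enorm N x \<and> enorm N x \<le> r})
               (restrict_space (lebN N) (esphere N r))"
proof (rule measurable_restrict_space3)
  show "(\<lambda>x. escale N (r / enorm N x) x) \<in> measurable (lebN N) (lebN N)"
    unfolding escale_def enorm_def L2_set_def lebN_def by measurable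
  show "(\<lambda>x. escale N (r / enorm N x) x)
          \<in> {x \<in> Rn N. 0 < enorm N x \<and> enorm N x \<le> r} \<rightarrow> esphere N r"
    using assms by (auto simp: esphere_def enorm_escale) (auto simp: Rn_def escale_def)
qed

lemma emeasure_sphere_measure:
  assumes "r > 0" and A: "A \<in> sets (lebN N)" "A \<subseteq> esphere N r"
  shows "emeasure (sphere_measure N r) A =
           ennreal (real N / r) * emeasure (lebN N) {escale N t x | t x. 0 < t \<and> t \<le> 1 \<and> x \<in> A}"
proof -
  let ?B = "{x \<in> Rn N. 0 < enorm N x \<and> enorm N x \<le> r}"
  let ?p = "\<lambda>x. escale N (r / enorm N x) x"
  have B: "?B \<in> sets (lebN N)"
  proof -
    have "?B = {x \<in> space (lebN N). 0 < enorm N x \<and> enorm N x \<le> r}" by (simp add: space_lebN)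
    then show ?thesis by simp
  qed
  have AS: "A \<in> sets (restrict_space (lebN N) (esphere N r))"
    using A by (simp add: sets_restrict_space_iff esphere_sets)
  have eq: "?p -` A \<inter> ?B = {escale N t x | t x. 0 < t \<and> t \<le> 1 \<and> x \<in> A}"
  proof (intro equalityI subsetI)
    fix x assume x: "x \<in> ?p -` A \<inter> ?B"
    then have "x = escale N (enorm N x / r) (?p x)"
      using \<open>r > 0\<close> by (fastforce simp: escale_def Rn_def PiE_def extensional_def)
    then show "x \<in> {escale N t x | t x. 0 < t \<and> t \<le> 1 \<and> x \<in> A}"
      using x \<open>r > 0\<close> by (intro CollectI exI[of _ "enorm N x / r"] exI[of _ "?p x"]) auto
  next
    fix y assume "y \<in> {escale N t x | t x. 0 < t \<and> t \<le> 1 \<and> x \<in> A}"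
    then obtain t x where tx: "0 < t" "t \<le> 1" "x \<in> A" "y = escale N t x" by blast
    then have x: "enorm N x = r" "x \<in> Rn N" using A by (auto simp: esphere_def)
    have y: "enorm N y = t * r" using tx x by (simp add: enorm_escale)
    have "?p y = x"
      unfolding y using tx x \<open>r > 0\<close> by (auto simp: escale_def Rn_def PiE_def extensional_def)
    moreover have "y \<in> Rn N" using tx by (auto simp: escale_def Rn_def)
    ultimately show "y \<in> ?p -` A \<inter> ?B"
      using tx y \<open>r > 0\<close> by (auto simp: mult_le_cancel_right1)
  qed
  have "emeasure (sphere_measure N r) A =
          ennreal (real N / r) * emeasure (restrict_space (lebN N) ?B) (?p -` A \<inter> ?B)"
    unfolding sphere_measure_def
    using B by (simp add: emeasure_distr[OF radial_projection_measurable[OF \<open>r > 0\<close>] AS]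
        space_restrict_space Int_absorb2 sets.sets_into_space)
  also have "emeasure (restrict_space (lebN N) ?B) (?p -` A \<inter> ?B) = emeasure (lebN N) (?p -` A \<inter> ?B)"
    using B by (intro emeasure_restrict_space) auto
  finally show ?thesis using eq by simp
qed

section \<open>The Helmholtz equation and radiating solutions\<close>

definition partial_deriv :: "nat \<Rightarrow> ((nat \<Rightarrow> real) \<Rightarrow> complex) \<Rightarrow> (nat \<Rightarrow> real) \<Rightarrow> complex" where
  "partial_deriv i f x = vector_derivative (\<lambda>t. f (x(i := t))) (at (x i))"

text \<open>The set \<open>S\<close> is meant to be open in \<open>\<real>\<^sup>N\<close>.\<close>

definition C1_on :: "nat \<Rightarrow> (nat \<Rightarrow> real) set \<Rightarrow> ((nat \<Rightarrow> real) \<Rightarrow> complex) \<Rightarrow> bool" where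
  "C1_on N S f \<longleftrightarrow> continuous_on S f \<and>
     (\<forall>i<N. (\<forall>x\<in>S. (\<lambda>t. f (x(i := t))) differentiable (at (x i))) \<and>
            continuous_on S (partial_deriv i f))"

definition C2_on :: "nat \<Rightarrow> (nat \<Rightarrow> real) set \<Rightarrow> ((nat \<Rightarrow> real) \<Rightarrow> complex) \<Rightarrow> bool" where
  "C2_on N S f \<longleftrightarrow> C1_on N S f \<and> (\<forall>i<N. C1_on N S (partial_deriv i f))"

definition laplacian :: "nat \<Rightarrow> ((nat \<Rightarrow> real) \<Rightarrow> complex) \<Rightarrow> (nat \<Rightarrow> real) \<Rightarrow> complex" where
  "laplacian N f x = (\<Sum>i<N. partial_deriv i (partial_deriv i f) x)"

definition helmholtz_solution ::
    "nat \<Rightarrow> real \<Rightarrow> (nat \<Rightarrow> real) set \<Rightarrow> ((nat \<Rightarrow> real) \<Rightarrow> complex) \<Rightarrow> bool" where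
  "helmholtz_solution N k S u \<longleftrightarrow>
     C2_on N S u \<and> (\<forall>x\<in>S. laplacian N u x + (complex_of_real k)\<^sup>2 * u x = 0)"

text \<open>Points \<open>x \<noteq> 0\<close> are written \<open>x = \<rho> w\<close> with \<open>\<rho> = \<parallel>x\<parallel>\<close> and a unit vector \<open>w\<close>.\<close>

definition radial_deriv ::
    "nat \<Rightarrow> ((nat \<Rightarrow> real) \<Rightarrow> complex) \<Rightarrow> real \<Rightarrow> (nat \<Rightarrow> real) \<Rightarrow> complex" where
  "radial_deriv N u \<rho> w = vector_derivative (\<lambda>t. u (escale N t w)) (at \<rho>)"

definition sommerfeld :: "nat \<Rightarrow> real \<Rightarrow> ((nat \<Rightarrow> real) \<Rightarrow> complex) \<Rightarrow> bool" where
  "sommerfeld N k u \<longleftrightarrow>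
     uniform_limit (esphere N 1)
       (\<lambda>\<rho> w. complex_of_real (\<rho> powr ((real N - 1) / 2)) *
                (radial_deriv N u \<rho> w - \<i> * complex_of_real k * u (escale N \<rho> w)))
       (\<lambda>_. 0) at_top"

definition radiating_solution :: "nat \<Rightarrow> real \<Rightarrow> real \<Rightarrow> ((nat \<Rightarrow> real) \<Rightarrow> complex) \<Rightarrow> bool" where
  "radiating_solution N k R u \<longleftrightarrow> helmholtz_solution N k (exterior_ball N R) u \<and> sommerfeld N k u"

definition far_field_pattern ::
    "nat \<Rightarrow> real \<Rightarrow> ((nat \<Rightarrow> real) \<Rightarrow> complex) \<Rightarrow> ((nat \<Rightarrow> real) \<Rightarrow> complex) \<Rightarrow> bool" where
  "far_field_pattern N k u u_inf \<longleftrightarrow>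
     (\<exists>g C \<rho>\<^sub>0. \<rho>\<^sub>0 > 0 \<and>
        (\<forall>\<rho>\<ge>\<rho>\<^sub>0. \<forall>w\<in>esphere N 1.
           u (escale N \<rho> w) =
             exp (\<i> * complex_of_real (k * \<rho>)) / complex_of_real (\<rho> powr ((real N - 1) / 2)) *
             (u_inf w + g \<rho> w) \<and>
           norm (g \<rho> w) \<le> C / \<rho>))"

end

(*
  Expand the solution in spherical harmonics: with v(t) = t^((N-1)/2) times the coefficient of u(t w)
  against a harmonic of degree n, v'' + (k^2 - c/t^2) v = 0 where c = nu^2 - 1/4, nu = n + (N-2)/2,
  and v(t) - exp(i k t) a = O(1/t), where a is the coefficient of the far field.  No Hankel function is needed:
  q = k^2 - c/t^2 increases (if c >= 0), so the energy |v'|^2 + q |v|^2 increases to its limit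
  2 k^2 |a|^2.  For modes that oscillate at t = r this bounds |v(r)| by a constant times |a|.  For the
  others, a maximum principle in the evanescent region t < sqrt(c)/k makes |v(r)| an exponentially
  small multiple of |v(R0)|, up to a multiple of |a|; the smallness exp(-k r/4) beats M/eps because
  k B0 R0/Ct is at least log(1/eps)/log(4/3).  Summing over an orthonormal system of harmonics
  (Bessel's inequality for a and v(R0), completeness at radius r) gives the estimate.
*)
theory Submission
  imports Defs "HOL-Real_Asymp.Real_Asymp"
begin

section \<open>Radial Helmholtz modes\<close>

text \<open>Two obstacles shape the proof. In the evanescent region the far field bounds a mode only
  through a radius beyond the turning point, at the cost of a factor exponential in
  \<open>sqrt c\<close>. Well inside that region the decay away from \<open>xb\<close> outweighs
  this loss. When r lies closer to the turning point, the conserved Wronskian is used backwards: it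
  bounds |a| by |v| at a point where |v(R0)| still has control, so that |a| itself is exponentially
  small against |v(R0)| and pays for the loss. The second obstacle is the passage from the partial
  differential equation to the radial one. To avoid the polar form of the Laplacian and
  differentiation under integrals over spheres, the equation is tested against radial functions
  times solid harmonics and read in polar coordinates; this yields a weak radial equation, which a
  du Bois-Reymond argument makes strong. Orthogonality of harmonics of different degree falls out of
  the same radial equation at frequency 0. Only finite orthonormal systems of real harmonics occur,
  so completeness is used up to an error that finally tends to 0.\<close>

text \<open>A one-dimensional maximum principle. At a positive interior maximum \<open>z'\<close>
  vanishes while \<open>z'' \<ge> Q z > 0\<close>, so \<open>z'\<close> is positive just to the
  right and \<open>z\<close> climbs above its maximum.\<close>

lemma nonpos_of_second_derivative_ge:
  fixes z z' z'' Q :: "real \<Rightarrow> real"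
  assumes cont: "continuous_on {a..b} z"
    and d1: "\<And>x. a < x \<Longrightarrow> x < b \<Longrightarrow> (z has_real_derivative z' x) (at x)"
    and d2: "\<And>x. a < x \<Longrightarrow> x < b \<Longrightarrow> (z' has_real_derivative z'' x) (at x)"
    and Q: "\<And>x. a < x \<Longrightarrow> x < b \<Longrightarrow> Q x > 0"
    and ge: "\<And>x. a < x \<Longrightarrow> x < b \<Longrightarrow> z'' x \<ge> Q x * z x"
    and bd: "z a \<le> 0" "z b \<le> 0" and x: "x \<in> {a..b}"
  shows "z x \<le> 0"
proof (rule ccontr)
  assume neg: "\<not> z x \<le> 0"
  have "{a..b} \<noteq> {}" using x by auto
  from continuous_attains_sup[OF compact_Icc this cont]
  obtain m where m: "m \<in> {a..b}" "\<And>y. y \<in> {a..b} \<Longrightarrow> z y \<le> z m" by blast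
  have zm: "z m > 0" using m(2)[OF x] neg by linarith
  have am: "a < m" "m < b" using m(1) bd zm by (auto simp: less_le)
  have "z' m = 0"
  proof (rule DERIV_local_max[OF d1[OF am], of "min (m - a) (b - m)"])
    show "0 < min (m - a) (b - m)" using am by simp
    show "\<forall>y. \<bar>m - y\<bar> < min (m - a) (b - m) \<longrightarrow> z y \<le> z m" 
      using m(2) am by (intro allI impI m(2)) (auto simp: abs_less_iff)
  qed
  have "z'' m > 0" using ge[OF am] mult_pos_pos[OF Q[OF am] zm] by linarith
  from DERIV_pos_inc_right[OF d2[OF am] this]
  obtain d where d: "d > 0" "\<And>h. h > 0 \<Longrightarrow> h < d \<Longrightarrow> z' m < z' (m + h)" by blast
  define e where "e = min d (b - m) / 2"
  have e: "e > 0" "e < d" "m + e < b" using d am by (auto simp: e_def min_def field_simps)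
  obtain y where y: "m < y" "y < m + e" "z (m + e) - z m = (m + e - m) * z' y"
    using MVT2[of m "m+e" z z'] d1 e am by force
  have "z' y > 0" using d(2)[of "y - m"] y e \<open>z' m = 0\<close> by auto
  from mult_pos_pos[OF e(1) this] y(3) have "z (m + e) > z m" by simp
  moreover have "z (m + e) \<le> z m" using m(2) e am by auto
  ultimately show False by simp
qed

lemma deriv_norm_square:
  fixes f :: "real \<Rightarrow> complex"
  assumes "(f has_vector_derivative f') (at x)"
  shows "((\<lambda>x. (norm (f x))\<^sup>2) has_real_derivative 2 * (Re (f x) * Re f' + Im (f x) * Im f')) (at x)"
  unfolding cmod_power2
  by (rule DERIV_cong[OF DERIV_add[OF DERIV_power[OF has_field_derivative_Re[OF assms]]
        DERIV_power[OF has_field_derivative_Im[OF assms]]]]) (simp add: algebra_simps)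

lemma deriv_div_square:
  fixes c t :: real
  assumes "t > 0"
  shows "((\<lambda>x. c / x\<^sup>2) has_real_derivative - 2 * c / t ^ 3) (at t)"
proof -
  have "((\<lambda>x. c / x\<^sup>2) has_real_derivative (0 * t\<^sup>2 - c * (2 * t)) / (t\<^sup>2 * t\<^sup>2)) (at t)"
    using assms by (intro DERIV_divide DERIV_const) (auto intro!: derivative_eq_intros)
  then show ?thesis by (rule DERIV_cong) (use assms in \<open>simp add: power2_eq_square power3_eq_cube mult_ac\<close>)
qed

section \<open>Asymptotics, energy and Wronskian of a single mode\<close>

text \<open>In the application \<open>v\<close> is a coefficient of the field on the sphere of
  radius \<open>x\<close>, weighted so that its equation has no first-order term, and
  \<open>a\<close> is the same coefficient of the far-field pattern. There \<open>c\<close> is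
  negative only for the constant mode in dimension 2, where it equals -1/4. The assumption
  \<open>outgoing\<close> speaks of \<open>v\<close> alone; the behaviour of \<open>v'\<close> at
  infinity has to be derived.\<close>

locale radial_mode =
  fixes v v' :: "real \<Rightarrow> complex" and a :: complex and k c R C x\<^sub>0 :: real
  assumes k: "k > 0" and R: "R > 0"
    and v: "\<And>x. x > R \<Longrightarrow> (v has_vector_derivative v' x) (at x)"
    and v': "\<And>x. x > R \<Longrightarrow> (v' has_vector_derivative of_real (c / x\<^sup>2 - k\<^sup>2) * v x) (at x)"
    and outgoing: "\<And>x. x \<ge> x\<^sub>0 \<Longrightarrow> norm (v x - cis (k * x) * a) \<le> C / x"
begin

definition "energy x = (norm (v' x))\<^sup>2 + (k\<^sup>2 - c / x\<^sup>2) * (norm (v x))\<^sup>2"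

text \<open>This is \<open>Im (cnj (v x) * v' x)\<close>, up to the factor 2i the Wronskian of
  \<open>cnj v\<close> and \<open>v\<close>; physically, the radial energy flux.\<close>

definition "wronskian x = Re (v x) * Im (v' x) - Im (v x) * Re (v' x)"

lemma tendsto_v: "((\<lambda>x. cis (- (k * x)) * v x) \<longlongrightarrow> a) at_top"
proof (rule LIM_zero_cancel, rule Lim_null_comparison)
  show "\<forall>\<^sub>F x in at_top. norm (cis (- (k * x)) * v x - a) \<le> C / x"
  proof (rule eventually_mono[OF eventually_ge_at_top[of x\<^sub>0]])
    fix x assume "x \<ge> x\<^sub>0"
    have "norm (v x - cis (k * x) * a) = norm (cis (- (k * x)) * (v x - cis (k * x) * a))"
      by (simp add: norm_mult)
    also have "cis (- (k * x)) * (v x - cis (k * x) * a) = cis (- (k * x)) * v x - (cis (- (k * x)) * cis (k * x)) * a"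
      by (simp only: right_diff_distrib mult.assoc)
    also have "cis (- (k * x)) * cis (k * x) = 1" by (simp add: cis_mult)
    also have "cis (- (k * x)) * v x - 1 * a = cis (- (k * x)) * v x - a" by simp
    finally show "norm (cis (- (k * x)) * v x - a) \<le> C / x" using outgoing[OF \<open>x \<ge> x\<^sub>0\<close>] by simp
  qed
  show "((\<lambda>x. C / x) \<longlongrightarrow> 0) at_top" by real_asymp
qed

text \<open>The Wronskian of \<open>v\<close> with \<open>cos (k (t - x))\<close> is almost constant over a quarter period, so
  \<open>v' x\<close> is close to \<open>k v (x + \<pi> / (2 k))\<close>.\<close>

lemma tendsto_v': "((\<lambda>x. cis (- (k * x)) * v' x) \<longlongrightarrow> \<i> * of_real k * a) at_top"
proof -
  define h where "h = pi / (2 * k)"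
  define X where "X = max (max R x\<^sub>0) 1 + 1"
  define B where "B = norm a + \<bar>C\<bar>"
  have hk: "h > 0" "k * h = pi / 2" using k by (auto simp: h_def)
  have vB: "norm (v t) \<le> B" if "t \<ge> X" for t
  proof -
    have t: "t \<ge> 1" "t \<ge> x\<^sub>0" using that by (auto simp: X_def)
    have "C / t \<le> \<bar>C\<bar> / t" using t by (intro divide_right_mono) auto
    also have "\<bar>C\<bar> / t \<le> \<bar>C\<bar>" using t divide_left_mono[of 1 t "\<bar>C\<bar>"] by simp
    finally have "C / t \<le> \<bar>C\<bar>" .
    moreover have "norm (v t) \<le> norm (v t - cis (k * t) * a) + norm (cis (k * t) * a)"
      by (metis diff_add_cancel norm_triangle_ineq)
    ultimately show ?thesis using outgoing[OF t(2)] by (simp add: B_def norm_mult)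
  qed
  have main: "norm (v' x - of_real k * v (x + h)) \<le> h * (\<bar>c\<bar> / x\<^sup>2 * B)" if x: "x \<ge> X" for x
  proof -
    have xR: "x > R" "x > 0" using x by (auto simp: X_def)
    \<comment> \<open>\<open>\<Phi>\<close> is \<open>v' * f - v * f'\<close> for the free solution
      f(t) = cos(k(t - x)). The terms with \<open>k\<^sup>2\<close> cancel in its derivative and
      only the perturbation \<open>c / t\<^sup>2\<close> remains. At \<open>t = x\<close> it equals
      \<open>v' x\<close>, and a quarter period later, where the cosine is 0 and the sine is 1, it
      equals \<open>k * v (x + h)\<close>.\<close>
    define \<Phi> where "\<Phi> t = v' t * of_real (cos (k * (t - x))) + v t * of_real (k * sin (k * (t - x)))" for t
    define D where "D t = of_real (c / t\<^sup>2 * cos (k * (t - x))) * v t" for t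
    have der: "(\<Phi> has_vector_derivative D t) (at t)" if "t > R" for t
    proof -
      have 1: "((\<lambda>t. of_real (cos (k * (t - x))) :: complex) has_vector_derivative of_real (- k * sin (k * (t - x)))) (at t)"
        by (rule has_vector_derivative_of_real) (auto intro!: derivative_eq_intros simp flip: has_real_derivative_iff_has_vector_derivative)
      have 2: "((\<lambda>t. of_real (k * sin (k * (t - x))) :: complex) has_vector_derivative of_real (k * k * cos (k * (t - x)))) (at t)"
        by (rule has_vector_derivative_of_real) (auto intro!: derivative_eq_intros simp flip: has_real_derivative_iff_has_vector_derivative)
      have "(\<Phi> has_vector_derivative
        (v' t * of_real (- k * sin (k * (t - x))) + of_real (c / t\<^sup>2 - k\<^sup>2) * v t * of_real (cos (k * (t - x))))
        + (v t * of_real (k * k * cos (k * (t - x))) + v' t * of_real (k * sin (k * (t - x))))) (at t)"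
        unfolding \<Phi>_def
        by (intro has_vector_derivative_add has_vector_derivative_mult v v' 1 2 that)
      moreover have "(v' t * of_real (- k * sin (k * (t - x))) + of_real (c / t\<^sup>2 - k\<^sup>2) * v t * of_real (cos (k * (t - x))))
        + (v t * of_real (k * k * cos (k * (t - x))) + v' t * of_real (k * sin (k * (t - x)))) = D t"
        by (simp add: D_def algebra_simps power2_eq_square)
      ultimately show ?thesis by simp
    qed
    have "\<exists>t\<in>{x<..<x+h}. norm (\<Phi> (x + h) - \<Phi> x) \<le> norm ((x + h - x) *\<^sub>R D t)"
    proof (rule mvt_general)
      show "continuous_on {x..x + h} \<Phi>"
      proof (rule continuous_at_imp_continuous_on, rule ballI)
        fix t assume "t \<in> {x..x + h}"
        then show "isCont \<Phi> t" using xR by (intro has_vector_derivative_continuous[OF der]) auto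
      qed
      fix t assume "x < t" "t < x + h"
      then show "(\<Phi> has_derivative (\<lambda>s. s *\<^sub>R D t)) (at t)"
        using der[of t] xR by (auto simp: has_vector_derivative_def)
    qed (use hk in auto)
    then obtain t where t: "x < t" "norm (\<Phi> (x + h) - \<Phi> x) \<le> h * norm (D t)" using hk by auto
    have "norm (D t) = \<bar>c\<bar> / t\<^sup>2 * \<bar>cos (k * (t - x))\<bar> * norm (v t)"
      by (simp add: D_def norm_mult abs_mult norm_divide norm_power)
    also have "\<dots> \<le> \<bar>c\<bar> / x\<^sup>2 * 1 * B"
      using t xR vB[of t] x
      by (intro mult_mono divide_left_mono power_mono) (auto simp: abs_cos_le_one)
    finally have "norm (\<Phi> (x + h) - \<Phi> x) \<le> h * (\<bar>c\<bar> / x\<^sup>2 * B)"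
      using t(2) hk by (smt (verit) mult_left_mono mult.right_neutral)
    moreover have "\<Phi> (x + h) = of_real k * v (x + h)" "\<Phi> x = v' x"
      by (simp_all only: \<Phi>_def add_diff_cancel_left' hk(2)) simp_all
    ultimately show ?thesis by (simp add: norm_minus_commute)
  qed
  have "((\<lambda>x. cis (- (k * x)) * (of_real k * v (x + h))) \<longlongrightarrow> \<i> * of_real k * a) at_top"
  proof -
    have "((\<lambda>x. cis (- (k * (x + h))) * v (x + h)) \<longlongrightarrow> a) at_top"
      by (rule filterlim_compose[OF tendsto_v]) real_asymp
    then have "((\<lambda>x. \<i> * of_real k * (cis (- (k * (x + h))) * v (x + h))) \<longlongrightarrow> \<i> * of_real k * a) at_top"
      by (rule tendsto_mult_left)
    moreover have "\<i> * of_real k * (cis (- (k * (x + h))) * v (x + h)) = cis (- (k * x)) * (of_real k * v (x + h))" for x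
    proof -
      have "\<i> = cis (k * h)" by (simp only: hk(2) cis_pi_half)
      then have "\<i> * of_real k * (cis (- (k * (x + h))) * v (x + h)) = (cis (k * h) * cis (- (k * (x + h)))) * (of_real k * v (x + h))"
        by (simp only: mult_ac)
      also have "cis (k * h) * cis (- (k * (x + h))) = cis (- (k * x))"
        by (simp only: cis_mult) (simp add: algebra_simps)
      finally show ?thesis .
    qed
    ultimately show ?thesis by simp
  qed
  moreover have "((\<lambda>x. cis (- (k * x)) * v' x - cis (- (k * x)) * (of_real k * v (x + h))) \<longlongrightarrow> 0) at_top"
  proof (rule Lim_null_comparison)
    show "\<forall>\<^sub>F x in at_top. norm (cis (- (k * x)) * v' x - cis (- (k * x)) * (of_real k * v (x + h))) \<le> h * (\<bar>c\<bar> / x\<^sup>2 * B)"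
    proof (rule eventually_mono[OF eventually_ge_at_top[of X]])
      fix x assume "x \<ge> X"
      then show "norm (cis (- (k * x)) * v' x - cis (- (k * x)) * (of_real k * v (x + h))) \<le> h * (\<bar>c\<bar> / x\<^sup>2 * B)"
        using main[of x] by (simp add: norm_mult flip: right_diff_distrib)
    qed
    show "((\<lambda>x. h * (\<bar>c\<bar> / x\<^sup>2 * B)) \<longlongrightarrow> 0) at_top" by real_asymp
  qed
  ultimately show ?thesis using tendsto_add by fastforce
qed

lemma tendsto_energy: "(energy \<longlongrightarrow> 2 * k\<^sup>2 * (norm a)\<^sup>2) at_top"
proof -
  have 1: "((\<lambda>x. norm (v x)) \<longlongrightarrow> norm a) at_top"
    using tendsto_norm[OF tendsto_v] by (simp add: norm_mult)
  have 2: "((\<lambda>x. norm (v' x)) \<longlongrightarrow> k * norm a) at_top"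
    using tendsto_norm[OF tendsto_v'] k by (simp add: norm_mult)
  have 3: "((\<lambda>x. k\<^sup>2 - c / x\<^sup>2) \<longlongrightarrow> k\<^sup>2) at_top" by real_asymp
  have "((\<lambda>x. (norm (v' x))\<^sup>2 + (k\<^sup>2 - c / x\<^sup>2) * (norm (v x))\<^sup>2) \<longlongrightarrow> (k * norm a)\<^sup>2 + k\<^sup>2 * (norm a)\<^sup>2) at_top"
    by (intro tendsto_intros 1 2 3)
  then show ?thesis by (simp add: energy_def[abs_def] power_mult_distrib mult_ac)
qed

lemma tendsto_wronskian: "(wronskian \<longlongrightarrow> k * (norm a)\<^sup>2) at_top"
proof -
  have "((\<lambda>x. Im (cnj (cis (- (k * x)) * v x) * (cis (- (k * x)) * v' x))) \<longlongrightarrow> Im (cnj a * (\<i> * of_real k * a))) at_top"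
    by (intro tendsto_intros tendsto_v tendsto_v')
  moreover have "Im (cnj (cis (- (k * x)) * v x) * (cis (- (k * x)) * v' x)) = wronskian x" for x
  proof -
    have "cnj (cis (- (k * x))) * cis (- (k * x)) = 1" by (simp only: cis_cnj cis_mult) simp
    then have *: "cnj (cis (- (k * x)) * v x) * (cis (- (k * x)) * v' x) = cnj (v x) * v' x"
      by (metis (no_types, lifting) complex_cnj_mult mult.assoc mult.commute mult.left_neutral)
    show ?thesis by (simp only: *) (simp add: wronskian_def)
  qed
  moreover have "Im (cnj a * (\<i> * of_real k * a)) = k * (norm a)\<^sup>2"
    unfolding cmod_power2 by (simp add: algebra_simps power2_eq_square)
  ultimately show ?thesis by (simp only:)
qed

text \<open>Conserved because the coefficient \<open>c / x\<^sup>2 - k\<^sup>2\<close> is real; the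
  value is read off at infinity. This ties \<open>v\<close> to the far field also where
  \<open>c / x\<^sup>2 > k\<^sup>2\<close> and the energy is an indefinite form.\<close>

lemma wronskian_eq:
  assumes "x > R"
  shows "wronskian x = k * (norm a)\<^sup>2"
proof -
  have d: "(wronskian has_real_derivative 0) (at x)" if "x > R" for x
  proof -
    have "((\<lambda>x. Re (v x) * Im (v' x) - Im (v x) * Re (v' x)) has_real_derivative
       (Re (v x) * Im (of_real (c / x\<^sup>2 - k\<^sup>2) * v x) + Re (v' x) * Im (v' x))
       - (Im (v x) * Re (of_real (c / x\<^sup>2 - k\<^sup>2) * v x) + Im (v' x) * Re (v' x))) (at x)"
      by (rule DERIV_cong[OF DERIV_diff[OF
        DERIV_mult[OF has_field_derivative_Re[OF v[OF that]] has_field_derivative_Im[OF v'[OF that]]]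
        DERIV_mult[OF has_field_derivative_Im[OF v[OF that]] has_field_derivative_Re[OF v'[OF that]]]]])
        (simp add: algebra_simps)
    then show ?thesis by (simp add: algebra_simps wronskian_def[abs_def])
  qed
  have "wronskian y = wronskian x" if "y \<ge> x" for y
  proof (rule antisym)
    show "wronskian x \<le> wronskian y"
      using that assms by (intro DERIV_nonneg_imp_nondecreasing[of x y wronskian] exI[of _ 0] conjI d) auto
    show "wronskian y \<le> wronskian x"
      using that assms by (intro DERIV_nonpos_imp_nonincreasing[of x y wronskian] exI[of _ 0] conjI d) auto
  qed
  then have "(wronskian \<longlongrightarrow> wronskian x) at_top"
    by (intro tendsto_eventually eventually_mono[OF eventually_ge_at_top[of x]])
  then show ?thesis by (rule tendsto_unique[OF trivial_limit_at_top_linorder _ tendsto_wronskian])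
qed

text \<open>The equation cancels everything except the derivative of the coefficient
  \<open>k\<^sup>2 - c / x\<^sup>2\<close>, so the direction of monotonicity is the sign of
  \<open>c\<close>.\<close>

lemma deriv_energy:
  assumes "x > R"
  shows "(energy has_real_derivative 2 * c / x ^ 3 * (norm (v x))\<^sup>2) (at x)"
proof -
  have x: "x > 0" using assms R by simp
  have "(energy has_real_derivative
      2 * (Re (v' x) * Re (of_real (c / x\<^sup>2 - k\<^sup>2) * v x) + Im (v' x) * Im (of_real (c / x\<^sup>2 - k\<^sup>2) * v x))
     + ((k\<^sup>2 - c / x\<^sup>2) * (2 * (Re (v x) * Re (v' x) + Im (v x) * Im (v' x))) + (2 * c / x ^ 3) * (norm (v x))\<^sup>2)) (at x)"
    unfolding energy_def[abs_def]
    by (rule DERIV_cong[OF DERIV_add[OF deriv_norm_square[OF v'[OF assms]]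
          DERIV_mult[OF DERIV_diff[OF DERIV_const deriv_div_square[OF x]] deriv_norm_square[OF v[OF assms]]]]])
       (simp add: algebra_simps)
  then show ?thesis by (simp add: algebra_simps)
qed

lemma energy_le:
  assumes "x > R" "c \<ge> 0"
  shows "energy x \<le> 2 * k\<^sup>2 * (norm a)\<^sup>2"
proof (rule tendsto_lowerbound[OF tendsto_energy])
  show "\<forall>\<^sub>F y in at_top. energy x \<le> energy y"
  proof (rule eventually_mono[OF eventually_ge_at_top[of x]])
    fix y assume "x \<le> y"
    then show "energy x \<le> energy y"
    proof (rule DERIV_nonneg_imp_nondecreasing)
      fix t assume "x \<le> t"
      then show "\<exists>D. (energy has_real_derivative D) (at t) \<and> 0 \<le> D"
        using deriv_energy[of t] assms R by (intro exI[of _ "2 * c / t ^ 3 * (norm (v t))\<^sup>2"]) auto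
    qed
  qed
qed auto

text \<open>For negative \<open>c\<close> the energy decreases, but slowly: it is at least
  \<open>k\<^sup>2 * (norm (v x))\<^sup>2\<close>, so its relative rate of decrease is at most 1/(2
  k^2 x^3). The integrating factor exp(-1/(4 k^2 x^2)) compensates exactly this rate, tends to 1 at
  infinity and is at least 1/2 once \<open>k * x \<ge> 1\<close>.\<close>

lemma energy_le_weak:
  assumes x: "x > R" "k * x \<ge> 1" and c: "c < 0" "c \<ge> - 1 / 4"
  shows "energy x \<le> 4 * k\<^sup>2 * (norm a)\<^sup>2"
proof -
  define F where "F y = energy y * exp (- 1 / (4 * k\<^sup>2 * y\<^sup>2))" for y
  have lim: "(F \<longlongrightarrow> (2 * k\<^sup>2 * (norm a)\<^sup>2) * 1) at_top"
    unfolding F_def[abs_def]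
  proof (rule tendsto_mult[OF tendsto_energy])
    show "((\<lambda>y. exp (- 1 / (4 * k\<^sup>2 * y\<^sup>2))) \<longlongrightarrow> 1) at_top" using k by real_asymp
  qed
  have "F x \<le> (2 * k\<^sup>2 * (norm a)\<^sup>2) * 1"
  proof (rule tendsto_lowerbound[OF lim])
    show "\<forall>\<^sub>F y in at_top. F x \<le> F y"
    proof (rule eventually_mono[OF eventually_ge_at_top[of x]])
      fix y assume "x \<le> y"
      then show "F x \<le> F y"
      proof (rule DERIV_nonneg_imp_nondecreasing)
        fix t assume "x \<le> t"
        then have t: "t > R" "t > 0" using x R by auto
        let ?D = "2 * c / t ^ 3 * (norm (v t))\<^sup>2 * exp (- 1 / (4 * k\<^sup>2 * t\<^sup>2)) + exp (- 1 / (4 * k\<^sup>2 * t\<^sup>2)) * (1 / (2 * k\<^sup>2 * t ^ 3)) * energy t"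
        have "(F has_real_derivative ?D) (at t)"
          unfolding F_def[abs_def]
          using DERIV_mult[OF deriv_energy[OF t(1)] DERIV_fun_exp[OF deriv_div_square[OF t(2), of "- 1 / (4 * k\<^sup>2)"]]]
          by simp
        moreover have "?D \<ge> 0"
        proof -
          have "c / t\<^sup>2 \<le> 0" using c by (intro divide_nonpos_nonneg) auto
          then have "(k\<^sup>2 - c / t\<^sup>2) * (norm (v t))\<^sup>2 \<ge> k\<^sup>2 * (norm (v t))\<^sup>2" by (intro mult_right_mono) auto
          then have "energy t \<ge> k\<^sup>2 * (norm (v t))\<^sup>2" using zero_le_power2[of "norm (v' t)"] unfolding energy_def by linarith
          then have "(1 / (2 * k\<^sup>2 * t ^ 3)) * energy t \<ge> (1 / (2 * k\<^sup>2 * t ^ 3)) * (k\<^sup>2 * (norm (v t))\<^sup>2)"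
            using t by (intro mult_left_mono) auto
          also have "(1 / (2 * k\<^sup>2 * t ^ 3)) * (k\<^sup>2 * (norm (v t))\<^sup>2) = (1 / 2) / t ^ 3 * (norm (v t))\<^sup>2" using k by simp
          finally have "2 * c / t ^ 3 * (norm (v t))\<^sup>2 + (1 / (2 * k\<^sup>2 * t ^ 3)) * energy t
             \<ge> (2 * c + 1/2) / t ^ 3 * (norm (v t))\<^sup>2"
            by (simp only: add_divide_distrib distrib_right)
          moreover have "(2 * c + 1/2) / t ^ 3 * (norm (v t))\<^sup>2 \<ge> 0" using c t by auto
          ultimately have "exp (- 1 / (4 * k\<^sup>2 * t\<^sup>2)) * (2 * c / t ^ 3 * (norm (v t))\<^sup>2 + (1 / (2 * k\<^sup>2 * t ^ 3)) * energy t) \<ge> 0"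
            by (intro mult_nonneg_nonneg) auto
          then show ?thesis by (simp only: distrib_left mult_ac)
        qed
        ultimately show "\<exists>D. (F has_real_derivative D) (at t) \<and> 0 \<le> D" by (intro exI[of _ ?D] conjI)
      qed
    qed
  qed (rule trivial_limit_at_top_linorder)
  moreover have "exp (- 1 / (4 * k\<^sup>2 * x\<^sup>2)) \<ge> 1 / 2"
  proof -
    have "(k * x)\<^sup>2 \<ge> 1" using x(2) by simp
    then have "1 / (4 * k\<^sup>2 * x\<^sup>2) \<le> 1 / 2" by (simp add: field_simps power_mult_distrib)
    then have "- 1 / (4 * k\<^sup>2 * x\<^sup>2) \<ge> - 1 / 2" by simp
    moreover have "1 + (- 1 / (4 * k\<^sup>2 * x\<^sup>2)) \<le> exp (- 1 / (4 * k\<^sup>2 * x\<^sup>2))" by (rule exp_ge_add_one_self)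
    ultimately show ?thesis by linarith
  qed
  moreover have "energy x \<ge> 0"
  proof -
    have "c / x\<^sup>2 \<le> 0" using c by (intro divide_nonpos_nonneg) auto
    then show ?thesis unfolding energy_def by (intro add_nonneg_nonneg mult_nonneg_nonneg) (auto intro: order_trans)
  qed
  ultimately have "energy x * (1 / 2) \<le> energy x * exp (- 1 / (4 * k\<^sup>2 * x\<^sup>2))"
    by (intro mult_left_mono) auto
  with \<open>F x \<le> _\<close> show ?thesis unfolding F_def by simp
qed

end

section \<open>Pointwise bounds for a mode, uniform in \<open>c\<close>\<close>

text \<open>Turns powers with different bases into exponentials, so that gains and losses can be
  compared in the exponent; \<open>m\<close> bounds the logarithm of the base.\<close>

lemma powr_le_exp:
  fixes x :: real
  assumes "0 < x" "x \<le> exp m" "0 \<le> b"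
  shows "x powr b \<le> exp (m * b)"
proof -
  have "x powr b \<le> exp m powr b" using assms by (intro powr_mono2) auto
  also have "\<dots> = exp (m * b)" by (simp add: powr_def mult.commute)
  finally show ?thesis .
qed

context radial_mode
begin

text \<open>The last assumption says
  \<open>k\<^sup>2 - c / x\<^sup>2 \<ge> \<eta> * k\<^sup>2\<close>: the energy is coercive at
  \<open>x\<close>, and its bound by the far field bounds \<open>v\<close>.\<close>

lemma oscillatory_bound:
  assumes x: "x > R" "k * x \<ge> 1" and c: "c \<ge> - 1 / 4" and \<eta>: "\<eta> > 0" "c \<le> (1 - \<eta>) * (k * x)\<^sup>2"
  shows "(norm (v x))\<^sup>2 \<le> 4 / \<eta> * (norm a)\<^sup>2"
proof -
  have x0: "x > 0" using x R by simp
  have "energy x \<le> 4 * k\<^sup>2 * (norm a)\<^sup>2"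
  proof (cases "c < 0")
    case False
    then have "energy x \<le> 2 * (k\<^sup>2 * (norm a)\<^sup>2)" using energy_le[OF x(1)] by (simp add: mult.assoc)
    moreover have "0 \<le> k\<^sup>2 * (norm a)\<^sup>2" by simp
    ultimately show ?thesis by linarith
  qed (use energy_le_weak x c in auto)
  moreover have "c / x\<^sup>2 \<le> (1 - \<eta>) * k\<^sup>2"
    using \<eta>(2) x0 by (simp add: field_simps power_mult_distrib)
  then have "\<eta> * k\<^sup>2 * (norm (v x))\<^sup>2 \<le> (k\<^sup>2 - c / x\<^sup>2) * (norm (v x))\<^sup>2"
    by (intro mult_right_mono) (auto simp: algebra_simps)
  then have "\<eta> * k\<^sup>2 * (norm (v x))\<^sup>2 \<le> energy x"
    unfolding energy_def using zero_le_power2[of "norm (v' x)"] by linarith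
  ultimately have "k\<^sup>2 * (\<eta> * (norm (v x))\<^sup>2) \<le> k\<^sup>2 * (4 * (norm a)\<^sup>2)" by (simp add: mult_ac)
  then have "\<eta> * (norm (v x))\<^sup>2 \<le> 4 * (norm a)\<^sup>2" using k by simp
  then show ?thesis using \<eta>(1) by (simp add: field_simps)
qed

text \<open>The squared modulus of \<open>cnj (v x) * v' x\<close>, split into its real part, which
  is half the derivative of \<open>(norm (v x))\<^sup>2\<close>, and its imaginary part, the
  Wronskian.\<close>

lemma lagrange_identity:
  "(Re (v x) * Re (v' x) + Im (v x) * Im (v' x))\<^sup>2 + (wronskian x)\<^sup>2 = (norm (v x))\<^sup>2 * (norm (v' x))\<^sup>2"
  unfolding wronskian_def cmod_power2 by (simp add: power2_eq_square algebra_simps)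

text \<open>With p the square of |v|, multiply the energy bound by p, replace p |v'|^2 by the
  Lagrange identity and the Wronskian by k |a|^2, and complete the square in p - |a|^2. Dropping the
  second square bounds the logarithmic derivative of p; dropping the first bounds p from below by
  |a|^2.\<close>

lemma radial_inequality:
  assumes "x > R" "c \<ge> 0"
  shows "(Re (v x) * Re (v' x) + Im (v x) * Im (v' x))\<^sup>2 + k\<^sup>2 * ((norm (v x))\<^sup>2 - (norm a)\<^sup>2)\<^sup>2
           \<le> c / x\<^sup>2 * ((norm (v x))\<^sup>2)\<^sup>2"
proof -
  let ?p = "(norm (v x))\<^sup>2"
  have "?p * (norm (v' x))\<^sup>2 \<le> ?p * (2 * k\<^sup>2 * (norm a)\<^sup>2 - (k\<^sup>2 - c / x\<^sup>2) * ?p)"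
    using energy_le[OF assms] by (intro mult_left_mono) (auto simp: energy_def)
  then show ?thesis
    using lagrange_identity[of x] unfolding wronskian_eq[OF assms(1)]
    by (simp add: power2_eq_square algebra_simps)
qed

text \<open>By \<open>radial_inequality\<close> the derivative of |v|^2 is at most (2 sqrt c / t)
  |v|^2 in absolute value, which the power compensates. It carries a bound inwards, from
  \<open>y\<close> to \<open>x\<close>, at the price of a power of \<open>y / x\<close>.\<close>

lemma norm_growth:
  assumes c: "c \<ge> 0" and xy: "R < x" "x \<le> y"
  shows "(norm (v x))\<^sup>2 * x powr (2 * sqrt c) \<le> (norm (v y))\<^sup>2 * y powr (2 * sqrt c)"
proof (rule DERIV_nonneg_imp_nondecreasing[OF xy(2)])
  fix t assume "x \<le> t"
  then have t: "t > R" "t > 0" using xy R by auto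
  let ?p = "(norm (v t))\<^sup>2" and ?d = "Re (v t) * Re (v' t) + Im (v t) * Im (v' t)"
  let ?D = "2 * ?d * t powr (2 * sqrt c) + 2 * sqrt c * t powr (2 * sqrt c - 1) * ?p"
  have "((\<lambda>x. (norm (v x))\<^sup>2 * x powr (2 * sqrt c)) has_real_derivative ?D) (at t)"
    by (rule DERIV_cong[OF DERIV_mult[OF deriv_norm_square[OF v[OF t(1)]] DERIV_fun_powr[OF DERIV_ident t(2), of "2 * sqrt c"]]])
       simp
  moreover have "?D \<ge> 0"
  proof -
    have "?d\<^sup>2 \<le> c / t\<^sup>2 * ?p\<^sup>2"
      using radial_inequality[OF t(1) c] zero_le_power2[of "k * (?p - (norm a)\<^sup>2)"]
      unfolding power_mult_distrib by linarith
    also have "\<dots> = (sqrt c / t * ?p)\<^sup>2" using c by (simp add: power_mult_distrib power_divide)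
    finally have "\<bar>?d\<bar> \<le> \<bar>sqrt c / t * ?p\<bar>" by (simp only: abs_le_square_iff)
    then have "\<bar>?d\<bar> \<le> sqrt c / t * ?p" using c t by (simp add: abs_mult)
    then have "0 \<le> 2 * t powr (2 * sqrt c) * (?d + sqrt c / t * ?p)" by (intro mult_nonneg_nonneg) auto
    also have "\<dots> = ?D" using t by (simp add: powr_diff algebra_simps)
    finally show ?thesis .
  qed
  ultimately show "\<exists>D. ((\<lambda>x. (norm (v x))\<^sup>2 * x powr (2 * sqrt c)) has_real_derivative D) (at t) \<and> 0 \<le> D"
    by (intro exI[of _ ?D] conjI)
qed

text \<open>The barrier \<open>P\<close> combines the two solutions t^(-b) and t^(b+1) of P'' =
  b(b+1)/t^2 P, weighted so that \<open>P\<close> dominates |v| at both ends. Below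
  \<open>x\<^sub>2\<close> the true coefficient \<open>c / t\<^sup>2 - k\<^sup>2\<close> is positive
  and at least b(b+1)/t^2, so the maximum principle keeps a real part of \<open>v\<close> under the
  barrier.\<close>

lemma evanescent_comparison:
  assumes x01: "R < x\<^sub>1" "x\<^sub>1 \<le> x" "x \<le> x\<^sub>2" and b: "0 \<le> b" "b * (b + 1) \<le> c - (k * x\<^sub>2)\<^sup>2" "(k * x\<^sub>2)\<^sup>2 < c"
  shows "norm (v x) \<le> norm (v x\<^sub>1) * (x\<^sub>1 / x) powr b + norm (v x\<^sub>2) * (x / x\<^sub>2) powr (b + 1)"
proof -
  have pos: "x\<^sub>1 > 0" "x > 0" "x\<^sub>2 > 0" using x01 R by auto
  \<comment> \<open>A fixed phase that makes \<open>w * v x\<close> equal to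
    \<open>norm (v x)\<close>. Since \<open>w\<close> is constant, the real function
    \<open>Re (w * v t)\<close> solves the same equation, and it never exceeds
    \<open>norm (v t)\<close>.\<close>
  define w where "w = cnj (sgn (v x))"
  have w: "norm w \<le> 1" by (simp add: w_def norm_sgn)
  have wv: "Re (w * v x) = norm (v x)"
  proof (cases "v x = 0")
    case False
    then have "w * v x = of_real (norm (v x))"
      by (simp add: w_def sgn_eq complex_norm_square[symmetric] power2_eq_square mult.commute)
    then show ?thesis by simp
  qed simp
  define P where "P t = norm (v x\<^sub>1) * x\<^sub>1 powr b * t powr (- b) + norm (v x\<^sub>2) * x\<^sub>2 powr (- (b + 1)) * t powr (b + 1)" for t
  have Peq: "P t = norm (v x\<^sub>1) * (x\<^sub>1 / t) powr b + norm (v x\<^sub>2) * (t / x\<^sub>2) powr (b + 1)" if "t > 0" for t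
  proof -
    have "x\<^sub>2 powr (- (b + 1)) = 1 / x\<^sub>2 powr (b + 1)" "t powr (- b) = 1 / t powr b"
      by (rule powr_minus_divide)+
    then show ?thesis using pos that unfolding P_def by (simp add: powr_divide)
  qed
  define P' where "P' t = norm (v x\<^sub>1) * x\<^sub>1 powr b * (- b * t powr (- b - 1)) + norm (v x\<^sub>2) * x\<^sub>2 powr (- (b + 1)) * ((b + 1) * t powr b)" for t
  have P: "(P has_real_derivative P' t) (at t)" if "t > 0" for t
    unfolding P_def[abs_def] P'_def using that
    by (intro DERIV_add DERIV_cmult DERIV_cong[OF DERIV_fun_powr[OF DERIV_ident that]]) auto
  have P': "(P' has_real_derivative (b * (b + 1)) / t\<^sup>2 * P t) (at t)" if "t > 0" for t
  proof -
    have 1: "((\<lambda>t. - b * t powr (- b - 1)) has_real_derivative (b * (b + 1)) / t\<^sup>2 * t powr (- b)) (at t)"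
      by (rule DERIV_cong[OF DERIV_cmult[OF DERIV_fun_powr[OF DERIV_ident that]]])
         (use that in \<open>simp add: field_simps powr_diff power2_eq_square powr_minus\<close>)
    have 2: "((\<lambda>t. (b + 1) * t powr b) has_real_derivative (b * (b + 1)) / t\<^sup>2 * t powr (b + 1)) (at t)"
      by (rule DERIV_cong[OF DERIV_cmult[OF DERIV_fun_powr[OF DERIV_ident that]]])
         (use that in \<open>simp add: field_simps powr_diff powr_add power2_eq_square\<close>)
    show ?thesis
      unfolding P'_def[abs_def]
      by (rule DERIV_cong[OF DERIV_add[OF DERIV_cmult[OF 1] DERIV_cmult[OF 2]]]) (simp add: P_def algebra_simps)
  qed
  have Ppos: "P t \<ge> 0" for t using b by (auto simp: P_def)
  have dy: "((\<lambda>t. Re (w * v t)) has_real_derivative Re (w * v' t)) (at t)" if "t > R" for t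
    by (rule has_field_derivative_Re, rule has_vector_derivative_mult_right[OF v[OF that]])
  have dy': "((\<lambda>t. Re (w * v' t)) has_real_derivative (c / t\<^sup>2 - k\<^sup>2) * Re (w * v t)) (at t)" if "t > R" for t
    by (rule DERIV_cong[OF has_field_derivative_Re[OF has_vector_derivative_mult_right[OF v'[OF that]]]])
       (subst mult.left_commute, simp)
  have q: "b * (b + 1) / t\<^sup>2 \<le> c / t\<^sup>2 - k\<^sup>2" "c / t\<^sup>2 - k\<^sup>2 > 0" if "x\<^sub>1 < t" "t < x\<^sub>2" for t
  proof -
    have t: "t > 0" using that pos by simp
    have "(k * t)\<^sup>2 \<le> (k * x\<^sub>2)\<^sup>2" using that t k by (intro power_mono mult_left_mono) auto
    then have "(b * (b + 1) + (k * t)\<^sup>2) / t\<^sup>2 \<le> c / t\<^sup>2" "(k * t)\<^sup>2 / t\<^sup>2 < c / t\<^sup>2"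
      using b t by (auto intro!: divide_right_mono divide_strict_right_mono)
    then show "b * (b + 1) / t\<^sup>2 \<le> c / t\<^sup>2 - k\<^sup>2" "c / t\<^sup>2 - k\<^sup>2 > 0"
      using t by (auto simp: add_divide_distrib power_mult_distrib)
  qed
  have "Re (w * v x) - P x \<le> 0"
  proof (rule nonpos_of_second_derivative_ge[where z = "\<lambda>t. Re (w * v t) - P t" and z' = "\<lambda>t. Re (w * v' t) - P' t" and Q = "\<lambda>t. c / t\<^sup>2 - k\<^sup>2"
        and z'' = "\<lambda>t. (c / t\<^sup>2 - k\<^sup>2) * Re (w * v t) - b * (b + 1) / t\<^sup>2 * P t" and a = x\<^sub>1 and b = x\<^sub>2])
    show "continuous_on {x\<^sub>1..x\<^sub>2} (\<lambda>t. Re (w * v t) - P t)"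
    proof (rule continuous_at_imp_continuous_on, rule ballI)
      fix t assume "t \<in> {x\<^sub>1..x\<^sub>2}"
      then have "t > R" "t > 0" using x01 pos by auto
      then show "isCont (\<lambda>t. Re (w * v t) - P t) t"
        by (intro DERIV_isCont[OF DERIV_diff[OF dy P]])
    qed
    show "((\<lambda>t. Re (w * v t) - P t) has_real_derivative Re (w * v' t) - P' t) (at t)" if "x\<^sub>1 < t" for t
      using that x01 pos by (intro DERIV_diff dy P) auto
    show "((\<lambda>t. Re (w * v' t) - P' t) has_real_derivative (c / t\<^sup>2 - k\<^sup>2) * Re (w * v t) - b * (b + 1) / t\<^sup>2 * P t) (at t)"
      if "x\<^sub>1 < t" for t
      using that x01 pos by (intro DERIV_diff dy' P') auto
    show "c / t\<^sup>2 - k\<^sup>2 > 0" if "x\<^sub>1 < t" "t < x\<^sub>2" for t using q that by blast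
    show "(c / t\<^sup>2 - k\<^sup>2) * (Re (w * v t) - P t) \<le> (c / t\<^sup>2 - k\<^sup>2) * Re (w * v t) - b * (b + 1) / t\<^sup>2 * P t"
      if "x\<^sub>1 < t" "t < x\<^sub>2" for t
      using mult_right_mono[OF q(1)[OF that] Ppos[of t]] by (simp add: algebra_simps)
    have le: "Re (w * v t) \<le> norm (v t)" for t
      using complex_Re_le_cmod[of "w * v t"] mult_right_mono[OF w norm_ge_zero[of "v t"]] by (simp add: norm_mult)
    show "Re (w * v x\<^sub>1) - P x\<^sub>1 \<le> 0"
      
    proof -
      have "0 \<le> norm (v x\<^sub>2) * (x\<^sub>1 / x\<^sub>2) powr (b + 1)" by simp
      then have "norm (v x\<^sub>1) \<le> P x\<^sub>1" using Peq[OF pos(1)] pos by simp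
      then show ?thesis using le[of x\<^sub>1] by linarith
    qed
    show "Re (w * v x\<^sub>2) - P x\<^sub>2 \<le> 0"
      
    proof -
      have "0 \<le> norm (v x\<^sub>1) * (x\<^sub>1 / x\<^sub>2) powr b" by simp
      then have "norm (v x\<^sub>2) \<le> P x\<^sub>2" using Peq[OF pos(3)] pos by simp
      then show ?thesis using le[of x\<^sub>2] by linarith
    qed
    show "x \<in> {x\<^sub>1..x\<^sub>2}" using x01 by simp
  qed
  then show ?thesis using wv Peq[OF pos(2)] by simp
qed

text \<open>The radii \<open>xm < xb < xt\<close> in the proof are multiples of the turning point \<open>sqrt c / k\<close>.  Up to \<open>xb\<close> the mode
  decays at least like \<open>x powr (- b)\<close> away from the two end points, and at \<open>xt\<close> it is bounded by
  its far field.  The loss \<open>exp (3/10 sqrt c)\<close> between \<open>xb\<close> and \<open>xt\<close> is beaten by the decay.\<close>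

lemma mode_bound:
  assumes R\<^sub>0: "R < R\<^sub>0" "k * R\<^sub>0 \<ge> 4" and r: "r \<ge> 8 * R\<^sub>0" and c: "c \<ge> - 1 / 4"
  shows "(norm (v r))\<^sup>2 \<le> 40000 * ((norm a)\<^sup>2 + exp (- (k * r / 2)) * (norm (v R\<^sub>0))\<^sup>2)"
\<comment> \<open>Here 1 - 31/256 = (15/16)^2. Either the mode is oscillatory at \<open>r\<close>
  with margin \<eta> = 31/256, or \<open>r\<close> is below 16/15 times the turning point, the
  radius called \<open>xt\<close>.\<close>
proof (cases "c \<le> (1 - 31 / 256) * (k * r)\<^sup>2")
  case True
  have "k * r \<ge> 8 * (k * R\<^sub>0)" using r k by (simp add: mult.left_commute)
  then have "(norm (v r))\<^sup>2 \<le> 4 / (31 / 256) * (norm a)\<^sup>2"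
    using R\<^sub>0 r R c True by (intro oscillatory_bound) auto
  also have "\<dots> \<le> 40000 * (norm a)\<^sup>2" by simp
  also have "\<dots> \<le> 40000 * ((norm a)\<^sup>2 + exp (- (k * r / 2)) * (norm (v R\<^sub>0))\<^sup>2)" by simp
  finally show ?thesis .
next
  case False
  have pos: "R\<^sub>0 > 0" "r > 0" "k * r > 0" using R R\<^sub>0 r k by auto
  have kr: "k * r \<ge> 8 * (k * R\<^sub>0)" using r k by (simp add: mult.left_commute)
  define \<tau> where "\<tau> = sqrt c"
  have "c > (15 / 16 * (k * r))\<^sup>2" using False by (simp add: power_mult_distrib power_divide)
  then have \<tau>: "\<tau> > 15 / 16 * (k * r)" unfolding \<tau>_def by (rule real_less_rsqrt)
  then have \<tau>30: "\<tau> \<ge> 30" using kr R\<^sub>0 by linarith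
  have "c \<ge> 0" using \<open>c > (15 / 16 * (k * r))\<^sup>2\<close> zero_le_power2[of "15 / 16 * (k * r)"] by linarith
  then have c\<tau>: "c = \<tau>\<^sup>2" "c \<ge> 0" unfolding \<tau>_def by auto
  define xt xb xm where "xt = 16 / 15 * (\<tau> / k)" and "xb = 4 / 5 * (\<tau> / k)" and "xm = 2 / 5 * (\<tau> / k)"
  \<comment> \<open>At \<open>xb\<close> one has
    \<open>c - (k * xb)\<^sup>2 = (3/5 * \<tau>)\<^sup>2\<close>, and b(b+1) = (b + 1/2)^2 - 1/4, so
    this is the exponent that the comparison at \<open>xb\<close> admits, up to the slack
    1/4.\<close>
  define b where "b = 3 / 5 * \<tau> - 1 / 2"
  have b: "b \<ge> 0" "b * (b + 1) \<le> c - (k * xb)\<^sup>2" "(k * xb)\<^sup>2 < c"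
  proof -
    have kxb: "(k * xb)\<^sup>2 = 16 / 25 * \<tau>\<^sup>2" using k by (simp add: xb_def power_mult_distrib power_divide)
    have "b * (b + 1) = 9 / 25 * \<tau>\<^sup>2 - 1 / 4" by (simp add: b_def power2_eq_square algebra_simps)
    then show "b * (b + 1) \<le> c - (k * xb)\<^sup>2" unfolding kxb c\<tau>(1) by linarith
    have "\<tau>\<^sup>2 > 0" using \<tau>30 by simp
    then show "(k * xb)\<^sup>2 < c" unfolding kxb c\<tau>(1) by linarith
    show "b \<ge> 0" using \<tau>30 by (simp add: b_def)
  qed
  have "\<tau> / k > 15 / 16 * r" using \<tau> k by (simp add: field_simps)
  then have ord: "r < xt" "3 * R\<^sub>0 < xm" "2 * xm = xb" "xb < xt"
    using r pos unfolding xt_def xb_def xm_def by linarith+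
  let ?A = "norm a" and ?V = "norm (v R\<^sub>0)"
  \<comment> \<open>The ratio \<open>xt / xb\<close> is 4/3, so \<open>e1\<close> bounds the loss
    between these radii by the exponential of 3/10 \<tau>; \<open>e2\<close>, that is ln 2 \<ge>
    2/3, measures the gain when a radius is halved.\<close>
  have e1: "4 / 3 \<le> exp (3 / 10 :: real)" using exp_lower_Taylor_quadratic[of "3 / 10 :: real"] by (simp add: power2_eq_square)
  have e2: "1 / 2 \<le> exp (- (2 / 3) :: real)" 
  proof -
    have "exp (2 / 3 :: real) \<le> exp (ln 2)" using ln2_ge_two_thirds by (simp only: exp_le_cancel_iff)
    then show ?thesis by (simp add: exp_minus field_simps)
  qed
  \<comment> \<open>The choice of \<open>xt\<close> gives the oscillatory bound there with the same
    margin, and 4/(31/256) \<le> 36. Monotonicity of |v|^2 times the power then brings the bound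
    inwards to \<open>x\<close>.\<close>
  have far: "norm (v x) \<le> 6 * ?A * exp (3 / 10 * \<tau>)" if "xb \<le> x" "x \<le> xt" for x
  proof -
    have x: "x > R" "x > 0" using that ord R\<^sub>0 pos by auto
    have "(norm (v xt))\<^sup>2 \<le> 4 / (31 / 256) * ?A\<^sup>2"
    proof (rule oscillatory_bound)
      show "xt > R" using x that by simp
      show "k * xt \<ge> 1" using k \<tau>30 by (simp add: xt_def)
      show "c \<le> (1 - 31 / 256) * (k * xt)\<^sup>2" using k by (simp add: xt_def c\<tau> power_mult_distrib power_divide)
    qed (use c in auto)
    also have "4 / (31 / 256) * ?A\<^sup>2 \<le> 36 * ?A\<^sup>2" by (intro mult_right_mono) auto
    finally have xt: "(norm (v xt))\<^sup>2 \<le> 36 * ?A\<^sup>2" .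
    have "(norm (v x))\<^sup>2 * x powr (2 * \<tau>) \<le> (norm (v xt))\<^sup>2 * xt powr (2 * \<tau>)"
      using norm_growth[OF c\<tau>(2) x(1) that(2)] unfolding \<tau>_def .
    then have "(norm (v x))\<^sup>2 \<le> (norm (v xt))\<^sup>2 * (xt / x) powr (2 * \<tau>)"
      using x ord by (simp add: powr_divide field_simps)
    also have "\<dots> \<le> (36 * ?A\<^sup>2) * exp (3 / 10 * (2 * \<tau>))"
    proof (intro mult_mono xt powr_le_exp)
      have "xt = 4 / 3 * xb" by (simp add: xt_def xb_def)
      then have "xt / x \<le> 4 / 3" using x that by (simp add: field_simps)
      then show "xt / x \<le> exp (3 / 10)" using e1 by linarith
    qed (use x ord pos \<tau>30 in auto)
    also have "\<dots> = (6 * ?A * exp (3 / 10 * \<tau>))\<^sup>2" by (simp add: power_mult_distrib exp_double[symmetric] mult_ac)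
    finally show ?thesis by (rule power2_le_imp_le) simp
  qed
  have near: "norm (v x) \<le> ?V * (R\<^sub>0 / x) powr b + 6 * ?A * exp (3 / 10 * \<tau>) * (x / xb) powr (b + 1)"
    if "R\<^sub>0 \<le> x" "x \<le> xb" for x
  proof -
    have "norm (v x) \<le> ?V * (R\<^sub>0 / x) powr b + norm (v xb) * (x / xb) powr (b + 1)"
      using that R\<^sub>0 b by (intro evanescent_comparison)
    moreover have "norm (v xb) * (x / xb) powr (b + 1) \<le> 6 * ?A * exp (3 / 10 * \<tau>) * (x / xb) powr (b + 1)"
      using ord by (intro mult_right_mono far) auto
    ultimately show ?thesis by linarith
  qed
  \<comment> \<open>Fixed by what follows: 6 * 2/30 = 2/5 stays below the 1/2 in
    \<open>lower\<close>, so that the far-field term can be absorbed there.\<close>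
  have e3: "exp (- (1 / 10) * \<tau>) \<le> 2 / 30"
  proof -
    have "exp (- (1 / 10) * \<tau>) \<le> exp (- 3)" using \<tau>30 by simp
    also have "\<dots> \<le> 2 / 30"
    proof -
      have "(5 / 2) ^ 3 \<le> exp (1 :: real) ^ 3"
        using exp_lower_Taylor_quadratic[of "1 :: real"] by (intro power_mono) auto
      also have "\<dots> = exp 3" by (simp flip: exp_of_nat_mult)
      finally show ?thesis by (simp add: exp_minus field_simps)
    qed
    finally show ?thesis .
  qed
  \<comment> \<open>Below half of \<open>xb\<close> the power gains exp(-2/5 \<tau>), which
    outweighs the loss exp(3/10 \<tau>).\<close>
  have near': "norm (v x) \<le> ?V * (R\<^sub>0 / x) powr b + 2 / 5 * ?A" if "R\<^sub>0 \<le> x" "x \<le> xm" for x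
  proof -
    have "(x / xb) powr (b + 1) \<le> exp (- (2 / 3) * (b + 1))"
    proof (rule powr_le_exp)
      have "x / xb \<le> 1 / 2" using that ord pos by (simp add: field_simps)
      then show "x / xb \<le> exp (- (2 / 3))" using e2 by linarith
    qed (use that ord pos b in auto)
    also have "\<dots> \<le> exp (- (2 / 5) * \<tau>)" by (simp add: b_def field_simps)
    finally have "exp (3 / 10 * \<tau>) * (x / xb) powr (b + 1) \<le> exp (3 / 10 * \<tau>) * exp (- (2 / 5) * \<tau>)"
      by (rule mult_left_mono) simp
    also have "\<dots> = exp (- (1 / 10) * \<tau>)" by (simp add: exp_add[symmetric])
    also note e3
    finally have "6 * ?A * (exp (3 / 10 * \<tau>) * (x / xb) powr (b + 1)) \<le> 6 * ?A * (2 / 30)"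
      by (intro mult_left_mono) auto
    then show ?thesis using near[of x] that ord pos by (simp add: mult.assoc xb_def xm_def)
  qed
  \<comment> \<open>The ratio of the radii is at most 1/8 \<le> exp(-2), and 2b = 6/5 \<tau> - 1
    with \<tau> > 15/16 k r leaves ample room. The exponent k r/4 becomes k r/2 on squaring.\<close>
  have small: "(R\<^sub>0 / r) powr b \<le> 3 * exp (- (k * r / 4))"
  proof -
    have "(R\<^sub>0 / r) powr b \<le> exp (- 2 * b)"
    proof (rule powr_le_exp)
      have "R\<^sub>0 / r \<le> (1 / 2) ^ 3" using r pos by (simp add: field_simps)
      also have "\<dots> \<le> exp (- (2 / 3)) ^ 3" using e2 by (intro power_mono) auto
      also have "\<dots> = exp (- 2 :: real)" by (simp add: exp_of_nat_mult[symmetric])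
      finally show "R\<^sub>0 / r \<le> exp (- 2)" .
    qed (use pos b in auto)
    also have "\<dots> \<le> exp (1 + - (k * r / 4))" using \<tau> pos by (simp add: b_def)
    also have "\<dots> \<le> 3 * exp (- (k * r / 4))" unfolding exp_add using exp_le by (intro mult_right_mono) auto
    finally show ?thesis .
  qed
  \<comment> \<open>The common end of all remaining cases, each of which needs at most 120 + 3 \<le>
    130. Squaring with (x + y)^2 \<le> 2 x^2 + 2 y^2 gives 2 * 130^2 = 33800, hence the
    40000.\<close>
  have final: "(norm (v r))\<^sup>2 \<le> 40000 * ((norm a)\<^sup>2 + exp (- (k * r / 2)) * ?V\<^sup>2)"
    if "norm (v r) \<le> 130 * (exp (- (k * r / 4)) * ?V) + ?A"
  proof -
    have "(norm (v r))\<^sup>2 \<le> (130 * (exp (- (k * r / 4)) * ?V) + ?A)\<^sup>2" using that by (intro power_mono) auto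
    also have "\<dots> \<le> 2 * (130 * (exp (- (k * r / 4)) * ?V))\<^sup>2 + 2 * ?A\<^sup>2"
      using zero_le_power2[of "130 * (exp (- (k * r / 4)) * ?V) - ?A"] unfolding power2_sum power2_diff by linarith
    also have "(130 * (exp (- (k * r / 4)) * ?V))\<^sup>2 = 16900 * (exp (- (k * r / 2)) * ?V\<^sup>2)"
      by (simp add: power_mult_distrib exp_double[symmetric])
    also have "2 * (16900 * (exp (- (k * r / 2)) * ?V\<^sup>2)) + 2 * ?A\<^sup>2 \<le> 40000 * ((norm a)\<^sup>2 + exp (- (k * r / 2)) * ?V\<^sup>2)"
      by simp
    finally show ?thesis .
  qed
  have Vs: "?V * (R\<^sub>0 / r) powr b \<le> 3 * (exp (- (k * r / 4)) * ?V)"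
    using mult_left_mono[OF small norm_ge_zero[of "v R\<^sub>0"]] by (simp add: mult_ac)
  show ?thesis
  proof (cases "r \<le> xm")
    case True
    then have "norm (v r) \<le> ?V * (R\<^sub>0 / r) powr b + 2 / 5 * ?A" using r pos by (intro near') auto
    moreover have "0 \<le> exp (- (k * r / 4)) * ?V" by simp
    ultimately show ?thesis using Vs norm_ge_zero[of a] by (intro final) linarith
  next
    case False
    have "xm > R" using ord R\<^sub>0 R by linarith
    \<comment> \<open>At \<open>xm\<close> the coefficient \<open>c / xm\<^sup>2\<close> is 25/4
      k^2, so \<open>radial_inequality\<close> without its derivative term gives | p - |a|^2 | \<le>
      5/2 p. If p were below |a|^2/4, this would make |a|^2 at most 7/2 p < |a|^2.\<close>
    have lower: "?A / 2 \<le> norm (v xm)"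
    proof (rule ccontr)
      assume "\<not> ?A / 2 \<le> norm (v xm)"
      then have lt: "(norm (v xm))\<^sup>2 < (?A / 2)\<^sup>2" and A: "?A > 0"
        using norm_ge_zero[of "v xm"] by (auto intro!: power_strict_mono)
      define p where "p = (norm (v xm))\<^sup>2"
      have p: "0 \<le> p" "p < ?A\<^sup>2 / 4" using lt by (auto simp: p_def power_divide)
      have cx: "c / xm\<^sup>2 = 25 / 4 * k\<^sup>2" using k \<tau>30 by (simp add: c\<tau> xm_def power_mult_distrib power_divide)
      then have "k\<^sup>2 * (p - ?A\<^sup>2)\<^sup>2 \<le> 25 / 4 * k\<^sup>2 * p\<^sup>2"
        using radial_inequality[OF \<open>xm > R\<close> c\<tau>(2)] zero_le_power2[of "Re (v xm) * Re (v' xm) + Im (v xm) * Im (v' xm)"]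
        unfolding p_def cx by linarith
      then have "k\<^sup>2 * (?A\<^sup>2 - p)\<^sup>2 \<le> k\<^sup>2 * (5 / 2 * p)\<^sup>2" by (simp add: power_mult_distrib power_divide power2_commute mult_ac)
      then have "(?A\<^sup>2 - p)\<^sup>2 \<le> (5 / 2 * p)\<^sup>2" using k by simp
      then have "?A\<^sup>2 - p \<le> 5 / 2 * p" by (rule power2_le_imp_le) (use p in simp)
      moreover have "?A\<^sup>2 > 0" using A by simp
      ultimately show False using p by linarith
    qed
    have "(R\<^sub>0 / xm) powr b \<le> exp (- 1 * b)"
    proof (rule powr_le_exp)
      have "R\<^sub>0 / xm \<le> 1 / 3" using ord pos by (simp add: field_simps)
      also have "\<dots> \<le> exp (- 1 :: real)" using exp_le by (simp add: exp_minus field_simps)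
      finally show "R\<^sub>0 / xm \<le> exp (- 1)" .
    qed (use ord pos b in auto)
    also have "\<dots> \<le> 2 * exp (- (3 / 5) * \<tau>)"
    proof -
      have "exp (- 1 * b) = exp (1 / 2) * exp (- (3 / 5) * \<tau>)" by (simp add: b_def flip: exp_add)
      moreover have "exp (1 / 2 :: real) \<le> 2"
      proof (rule power2_le_imp_le)
        show "(exp (1 / 2 :: real))\<^sup>2 \<le> 2\<^sup>2" using exp_le by (simp add: exp_double[symmetric])
      qed simp
      ultimately show ?thesis by simp
    qed
    finally have "?V * (R\<^sub>0 / xm) powr b \<le> ?V * (2 * exp (- (3 / 5) * \<tau>))" by (rule mult_left_mono) simp
    moreover have "norm (v xm) \<le> ?V * (R\<^sub>0 / xm) powr b + 2 / 5 * ?A" using ord pos by (intro near') auto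
    \<comment> \<open>The term 2/5 |a| is absorbed in |a|/2, which leaves |a|/10. So the far-field
      coefficient is itself exponentially small against |v(R0)|, with the exponent 3/5 \<tau>, twice
      what the loss 3/10 \<tau> costs.\<close>
    ultimately have A: "?A \<le> 20 * (?V * exp (- (3 / 5) * \<tau>))" using lower by linarith
    then have "6 * ?A * exp (3 / 10 * \<tau>) \<le> 6 * (20 * (?V * exp (- (3 / 5) * \<tau>))) * exp (3 / 10 * \<tau>)"
      by (intro mult_right_mono mult_left_mono) auto
    also have "\<dots> = 120 * (?V * (exp (- (3 / 5) * \<tau>) * exp (3 / 10 * \<tau>)))" by simp
    also have "exp (- (3 / 5) * \<tau>) * exp (3 / 10 * \<tau>) = exp (- (3 / 10) * \<tau>)" by (simp flip: exp_add)
    also have "120 * (?V * exp (- (3 / 10) * \<tau>)) \<le> 120 * (?V * exp (- (k * r / 4)))"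
      using \<tau> pos by (intro mult_left_mono) auto
    finally have far': "6 * ?A * exp (3 / 10 * \<tau>) \<le> 120 * (exp (- (k * r / 4)) * ?V)" by (simp add: mult.commute)
    have nn: "0 \<le> exp (- (k * r / 4)) * ?V" by simp
    show ?thesis
    proof (cases "xb \<le> r")
      case True
      then show ?thesis using far[of r] ord far' nn norm_ge_zero[of a] by (intro final) linarith
    next
      case F: False
      have "(r / xb) powr (b + 1) \<le> 1" using F pos b ord by (intro powr_le1) auto
      then have "6 * ?A * exp (3 / 10 * \<tau>) * (r / xb) powr (b + 1) \<le> 6 * ?A * exp (3 / 10 * \<tau>) * 1"
        by (intro mult_left_mono) auto
      then show ?thesis using near[of r] r pos F far' nn Vs norm_ge_zero[of a] by (intro final) linarith
    qed
  qed
qed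

end

section \<open>From the weak to the strong radial equation\<close>

lemma deriv_compose_affine:
  fixes f :: "real \<Rightarrow> real"
  assumes "(f has_real_derivative D) (at ((y - x) / e))" "e \<noteq> 0"
  shows "((\<lambda>y. f ((y - x) / e)) has_real_derivative D / e) (at y)"
proof -
  have "((\<lambda>y. (y - x) / e) has_real_derivative 1 / e) (at y)"
    using assms(2) by (auto intro!: derivative_eq_intros)
  from DERIV_chain2[where f = f and g = "\<lambda>y. (y - x) / e", OF assms(1) this] show ?thesis by simp
qed

lemma deriv_pos_part_power:
  fixes x :: real
  shows "((\<lambda>x. max 0 x ^ Suc (Suc n)) has_real_derivative real (Suc (Suc n)) * max 0 x ^ Suc n) (at x)"
proof -
  consider "x < 0" | "x > 0" | "x = 0" by linarith
  then show ?thesis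
  proof cases
    case 1
    have "((\<lambda>x. 0 :: real) has_real_derivative 0) (at x)" by simp
    then have "((\<lambda>x. max 0 x ^ Suc (Suc n)) has_real_derivative 0) (at x)"
      by (rule has_field_derivative_transform_within_open[of _ _ _ "{..<0}"]) (use 1 in auto)
    then show ?thesis using 1 by simp
  next
    case 2
    have "((\<lambda>x. x ^ Suc (Suc n)) has_real_derivative real (Suc (Suc n)) * x ^ Suc n) (at x)"
      by (rule DERIV_cong[OF DERIV_pow]) simp
    then have "((\<lambda>x. max 0 x ^ Suc (Suc n)) has_real_derivative real (Suc (Suc n)) * x ^ Suc n) (at x)"
      by (rule has_field_derivative_transform_within_open[of _ _ _ "{0<..}"]) (use 2 in auto)
    then show ?thesis using 2 by simp
  next
    case 3
    have "((\<lambda>h. (max 0 (0 + h) ^ Suc (Suc n) - max 0 0 ^ Suc (Suc n)) / h) \<longlongrightarrow> 0) (at (0::real))"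
    proof (rule Lim_null_comparison)
      show "\<forall>\<^sub>F h in at (0::real). norm ((max 0 (0 + h) ^ Suc (Suc n) - max 0 0 ^ Suc (Suc n)) / h) \<le> \<bar>h\<bar> ^ Suc n"
      proof (rule always_eventually, rule allI)
        fix h :: real
        show "norm ((max 0 (0 + h) ^ Suc (Suc n) - max 0 0 ^ Suc (Suc n)) / h) \<le> \<bar>h\<bar> ^ Suc n"
        proof (cases "h > 0")
          case False
          then have "max 0 (0 + h) = 0" by simp
          then have "norm ((max 0 (0 + h) ^ Suc (Suc n) - max 0 0 ^ Suc (Suc n)) / h) = 0" by simp
          then show ?thesis by (simp only: zero_le_power abs_ge_zero)
        qed (simp add: max_def)
      qed
      show "((\<lambda>h. \<bar>h\<bar> ^ Suc n) \<longlongrightarrow> 0) (at (0::real))"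
        using tendsto_power[OF tendsto_rabs[OF tendsto_ident_at[of "0 :: real" UNIV]], of "Suc n"] by simp
    qed
    then show ?thesis unfolding 3 DERIV_def by simp
  qed
qed

text \<open>The positive part convolved with the hat kernel \<open>tent\<close>, as a cubic spline:
  a second difference of truncated cubes. Its second derivative is \<open>tent\<close>, it vanishes
  left of -1 and is the identity right of 1. An explicit spline is enough because test functions
  need only be twice continuously differentiable.\<close>

definition ramp :: "real \<Rightarrow> real" where
  "ramp x = (max 0 (x + 1) ^ 3 - 2 * max 0 x ^ 3 + max 0 (x - 1) ^ 3) / 6"

definition ramp' :: "real \<Rightarrow> real" where
  "ramp' x = (max 0 (x + 1) ^ 2 - 2 * max 0 x ^ 2 + max 0 (x - 1) ^ 2) / 2"

definition tent :: "real \<Rightarrow> real" where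
  "tent x = max 0 (x + 1) - 2 * max 0 x + max 0 (x - 1)"

lemma deriv_ramp: "(ramp has_real_derivative ramp' x) (at x)"
proof -
  have 1: "((\<lambda>x. max 0 (x + c) ^ 3) has_real_derivative 3 * max 0 (x + c) ^ 2) (at x)" for c :: real
    using deriv_compose_affine[OF deriv_pos_part_power[of 1 "(x - (- c)) / 1"]]
    by (simp add: numeral_3_eq_3 numeral_2_eq_2)
  show ?thesis
    unfolding ramp_def[abs_def] ramp'_def
    using DERIV_cdivide[OF DERIV_add[OF DERIV_diff[OF 1[of 1] DERIV_cmult[OF 1[of 0], of 2]] 1[of "-1"]], of 6]
    by (simp add: diff_divide_distrib add_divide_distrib)
qed

lemma deriv_ramp': "(ramp' has_real_derivative tent x) (at x)"
proof -
  have 1: "((\<lambda>x. max 0 (x + c) ^ 2) has_real_derivative 2 * max 0 (x + c)) (at x)" for c :: real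
    using deriv_compose_affine[OF deriv_pos_part_power[of 0 "(x - (- c)) / 1"]]
    by (simp add: numeral_2_eq_2)
  show ?thesis
    unfolding ramp'_def[abs_def] tent_def
    using DERIV_cdivide[OF DERIV_add[OF DERIV_diff[OF 1[of 1] DERIV_cmult[OF 1[of 0], of 2]] 1[of "-1"]], of 2]
    by (simp add: diff_divide_distrib add_divide_distrib)
qed

lemma continuous_tent: "continuous_on A tent"
  unfolding tent_def[abs_def] by (intro continuous_intros)

lemma tent_nonneg: "tent x \<ge> 0"
  by (simp add: tent_def max_def)

lemma tent_eq_0: "\<bar>x\<bar> \<ge> 1 \<Longrightarrow> tent x = 0"
  by (auto simp: tent_def max_def)

lemma ramp_left: "x \<le> -1 \<Longrightarrow> ramp x = 0" "x \<le> -1 \<Longrightarrow> ramp' x = 0"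
  by (auto simp: ramp_def ramp'_def)

lemma ramp_right: "x \<ge> 1 \<Longrightarrow> ramp x = x" "x \<ge> 1 \<Longrightarrow> ramp' x = 1"
  by (auto simp: ramp_def ramp'_def max_def power2_eq_square power3_eq_cube algebra_simps)

text \<open>The rescaled hat is an approximate identity: nonnegative, supported within \<epsilon> of
  \<open>x\<close>, and of mass 1, which is the increment of \<open>ramp'\<close> across the
  interval.\<close>

lemma integral_tent:
  fixes f :: "real \<Rightarrow> complex"
  assumes cont: "continuous_on {a..b} f" and e: "\<epsilon> > 0" "a \<le> x - \<epsilon>" "x + \<epsilon> \<le> b"
    and d: "\<And>y. \<bar>y - x\<bar> \<le> \<epsilon> \<Longrightarrow> norm (f y - f x) \<le> d"
  shows "norm (integral {a..b} (\<lambda>y. (tent ((y - x) / \<epsilon>) / \<epsilon>) *\<^sub>R f y) - f x) \<le> d"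
proof -
  let ?t = "\<lambda>y. tent ((y - x) / \<epsilon>) / \<epsilon>"
  have ct: "continuous_on {a..b} ?t"
    using e by (intro continuous_intros continuous_on_compose2[OF continuous_tent[of UNIV]]) auto
  have der: "((\<lambda>y. ramp' ((y - x) / \<epsilon>)) has_real_derivative ?t y) (at y)" for y
    using deriv_compose_affine[OF deriv_ramp'] e by simp
  have "(?t has_integral ramp' ((b - x) / \<epsilon>) - ramp' ((a - x) / \<epsilon>)) {a..b}"
    using e der by (intro fundamental_theorem_of_calculus)
      (auto simp flip: has_real_derivative_iff_has_vector_derivative intro: has_field_derivative_at_within)
  moreover have "(b - x) / \<epsilon> \<ge> 1" "(a - x) / \<epsilon> \<le> - 1" using e by (auto simp: field_simps)
  ultimately have one: "(?t has_integral 1) {a..b}" by (simp add: ramp_left ramp_right)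
  have i1: "(\<lambda>y. ?t y *\<^sub>R (f y - f x)) integrable_on {a..b}"
    by (intro integrable_continuous_real continuous_intros ct cont)
  have "((\<lambda>y. ?t y *\<^sub>R f x) has_integral 1 *\<^sub>R f x) {a..b}"
    by (rule has_integral_scaleR_left[OF one])
  from has_integral_add[OF integrable_integral[OF i1] this]
  have "((\<lambda>y. ?t y *\<^sub>R f y) has_integral integral {a..b} (\<lambda>y. ?t y *\<^sub>R (f y - f x)) + f x) {a..b}"
    by (simp flip: scaleR_add_right)
  then have "integral {a..b} (\<lambda>y. ?t y *\<^sub>R f y) - f x = integral {a..b} (\<lambda>y. ?t y *\<^sub>R (f y - f x))"
    by (simp add: integral_unique)
  also have "norm \<dots> \<le> integral {a..b} (\<lambda>y. ?t y * d)"
  proof (rule integral_norm_bound_integral[OF i1])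
    show "(\<lambda>y. ?t y * d) integrable_on {a..b}"
      by (intro integrable_continuous_real continuous_intros ct)
    show "norm (?t y *\<^sub>R (f y - f x)) \<le> ?t y * d" for y
    proof (cases "\<bar>y - x\<bar> \<le> \<epsilon>")
      case True
      then show ?thesis using d[of y] tent_nonneg e by (auto simp: abs_of_nonneg intro!: mult_left_mono divide_right_mono)
    next
      case False
      then have "tent ((y - x) / \<epsilon>) = 0" using e by (intro tent_eq_0) (simp add: field_simps)
      then show ?thesis by simp
    qed
  qed
  also have "\<dots> = d" using has_integral_mult_left[OF one, of d] by (metis integral_unique mult_1)
  finally show ?thesis .
qed

section \<open>The du Bois-Reymond argument\<close>

text \<open>A vanishing weak second derivative makes every second divided difference vanish. The
  test function is a combination of three ramps centred at the three points; its second derivative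
  is the same combination of hats, so the tested integral approximates the divided difference of
  \<open>f\<close>.\<close>

lemma affine_of_weak_second_derivative:
  fixes f :: "real \<Rightarrow> complex"
  assumes cont: "continuous_on {a<..<b} f"
    and weak: "\<And>z z' z'' \<alpha> \<beta>. a < \<alpha> \<Longrightarrow> \<alpha> \<le> \<beta> \<Longrightarrow> \<beta> < b \<Longrightarrow>
       (\<And>x. (z has_real_derivative z' x) (at x)) \<Longrightarrow> (\<And>x. (z' has_real_derivative z'' x) (at x)) \<Longrightarrow>
       continuous_on UNIV z'' \<Longrightarrow> (\<And>x. x \<notin> {\<alpha>..\<beta>} \<Longrightarrow> z x = 0) \<Longrightarrow>
       integral {\<alpha>..\<beta>} (\<lambda>x. z'' x *\<^sub>R f x) = 0"
    and x: "a < x\<^sub>1" "x\<^sub>1 < x\<^sub>2" "x\<^sub>2 < x\<^sub>3" "x\<^sub>3 < b"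
  shows "(x\<^sub>3 - x\<^sub>1) *\<^sub>R f x\<^sub>2 = (x\<^sub>3 - x\<^sub>2) *\<^sub>R f x\<^sub>1 + (x\<^sub>2 - x\<^sub>1) *\<^sub>R f x\<^sub>3"
proof -
  let ?D = "(x\<^sub>3 - x\<^sub>2) *\<^sub>R f x\<^sub>1 - (x\<^sub>3 - x\<^sub>1) *\<^sub>R f x\<^sub>2 + (x\<^sub>2 - x\<^sub>1) *\<^sub>R f x\<^sub>3"
  have "norm ?D \<le> d" if d: "d > 0" for d
  proof -
    \<comment> \<open>The sum of the three weights in absolute value.\<close>
    define L where "L = 2 * (x\<^sub>3 - x\<^sub>1)"
    have L: "L > 0" using x by (simp add: L_def)
    define d' where "d' = d / L"
    have d': "d' > 0" using d L by (simp add: d'_def)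
    have "\<exists>\<epsilon>>0. \<epsilon> < min (x\<^sub>1 - a) (b - x\<^sub>3) \<and> (\<forall>y. \<bar>y - x\<bar> \<le> \<epsilon> \<longrightarrow> norm (f y - f x) \<le> d')" if "a < x" "x < b" for x
    proof -
      have "isCont f x" using cont that by (simp add: continuous_on_eq_continuous_at)
      then obtain s where s: "s > 0" "\<And>y. dist y x < s \<Longrightarrow> dist (f y) (f x) < d'"
        unfolding continuous_at_eps_delta using d' by blast
      show ?thesis
        using s x by (intro exI[of _ "min s (min (x\<^sub>1 - a) (b - x\<^sub>3)) / 2"])
           (auto simp: dist_norm less_imp_le min_def field_simps split: if_splits)
    qed
    then obtain e where e: "\<And>x. a < x \<Longrightarrow> x < b \<Longrightarrow> e x > 0 \<and> e x < min (x\<^sub>1 - a) (b - x\<^sub>3) \<and> (\<forall>y. \<bar>y - x\<bar> \<le> e x \<longrightarrow> norm (f y - f x) \<le> d')"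
      by metis
    define \<epsilon> where "\<epsilon> = min (e x\<^sub>1) (min (e x\<^sub>2) (e x\<^sub>3))"
    have \<epsilon>: "\<epsilon> > 0" "a < x\<^sub>1 - \<epsilon>" "x\<^sub>3 + \<epsilon> < b"
      using e[of x\<^sub>1] e[of x\<^sub>2] e[of x\<^sub>3] x by (auto simp: \<epsilon>_def)
    have ed: "norm (f y - f x) \<le> d'" if "x \<in> {x\<^sub>1, x\<^sub>2, x\<^sub>3}" "\<bar>y - x\<bar> \<le> \<epsilon>" for x y
      using that e[of x] x by (auto simp: \<epsilon>_def)
    define T where "T x y = \<epsilon> * ramp ((y - x) / \<epsilon>)" for x y
    define T' where "T' x y = ramp' ((y - x) / \<epsilon>)" for x y
    define T'' where "T'' x y = tent ((y - x) / \<epsilon>) / \<epsilon>" for x y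
    have T: "(T x has_real_derivative T' x y) (at y)" for x y
      using DERIV_cmult[OF deriv_compose_affine[OF deriv_ramp[of "(y - x) / \<epsilon>"]], of \<epsilon>] \<epsilon>
      unfolding T_def[abs_def] T'_def by simp
    have T': "(T' x has_real_derivative T'' x y) (at y)" for x y
      using deriv_compose_affine[OF deriv_ramp'[of "(y - x) / \<epsilon>"]] \<epsilon>
      unfolding T'_def[abs_def] T''_def by simp
    have cT: "continuous_on A (T'' x)" for x A
      unfolding T''_def[abs_def] using \<epsilon> by (intro continuous_intros continuous_on_compose2[OF continuous_tent[of UNIV]]) auto
    \<comment> \<open>Left of all three points the ramps are 0; right of them the ramp at x is y -
      x, and these weights annihilate affine functions. Hence \<open>z\<close> has compact
      support.\<close>
    define z where "z y = (x\<^sub>3 - x\<^sub>2) * T x\<^sub>1 y - (x\<^sub>3 - x\<^sub>1) * T x\<^sub>2 y + (x\<^sub>2 - x\<^sub>1) * T x\<^sub>3 y" for y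
    let ?a = "x\<^sub>1 - \<epsilon>" and ?b = "x\<^sub>3 + \<epsilon>"
    have contab: "continuous_on {?a..?b} f"
      by (rule continuous_on_subset[OF cont]) (use \<epsilon> in auto)
    have 0: "integral {?a..?b} (\<lambda>y. ((x\<^sub>3 - x\<^sub>2) * T'' x\<^sub>1 y - (x\<^sub>3 - x\<^sub>1) * T'' x\<^sub>2 y + (x\<^sub>2 - x\<^sub>1) * T'' x\<^sub>3 y) *\<^sub>R f y) = 0"
    proof (rule weak[where z = z and z' = "\<lambda>y. (x\<^sub>3 - x\<^sub>2) * T' x\<^sub>1 y - (x\<^sub>3 - x\<^sub>1) * T' x\<^sub>2 y + (x\<^sub>2 - x\<^sub>1) * T' x\<^sub>3 y"])
      show "z y = 0" if "y \<notin> {?a..?b}" for y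
      proof (cases "y < ?a")
        case True
        then have "T x\<^sub>1 y = 0" "T x\<^sub>2 y = 0" "T x\<^sub>3 y = 0"
          unfolding T_def using x \<epsilon> by (auto intro!: ramp_left simp: field_simps)
        then show ?thesis by (simp add: z_def)
      next
        case False
        then have y: "y > ?b" using that by auto
        have "T x\<^sub>1 y = y - x\<^sub>1" "T x\<^sub>2 y = y - x\<^sub>2" "T x\<^sub>3 y = y - x\<^sub>3"
          using ramp_right(1)[of "(y - x\<^sub>1) / \<epsilon>"] ramp_right(1)[of "(y - x\<^sub>2) / \<epsilon>"] ramp_right(1)[of "(y - x\<^sub>3) / \<epsilon>"] x \<epsilon> y
          by (auto simp: T_def field_simps)
        then show ?thesis unfolding z_def by (simp only:) (simp add: algebra_simps)
      qed
    qed (use x \<epsilon> in \<open>auto simp: z_def[abs_def] intro!: DERIV_add DERIV_diff DERIV_cmult T T' continuous_intros cT\<close>)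
    define I where "I x = integral {?a..?b} (\<lambda>y. T'' x y *\<^sub>R f y)" for x
    have int: "(\<lambda>y. T'' x y *\<^sub>R f y) integrable_on {?a..?b}" for x
      by (intro integrable_continuous_real continuous_intros cT contab)
    have "((\<lambda>y. (x\<^sub>3 - x\<^sub>2) *\<^sub>R (T'' x\<^sub>1 y *\<^sub>R f y) - (x\<^sub>3 - x\<^sub>1) *\<^sub>R (T'' x\<^sub>2 y *\<^sub>R f y) + (x\<^sub>2 - x\<^sub>1) *\<^sub>R (T'' x\<^sub>3 y *\<^sub>R f y))
        has_integral (x\<^sub>3 - x\<^sub>2) *\<^sub>R I x\<^sub>1 - (x\<^sub>3 - x\<^sub>1) *\<^sub>R I x\<^sub>2 + (x\<^sub>2 - x\<^sub>1) *\<^sub>R I x\<^sub>3) {?a..?b}"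
      unfolding I_def by (intro has_integral_add has_integral_diff has_integral_cmul integrable_integral int)
    from integral_unique[OF this] 0
    have I0: "(x\<^sub>3 - x\<^sub>2) *\<^sub>R I x\<^sub>1 - (x\<^sub>3 - x\<^sub>1) *\<^sub>R I x\<^sub>2 + (x\<^sub>2 - x\<^sub>1) *\<^sub>R I x\<^sub>3 = 0"
      by (simp add: algebra_simps)
    have I: "norm (I x - f x) \<le> d'" if "x \<in> {x\<^sub>1, x\<^sub>2, x\<^sub>3}" for x
      unfolding I_def T''_def using that x by (intro integral_tent contab \<epsilon> ed) auto
    have "?D = (x\<^sub>3 - x\<^sub>1) *\<^sub>R (I x\<^sub>2 - f x\<^sub>2) - (x\<^sub>3 - x\<^sub>2) *\<^sub>R (I x\<^sub>1 - f x\<^sub>1) - (x\<^sub>2 - x\<^sub>1) *\<^sub>R (I x\<^sub>3 - f x\<^sub>3)"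
      using I0 by (simp add: scaleR_diff_right algebra_simps)
    also have "norm \<dots> \<le> (x\<^sub>3 - x\<^sub>1) * d' + (x\<^sub>3 - x\<^sub>2) * d' + (x\<^sub>2 - x\<^sub>1) * d'"
      using I[of x\<^sub>1] I[of x\<^sub>2] I[of x\<^sub>3] x
      by (intro norm_triangle_le_diff add_mono) (auto intro!: norm_triangle_le_diff add_mono mult_left_mono)
    also have "\<dots> = L * d'" by (simp add: L_def algebra_simps)
    also have "\<dots> = d" using L by (simp add: d'_def)
    finally show ?thesis .
  qed
  then have "norm ?D \<le> 0" by (rule field_le_epsilon[of _ 0, simplified])
  then show ?thesis by (simp add: algebra_simps)
qed


lemma compact_support_deriv_eq_0:
  fixes f f' :: "real \<Rightarrow> real"
  assumes "\<And>x. (f has_real_derivative f' x) (at x)" "\<And>x. x \<notin> {a..b} \<Longrightarrow> f x = 0" "x \<notin> {a..b}"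
  shows "f' x = 0"
proof -
  have "((\<lambda>_. 0 :: real) has_real_derivative 0) (at x)" by simp
  then have "(f has_real_derivative 0) (at x)"
    by (rule has_field_derivative_transform_within_open[of _ _ _ "- {a..b}"]) (use assms in auto)
  then show ?thesis using assms(1) DERIV_unique by blast
qed

text \<open>Near each point subtract from \<open>v\<close> a double antiderivative of
  \<open>q v\<close>, which is a twice differentiable solution with that right-hand side. The
  difference has weak second derivative 0, hence is affine, so \<open>v\<close> inherits the
  regularity and the equation.\<close>

lemma ode_of_weak_ode:
  fixes v :: "real \<Rightarrow> complex" and q :: "real \<Rightarrow> real"
  assumes cv: "continuous_on {R<..} v" and cq: "continuous_on {R<..} q"
    and weak: "\<And>z z' z'' \<alpha> \<beta>. R < \<alpha> \<Longrightarrow> \<alpha> \<le> \<beta> \<Longrightarrow>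
       (\<And>x. (z has_real_derivative z' x) (at x)) \<Longrightarrow> (\<And>x. (z' has_real_derivative z'' x) (at x)) \<Longrightarrow>
       continuous_on UNIV z'' \<Longrightarrow> (\<And>x. x \<notin> {\<alpha>..\<beta>} \<Longrightarrow> z x = 0) \<Longrightarrow>
       integral {\<alpha>..\<beta>} (\<lambda>x. (z'' x - q x * z x) *\<^sub>R v x) = 0"
  obtains v' where "\<And>x. x > R \<Longrightarrow> (v has_vector_derivative v' x) (at x)"
    "\<And>x. x > R \<Longrightarrow> (v' has_vector_derivative q x *\<^sub>R v x) (at x)"
proof -
  have local: "\<exists>w. \<exists>U. open U \<and> x\<^sub>0 \<in> U \<and> (\<forall>x\<in>U. (v has_vector_derivative w x) (at x)) \<and> (w has_vector_derivative q x\<^sub>0 *\<^sub>R v x\<^sub>0) (at x\<^sub>0)"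
    if x0: "x\<^sub>0 > R" for x\<^sub>0
  proof -
    define a b where "a = (R + x\<^sub>0) / 2" and "b = x\<^sub>0 + 1"
    have ab: "R < a" "a < x\<^sub>0" "x\<^sub>0 < b" using x0 by (auto simp: a_def b_def)
    define g where "g x = q x *\<^sub>R v x" for x
    have cg: "continuous_on {a..b} g"
      unfolding g_def[abs_def] using ab by (intro continuous_intros continuous_on_subset[OF cv] continuous_on_subset[OF cq]) auto
    define V' where "V' x = integral {a..x} g" for x
    define V where "V x = integral {a..x} V'" for x
    have dV': "(V' has_vector_derivative g x) (at x)" if "a < x" "x < b" for x
      using integral_has_vector_derivative[OF cg, of x] that
      by (simp add: V'_def[abs_def] at_within_Icc_at)
    have cV': "continuous_on {a..b} V'"
      unfolding V'_def[abs_def] by (intro indefinite_integral_continuous_1 integrable_continuous_real cg)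
    have dV: "(V has_vector_derivative V' x) (at x)" if "a < x" "x < b" for x
      using integral_has_vector_derivative[OF cV', of x] that
      by (simp add: V_def[abs_def] at_within_Icc_at)
    define f where "f x = v x - V x" for x
    have cV: "continuous_on {a<..<b} V"
      by (rule continuous_at_imp_continuous_on) (auto intro: has_vector_derivative_continuous[OF dV])
    have cf: "continuous_on {a<..<b} f"
      unfolding f_def[abs_def] using ab by (intro continuous_intros cV continuous_on_subset[OF cv]) auto
    have wf: "integral {\<alpha>..\<beta>} (\<lambda>x. z'' x *\<^sub>R f x) = 0"
      if ab': "a < \<alpha>" "\<alpha> \<le> \<beta>" "\<beta> < b" and z: "\<And>x. (z has_real_derivative z' x) (at x)"
        and z': "\<And>x. (z' has_real_derivative z'' x) (at x)" and z'': "continuous_on UNIV z''" and supp: "\<And>x. x \<notin> {\<alpha>..\<beta>} \<Longrightarrow> z x = 0"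
      for z z' z'' \<alpha> \<beta>
    proof -
      have supp': "z' x = 0" if "x \<notin> {\<alpha>..\<beta>}" for x by (rule compact_support_deriv_eq_0[OF z supp that])
      have supp'': "z'' x = 0" if "x \<notin> {\<alpha>..\<beta>}" for x by (rule compact_support_deriv_eq_0[OF z' supp' that])
      \<comment> \<open>The interval is enlarged so that its end points lie strictly outside the
        support: there \<open>z\<close> and \<open>z'\<close> vanish, and two integrations by parts
        against \<open>V\<close> leave no boundary terms.\<close>
      define \<alpha>' \<beta>' where "\<alpha>' = (a + \<alpha>) / 2" and "\<beta>' = (\<beta> + b) / 2"
      have o: "a < \<alpha>'" "\<alpha>' < \<alpha>" "\<beta> < \<beta>'" "\<beta>' < b" using ab' by (auto simp: \<alpha>'_def \<beta>'_def)
      have cz: "continuous_on A z" for A by (rule continuous_at_imp_continuous_on) (use z DERIV_isCont in blast)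
      have cz': "continuous_on A z'" for A by (rule continuous_at_imp_continuous_on) (use z' DERIV_isCont in blast)
      have "((\<lambda>x. z'' x *\<^sub>R V x - z x *\<^sub>R g x) has_integral (z' \<beta>' *\<^sub>R V \<beta>' - z \<beta>' *\<^sub>R V' \<beta>') - (z' \<alpha>' *\<^sub>R V \<alpha>' - z \<alpha>' *\<^sub>R V' \<alpha>')) {\<alpha>'..\<beta>'}"
      proof (rule fundamental_theorem_of_calculus)
        show "\<alpha>' \<le> \<beta>'" using o ab' by linarith
        fix x assume "x \<in> {\<alpha>'..\<beta>'}"
        then have x: "a < x" "x < b" using o by auto
        have "((\<lambda>x. z' x *\<^sub>R V x - z x *\<^sub>R V' x) has_vector_derivative
           (z' x *\<^sub>R V' x + z'' x *\<^sub>R V x) - (z x *\<^sub>R g x + z' x *\<^sub>R V' x)) (at x)"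
          by (rule has_vector_derivative_diff[OF has_vector_derivative_scaleR[OF z' dV[OF x]] has_vector_derivative_scaleR[OF z dV'[OF x]]])
        moreover have "(z' x *\<^sub>R V' x + z'' x *\<^sub>R V x) - (z x *\<^sub>R g x + z' x *\<^sub>R V' x) = z'' x *\<^sub>R V x - z x *\<^sub>R g x" by simp
        ultimately show "((\<lambda>x. z' x *\<^sub>R V x - z x *\<^sub>R V' x) has_vector_derivative z'' x *\<^sub>R V x - z x *\<^sub>R g x) (at x within {\<alpha>'..\<beta>'})"
          by (simp only: has_vector_derivative_at_within)
      qed
      moreover have "z \<alpha>' = 0" "z \<beta>' = 0" "z' \<alpha>' = 0" "z' \<beta>' = 0"
        using o ab' supp[of \<alpha>'] supp[of \<beta>'] supp'[of \<alpha>'] supp'[of \<beta>'] by simp_all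
      ultimately have 1: "((\<lambda>x. z'' x *\<^sub>R V x - z x *\<^sub>R g x) has_integral 0) {\<alpha>'..\<beta>'}" by simp
      have "integral {\<alpha>'..\<beta>'} (\<lambda>x. (z'' x - q x * z x) *\<^sub>R v x) = 0"
        by (rule weak[OF _ _ z z' z'']) (use o ab ab' in \<open>auto intro!: supp\<close>)
      moreover have "(\<lambda>x. (z'' x - q x * z x) *\<^sub>R v x) integrable_on {\<alpha>'..\<beta>'}"
        using o ab by (intro integrable_continuous_real continuous_intros continuous_on_subset[OF cv] continuous_on_subset[OF cq]
             continuous_on_subset[OF z''] cz) auto
      ultimately have 2: "((\<lambda>x. (z'' x - q x * z x) *\<^sub>R v x) has_integral 0) {\<alpha>'..\<beta>'}"
        by (simp only: has_integral_integrable_integral)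
      have "((\<lambda>x. z'' x *\<^sub>R f x) has_integral 0) {\<alpha>'..\<beta>'}"
        using has_integral_diff[OF 2 1] by (simp add: f_def g_def algebra_simps)
      then have "((\<lambda>x. if x \<in> {\<alpha>..\<beta>} then z'' x *\<^sub>R f x else 0) has_integral 0) {\<alpha>'..\<beta>'}"
        by (rule has_integral_eq[rotated]) (use supp'' in auto)
      then have "((\<lambda>x. z'' x *\<^sub>R f x) has_integral 0) {\<alpha>..\<beta>}"
        by (subst (asm) has_integral_restrict) (use o in auto)
      then show ?thesis by (rule integral_unique)
    qed
    define p r where "p = (a + x\<^sub>0) / 2" and "r = (x\<^sub>0 + b) / 2"
    have pr: "a < p" "p < x\<^sub>0" "x\<^sub>0 < r" "r < b" using ab by (auto simp: p_def r_def)
    define B where "B = (1 / (r - p)) *\<^sub>R (f r - f p)"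
    have v_eq: "v x = V x + f p + (x - p) *\<^sub>R B" if "x \<in> {p<..<r}" for x
    proof -
      have "(r - p) *\<^sub>R f x = (r - x) *\<^sub>R f p + (x - p) *\<^sub>R f r"
      proof (rule affine_of_weak_second_derivative[OF cf])
        fix z z' z'' :: "real \<Rightarrow> real" and \<alpha> \<beta>
        assume "a < \<alpha>" "\<alpha> \<le> \<beta>" "\<beta> < b" "\<And>x. (z has_real_derivative z' x) (at x)"
          "\<And>x. (z' has_real_derivative z'' x) (at x)" "continuous_on UNIV z''" "\<And>x. x \<notin> {\<alpha>..\<beta>} \<Longrightarrow> z x = 0"
        then show "integral {\<alpha>..\<beta>} (\<lambda>x. z'' x *\<^sub>R f x) = 0" by (rule wf)
      qed (use that pr in auto)
      also have "\<dots> = (r - p) *\<^sub>R f p + (x - p) *\<^sub>R (f r - f p)"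
        by (simp add: algebra_simps)
      also have "f r - f p = (r - p) *\<^sub>R B" using pr by (simp add: B_def)
      also have "(r - p) *\<^sub>R f p + (x - p) *\<^sub>R (r - p) *\<^sub>R B = (r - p) *\<^sub>R (f p + (x - p) *\<^sub>R B)"
        by (simp only: scaleR_add_right scaleR_left_commute)
      finally have "f x = f p + (x - p) *\<^sub>R B" using pr by simp
      then show ?thesis by (simp add: f_def algebra_simps)
    qed
    have "(v has_vector_derivative V' x + B) (at x)" if "x \<in> {p<..<r}" for x
    proof -
      have "((\<lambda>x. V x + f p + (x - p) *\<^sub>R B) has_vector_derivative V' x + B) (at x)"
        using that pr dV[of x] by (auto intro!: derivative_eq_intros)
      then show ?thesis
        by (rule has_vector_derivative_transform_within_open[of _ _ _ "{p<..<r}"]) (use that v_eq in auto)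
    qed
    moreover have "((\<lambda>x. V' x + B) has_vector_derivative q x\<^sub>0 *\<^sub>R v x\<^sub>0) (at x\<^sub>0)"
      using dV'[of x\<^sub>0] ab by (auto intro!: derivative_eq_intros simp: g_def)
    ultimately show ?thesis
      using pr by (intro exI[of _ "\<lambda>x. V' x + B"] exI[of _ "{p<..<r}"]) auto
  qed
  \<comment> \<open>The local derivatives depend on the interval chosen; the derivative of
    \<open>v\<close> itself is the one function that agrees with all of them.\<close>
  define v' where "v' x = vector_derivative v (at x)" for x
  have 1: "(v has_vector_derivative v' x) (at x)" if xR: "x > R" for x
  proof -
    obtain w U where w: "x \<in> U" "\<And>y. y \<in> U \<Longrightarrow> (v has_vector_derivative w y) (at y)"
      using local[OF xR] by blast
    from w(2)[OF w(1)] show ?thesis unfolding v'_def by (simp add: vector_derivative_at)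
  qed
  have 2: "(v' has_vector_derivative q x *\<^sub>R v x) (at x)" if xR: "x > R" for x
  proof -
    obtain w U where w: "open U" "x \<in> U" "\<And>y. y \<in> U \<Longrightarrow> (v has_vector_derivative w y) (at y)" "(w has_vector_derivative q x *\<^sub>R v x) (at x)"
      using local[OF xR] by blast
    show ?thesis
    proof (rule has_vector_derivative_transform_within_open[OF w(4) w(1,2)])
      show "w y = v' y" if "y \<in> U" for y
        unfolding v'_def by (rule vector_derivative_at[OF w(3)[OF that], symmetric])
    qed
  qed
  show thesis using 1 2 by (rule that[of v'])
qed

section \<open>Homogeneous polynomials and solid harmonics\<close>

text \<open>Homogeneous polynomials as functions, generated without coefficients, so that identities
  such as Euler's are proved by induction on the generation. The index is a degree in the sense of
  homogeneity; for \<open>0 < N\<close> the zero function has every degree.\<close>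

inductive hpoly :: "nat \<Rightarrow> nat \<Rightarrow> ((nat \<Rightarrow> real) \<Rightarrow> real) \<Rightarrow> bool" for N where
  hpoly_const: "hpoly N 0 (\<lambda>x. c)"
| hpoly_var: "i < N \<Longrightarrow> hpoly N n f \<Longrightarrow> hpoly N (Suc n) (\<lambda>x. x i * f x)"
| hpoly_add: "hpoly N n f \<Longrightarrow> hpoly N n g \<Longrightarrow> hpoly N n (\<lambda>x. f x + g x)"

lemma hpoly_cmult: "hpoly N n f \<Longrightarrow> hpoly N n (\<lambda>x. c * f x)"
proof (induction rule: hpoly.induct)
  case (hpoly_var i n f)
  from hpoly.hpoly_var[OF hpoly_var(1,3)] show ?case by (simp add: mult.left_commute)
next
  case (hpoly_add n f g)
  from hpoly.hpoly_add[OF hpoly_add(3,4)] show ?case by (simp add: distrib_left)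
qed (rule hpoly_const)

lemma hpoly_zero: "0 < N \<Longrightarrow> hpoly N n (\<lambda>_. 0)"
proof (induction n)
  case (Suc n)
  then show ?case using hpoly_var[of 0 N n "\<lambda>_. 0"] by simp
qed (rule hpoly_const)

lemma hpoly_diff:
  assumes "hpoly N n f" "hpoly N n g"
  shows "hpoly N n (\<lambda>x. f x - g x)"
  using hpoly_add[OF assms(1) hpoly_cmult[OF assms(2), of "-1"]] by simp

lemma hpoly_sum:
  assumes "0 < N" "finite I" "\<And>i. i \<in> I \<Longrightarrow> hpoly N n (f i)"
  shows "hpoly N n (\<lambda>x. \<Sum>i\<in>I. f i x)"
  using assms(2,3) by (induction I rule: finite_induct) (auto intro: hpoly_zero[OF assms(1)] hpoly_add)

lemma hpoly_mult: "hpoly N m f \<Longrightarrow> hpoly N n g \<Longrightarrow> hpoly N (m + n) (\<lambda>x. f x * g x)"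
proof (induction rule: hpoly.induct)
  case (hpoly_const c)
  then show ?case by (simp add: hpoly_cmult)
next
  case (hpoly_var i m f)
  from hpoly.hpoly_var[OF hpoly_var(1) hpoly_var(3)[OF hpoly_var(4)]] show ?case by (simp add: mult.assoc)
next
  case (hpoly_add m f h)
  from hpoly.hpoly_add[OF hpoly_add(3)[OF hpoly_add(5)] hpoly_add(4)[OF hpoly_add(5)]]
  show ?case by (simp add: distrib_right)
qed

lemma hpoly_coord: "i < N \<Longrightarrow> hpoly N 1 (\<lambda>x. x i)"
  using hpoly_var[OF _ hpoly_const, of i N 1] by simp

lemma continuous_on_hpoly: "hpoly N n f \<Longrightarrow> continuous_on A f"
proof (induction rule: hpoly.induct)
  case (hpoly_var i n f)
  have "continuous_on A (\<lambda>x. x i)" by (rule continuous_on_subset[OF continuous_on_product_coordinates]) simp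
  then show ?case using hpoly_var by (intro continuous_intros)
qed (auto intro: continuous_intros)

section \<open>Partial derivatives and the Laplacian on polynomials\<close>

definition pd :: "nat \<Rightarrow> ((nat \<Rightarrow> real) \<Rightarrow> real) \<Rightarrow> (nat \<Rightarrow> real) \<Rightarrow> real" where
  "pd i f x = deriv (\<lambda>t. f (x(i := t))) (x i)"

text \<open>The derivative is required at every parameter \<open>s\<close> of every coordinate line,
  not just at the base point, so that the rules of one variable apply verbatim and can be
  iterated.\<close>

definition has_pd :: "nat \<Rightarrow> ((nat \<Rightarrow> real) \<Rightarrow> real) \<Rightarrow> ((nat \<Rightarrow> real) \<Rightarrow> real) \<Rightarrow> bool" where
  "has_pd i f g \<longleftrightarrow> (\<forall>x s. ((\<lambda>t. f (x(i := t))) has_real_derivative g (x(i := s))) (at s))"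

lemma pd_eq: "has_pd i f g \<Longrightarrow> pd i f = g"
proof
  fix x assume "has_pd i f g"
  then have "((\<lambda>t. f (x(i := t))) has_real_derivative g (x(i := x i))) (at (x i))" unfolding has_pd_def by blast
  then show "pd i f x = g x" by (simp add: pd_def DERIV_imp_deriv)
qed

lemma has_pd_const: "has_pd i (\<lambda>_. c) (\<lambda>_. 0)"
  by (simp add: has_pd_def)

lemma has_pd_coord: "has_pd i (\<lambda>x. x j) (\<lambda>_. of_bool (i = j))"
  by (auto simp: has_pd_def)

lemma has_pd_add: "has_pd i f f' \<Longrightarrow> has_pd i g g' \<Longrightarrow> has_pd i (\<lambda>x. f x + g x) (\<lambda>x. f' x + g' x)"
  unfolding has_pd_def by (intro allI DERIV_add) auto

lemma has_pd_mult: "has_pd i f f' \<Longrightarrow> has_pd i g g' \<Longrightarrow> has_pd i (\<lambda>x. f x * g x) (\<lambda>x. f' x * g x + g' x * f x)"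
  unfolding has_pd_def by (intro allI DERIV_mult) auto

lemma has_pd_pd: "has_pd i f g \<Longrightarrow> has_pd i f (pd i f)"
  using pd_eq[of i f g] by simp

lemma hpoly_has_pd: "hpoly N n f \<Longrightarrow> has_pd i f (pd i f)"
proof (induction rule: hpoly.induct)
  case (hpoly_const c)
  show ?case by (rule has_pd_pd[OF has_pd_const])
next
  case (hpoly_var j n f)
  show ?case by (rule has_pd_pd[OF has_pd_mult[OF has_pd_coord hpoly_var(3)]])
next
  case (hpoly_add n f g)
  show ?case by (rule has_pd_pd[OF has_pd_add[OF hpoly_add(3,4)]])
qed

lemma pd_const: "pd i (\<lambda>_. c) = (\<lambda>_. 0)"
  by (rule pd_eq[OF has_pd_const])

lemma pd_coord: "pd i (\<lambda>x. x j) = (\<lambda>_. of_bool (i = j))"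
  by (rule pd_eq[OF has_pd_coord])

lemma pd_add: "hpoly N m f \<Longrightarrow> hpoly N n g \<Longrightarrow> pd i (\<lambda>x. f x + g x) = (\<lambda>x. pd i f x + pd i g x)"
  by (rule pd_eq[OF has_pd_add[OF hpoly_has_pd hpoly_has_pd]])

lemma pd_mult: "hpoly N m f \<Longrightarrow> hpoly N n g \<Longrightarrow> pd i (\<lambda>x. f x * g x) = (\<lambda>x. pd i f x * g x + pd i g x * f x)"
  by (rule pd_eq[OF has_pd_mult[OF hpoly_has_pd hpoly_has_pd]])

lemma pd_cmult: "hpoly N n f \<Longrightarrow> pd i (\<lambda>x. c * f x) = (\<lambda>x. c * pd i f x)"
  using pd_mult[OF hpoly_const[of N c]] by (simp add: pd_const mult.commute)

lemma hpoly_pd':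
  assumes "0 < N"
  shows "hpoly N n f \<Longrightarrow> (n = 0 \<longrightarrow> pd i f = (\<lambda>_. 0)) \<and> (\<forall>m. n = Suc m \<longrightarrow> hpoly N m (pd i f))"
proof (induction rule: hpoly.induct)
  case (hpoly_const c)
  then show ?case by (simp add: pd_const)
next
  case (hpoly_var j n f)
  have "hpoly N n (\<lambda>x. of_bool (i = j) * f x + pd i f x * x j)"
  proof (cases n)
    case 0
    then show ?thesis using hpoly_var hpoly_cmult[OF hpoly_var(2), of "of_bool (i = j)"] by simp
  next
    case (Suc m)
    then have "hpoly N (m + 1) (\<lambda>x. pd i f x * x j)"
      using hpoly_var by (intro hpoly_mult hpoly_coord) auto
    then show ?thesis using hpoly_add[OF hpoly_cmult[OF hpoly_var(2)]] Suc by simp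
  qed
  then show ?case using pd_mult[OF hpoly_coord[OF hpoly_var(1)] hpoly_var(2), of i] by (simp add: pd_coord)
next
  case (hpoly_add n f g)
  then show ?case using pd_add[OF hpoly_add(1,2), of i] by (auto intro: hpoly.hpoly_add)
qed

lemma hpoly_pd: "0 < N \<Longrightarrow> hpoly N (Suc n) f \<Longrightarrow> hpoly N n (pd i f)"
  using hpoly_pd' by blast

lemma pd_hpoly_0: "0 < N \<Longrightarrow> hpoly N 0 f \<Longrightarrow> pd i f = (\<lambda>_. 0)"
  using hpoly_pd' by blast

lemma hpoly_pd_ex:
  assumes "0 < N" "hpoly N n f"
  shows "\<exists>m. hpoly N m (pd i f)"
proof (cases n)
  case 0
  then show ?thesis using assms pd_hpoly_0[of N f i] hpoly_zero[of N 0] by auto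
next
  case (Suc m)
  then show ?thesis using assms hpoly_pd[of N m f i] by blast
qed

lemma euler_identity:
  assumes "0 < N"
  shows "hpoly N n f \<Longrightarrow> (\<Sum>i<N. x i * pd i f x) = real n * f x"
proof (induction rule: hpoly.induct)
  case (hpoly_const c)
  then show ?case by (simp add: pd_const)
next
  case (hpoly_var j n f)
  have "(\<Sum>i<N. x i * pd i (\<lambda>x. x j * f x) x) = (\<Sum>i<N. of_bool (i = j) * (x i * f x)) + x j * (\<Sum>i<N. x i * pd i f x)"
    using pd_mult[OF hpoly_coord[OF hpoly_var(1)] hpoly_var(2)]
    by (simp add: pd_coord sum.distrib sum_distrib_left algebra_simps)
  also have "(\<Sum>i<N. of_bool (i = j) * (x i * f x)) = x j * f x"
    using hpoly_var(1) by (simp add: of_bool_def if_distrib[of "\<lambda>c. c * _"] sum.delta cong: if_cong)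
  finally show ?case using hpoly_var(3) by (simp add: algebra_simps)
next
  case (hpoly_add n f g)
  then show ?case using pd_add[OF hpoly_add(1,2)] by (simp add: sum.distrib algebra_simps)
qed

definition lap :: "nat \<Rightarrow> ((nat \<Rightarrow> real) \<Rightarrow> real) \<Rightarrow> (nat \<Rightarrow> real) \<Rightarrow> real" where
  "lap N f x = (\<Sum>i<N. pd i (pd i f) x)"

definition norm2 :: "nat \<Rightarrow> (nat \<Rightarrow> real) \<Rightarrow> real" where
  "norm2 N x = (\<Sum>i<N. (x i)\<^sup>2)"

lemma hpoly_norm2: "0 < N \<Longrightarrow> hpoly N 2 (norm2 N)"
  unfolding norm2_def[abs_def] power2_eq_square
  using hpoly_mult[OF hpoly_coord hpoly_coord] by (intro hpoly_sum) (auto simp: numeral_2_eq_2)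

lemma pd_norm2:
  assumes "i < N"
  shows "pd i (norm2 N) = (\<lambda>x. 2 * x i)"
proof (rule pd_eq, unfold has_pd_def, intro allI)
  fix x s
  have "norm2 N (x(i := t)) = t\<^sup>2 + (\<Sum>j\<in>{..<N} - {i}. (x j)\<^sup>2)" for t
    unfolding norm2_def using assms by (subst sum.remove[of _ i]) auto
  then show "((\<lambda>t. norm2 N (x(i := t))) has_real_derivative 2 * (x(i := s)) i) (at s)"
    by (auto intro!: derivative_eq_intros)
qed

lemma lap_add:
  assumes "0 < N" "hpoly N m f" "hpoly N n g"
  shows "lap N (\<lambda>x. f x + g x) x = lap N f x + lap N g x"
proof -
  have "pd i (pd i (\<lambda>x. f x + g x)) = (\<lambda>x. pd i (pd i f) x + pd i (pd i g) x)" for i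
  proof -
    obtain a b where "hpoly N a (pd i f)" "hpoly N b (pd i g)"
      using hpoly_pd_ex[OF assms(1,2)] hpoly_pd_ex[OF assms(1,3)] by blast
    from pd_add[OF this] show ?thesis by (simp only: pd_add[OF assms(2,3)])
  qed
  then show ?thesis by (simp add: lap_def sum.distrib)
qed

lemma lap_cmult:
  assumes "0 < N" "hpoly N n f"
  shows "lap N (\<lambda>x. c * f x) x = c * lap N f x"
proof -
  have "pd i (pd i (\<lambda>x. c * f x)) = (\<lambda>x. c * pd i (pd i f) x)" for i
  proof -
    obtain a where "hpoly N a (pd i f)" using hpoly_pd_ex[OF assms] by blast
    from pd_cmult[OF this] show ?thesis by (simp only: pd_cmult[OF assms(2)])
  qed
  then show ?thesis by (simp add: lap_def sum_distrib_left)
qed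

text \<open>The Laplacian of |x|^2 f is 2N f + 4 x . grad f + |x|^2 lap f, and Euler's identity
  evaluates the middle term as 4n f.\<close>

lemma lap_norm2_mult:
  assumes N: "0 < N" and f: "hpoly N n f"
  shows "lap N (\<lambda>x. norm2 N x * f x) x = (2 * real N + 4 * real n) * f x + norm2 N x * lap N f x"
proof -
  have 2: "pd i (pd i (\<lambda>x. norm2 N x * f x)) x = 2 * f x + 4 * (x i * pd i f x) + norm2 N x * pd i (pd i f) x"
    if i: "i < N" for i
  proof -
    obtain m where m: "hpoly N m (pd i f)" using hpoly_pd_ex[OF N f] by blast
    have 1: "pd i (\<lambda>x. norm2 N x * f x) = (\<lambda>x. (2 * x i) * f x + pd i f x * norm2 N x)"
      using pd_mult[OF hpoly_norm2[OF N] f] pd_norm2[OF i] by simp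
    have c: "hpoly N 1 (\<lambda>x. 2 * x i)" by (rule hpoly_cmult[OF hpoly_coord[OF i]])
    have c': "pd i (\<lambda>x. 2 * x i) = (\<lambda>x. 2)" using pd_cmult[OF hpoly_coord[OF i]] by (simp add: pd_coord)
    have "pd i (\<lambda>x. (2 * x i) * f x + pd i f x * norm2 N x) = (\<lambda>x. pd i (\<lambda>x. (2 * x i) * f x) x + pd i (\<lambda>x. pd i f x * norm2 N x) x)"
      by (rule pd_add[OF hpoly_mult[OF c f] hpoly_mult[OF m hpoly_norm2[OF N]]])
    also have "\<dots> = (\<lambda>x. (2 * f x + pd i f x * (2 * x i)) + (pd i (pd i f) x * norm2 N x + (2 * x i) * pd i f x))"
      using pd_mult[OF c f] pd_mult[OF m hpoly_norm2[OF N]] pd_norm2[OF i] c' by simp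
    finally show ?thesis unfolding 1 by simp
  qed
  have "lap N (\<lambda>x. norm2 N x * f x) x = (\<Sum>i<N. 2 * f x + 4 * (x i * pd i f x) + norm2 N x * pd i (pd i f) x)"
    unfolding lap_def by (rule sum.cong) (use 2 in auto)
  also have "\<dots> = 2 * real N * f x + 4 * (\<Sum>i<N. x i * pd i f x) + norm2 N x * lap N f x"
    by (simp add: sum.distrib lap_def sum_distrib_left)
  finally show ?thesis unfolding euler_identity[OF N f] by (simp add: algebra_simps)
qed

lemma hpoly_lap: "0 < N \<Longrightarrow> hpoly N (Suc (Suc n)) f \<Longrightarrow> hpoly N n (lap N f)"
  unfolding lap_def[abs_def] by (intro hpoly_sum hpoly_pd) auto

lemma lap_hpoly_0_1:
  assumes "0 < N" "hpoly N n f" "n < 2"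
  shows "lap N f x = 0"
proof -
  have "pd i (pd i f) = (\<lambda>_. 0)" for i
  proof (cases n)
    case 0
    then show ?thesis using pd_hpoly_0[OF assms(1)] assms(2) by (simp add: pd_const)
  next
    case (Suc m)
    then have "hpoly N 0 (pd i f)" using hpoly_pd[OF assms(1)] assms(2,3) by (cases m) auto
    then show ?thesis by (rule pd_hpoly_0[OF assms(1)])
  qed
  then show ?thesis by (simp add: lap_def)
qed

text \<open>Applying the Laplacian shows what g = lap q must satisfy: (l + 2N + 4m) g + |x|^2 lap g
  = lap f, the same equation two degrees lower with a larger, still positive, constant. Conversely q
  = (f - |x|^2 g)/l has Laplacian g and solves the equation.\<close>

lemma ex_lap_equation:
  assumes N: "0 < N"
  shows "l > 0 \<Longrightarrow> hpoly N n f \<Longrightarrow> \<exists>q. hpoly N n q \<and> (\<forall>x. l * q x + norm2 N x * lap N q x = f x)"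
proof (induction n arbitrary: l f rule: less_induct)
  case (less n)
  show ?case
  proof (cases "n < 2")
    case True
    have "hpoly N n (\<lambda>x. (1 / l) * f x)" by (rule hpoly_cmult[OF less(3)])
    moreover have "lap N (\<lambda>x. (1 / l) * f x) x = 0" for x
      using lap_hpoly_0_1[OF N calculation True] .
    ultimately show ?thesis using less(2) by (intro exI[of _ "\<lambda>x. (1 / l) * f x"]) auto
  next
    case False
    then obtain m where n: "n = Suc (Suc m)" using le_Suc_ex[of 2 n] by auto
    have "0 < l + 2 * real N + 4 * real m" using less(2) by simp
    then obtain g where g: "hpoly N m g" "\<And>x. (l + 2 * real N + 4 * real m) * g x + norm2 N x * lap N g x = lap N f x"
      using less(1)[of m "l + 2 * real N + 4 * real m" "lap N f"] less(3) hpoly_lap[OF N, of m f] n by auto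
    define h where "h = (\<lambda>x. f x - norm2 N x * g x)"
    have ng: "hpoly N n (\<lambda>x. norm2 N x * g x)" using hpoly_mult[OF hpoly_norm2[OF N] g(1)] n by simp
    have h: "hpoly N n h" unfolding h_def by (rule hpoly_diff[OF less(3) ng])
    have "lap N h x = lap N f x + (- 1) * lap N (\<lambda>x. norm2 N x * g x) x" for x
      using lap_add[OF N less(3) hpoly_cmult[OF ng, of "- 1"], of x] lap_cmult[OF N ng, of "- 1" x] by (simp add: h_def)
    from this lap_norm2_mult[OF N g(1)] have lh: "lap N h x = l * g x" for x
      using g(2)[of x] by (simp add: distrib_right)
    have "lap N (\<lambda>x. (1 / l) * h x) x = g x" for x
      using lap_cmult[OF N h, of "1 / l" x] lh less(2) by simp
    then show ?thesis using hpoly_cmult[OF h, of "1 / l"] less(2)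
      by (intro exI[of _ "\<lambda>x. (1 / l) * h x"]) (auto simp: h_def)
  qed
qed

section \<open>Solid harmonics and the Fischer decomposition\<close>

definition solid_harmonic :: "nat \<Rightarrow> nat \<Rightarrow> ((nat \<Rightarrow> real) \<Rightarrow> real) \<Rightarrow> bool" where
  "solid_harmonic N n f \<longleftrightarrow> hpoly N n f \<and> (\<forall>x. lap N f x = 0)"

lemma solid_harmonic_cmult: "0 < N \<Longrightarrow> solid_harmonic N n f \<Longrightarrow> solid_harmonic N n (\<lambda>x. c * f x)"
  unfolding solid_harmonic_def using lap_cmult[of N n f c] by (auto intro: hpoly_cmult)

lemma solid_harmonic_add: "0 < N \<Longrightarrow> solid_harmonic N n f \<Longrightarrow> solid_harmonic N n g \<Longrightarrow> solid_harmonic N n (\<lambda>x. f x + g x)"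
  unfolding solid_harmonic_def using lap_add[of N n f n g] by (auto intro: hpoly_add)

lemma solid_harmonic_zero: "0 < N \<Longrightarrow> solid_harmonic N n (\<lambda>_. 0)"
  by (simp add: solid_harmonic_def hpoly_zero lap_def pd_const)

lemma solid_harmonic_sum:
  assumes "0 < N" "finite I" "\<And>i. i \<in> I \<Longrightarrow> solid_harmonic N n (f i)"
  shows "solid_harmonic N n (\<lambda>x. \<Sum>i\<in>I. f i x)"
  using assms(2,3) by (induction I rule: finite_induct) (auto intro: solid_harmonic_zero[OF assms(1)] solid_harmonic_add[OF assms(1)])

inductive harm_span :: "nat \<Rightarrow> ((nat \<Rightarrow> real) \<Rightarrow> real) \<Rightarrow> bool" for N where
  harm_span_harm: "solid_harmonic N n f \<Longrightarrow> harm_span N f"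
| harm_span_add: "harm_span N f \<Longrightarrow> harm_span N g \<Longrightarrow> harm_span N (\<lambda>x. f x + g x)"

text \<open>Write f = h + |x|^2 g with h harmonic: the condition lap(|x|^2 g) = lap f is the
  equation solved above with l = 2N + 4m. On the unit sphere the factor |x|^2 is 1, and g has degree
  smaller by 2.\<close>

lemma fischer_decomposition:
  assumes N: "0 < N"
  shows "hpoly N n f \<Longrightarrow> \<exists>h. harm_span N h \<and> (\<forall>x. norm2 N x = 1 \<longrightarrow> f x = h x)"
proof (induction n arbitrary: f rule: less_induct)
  case (less n)
  show ?case
  proof (cases "n < 2")
    case True
    then have "solid_harmonic N n f" using lap_hpoly_0_1[OF N less(2)] less(2) by (simp add: solid_harmonic_def)
    then show ?thesis using harm_span_harm by blast
  next
    case False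
    then obtain m where n: "n = Suc (Suc m)" using le_Suc_ex[of 2 n] by auto
    obtain g where g: "hpoly N m g" "\<And>x. (2 * real N + 4 * real m) * g x + norm2 N x * lap N g x = lap N f x"
      using ex_lap_equation[OF N, of "2 * real N + 4 * real m" m "lap N f"] hpoly_lap[OF N] less(2) n N by auto
    have ng: "hpoly N n (\<lambda>x. norm2 N x * g x)" using hpoly_mult[OF hpoly_norm2[OF N] g(1)] n by simp
    define h where "h = (\<lambda>x. f x - norm2 N x * g x)"
    have "lap N h x = lap N f x + (- 1) * lap N (\<lambda>x. norm2 N x * g x) x" for x
      using lap_add[OF N less(2) hpoly_cmult[OF ng, of "- 1"], of x] lap_cmult[OF N ng, of "- 1" x] by (simp add: h_def)
    from this lap_norm2_mult[OF N g(1)] have "lap N h x = 0" for x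
      using g(2)[of x] by simp
    then have h: "solid_harmonic N n h" unfolding solid_harmonic_def h_def using hpoly_diff[OF less(2) ng] by blast
    obtain s where s: "harm_span N s" "\<And>x. norm2 N x = 1 \<Longrightarrow> g x = s x"
      using less(1)[of m g] g(1) n by auto
    have "harm_span N (\<lambda>x. h x + s x)" by (intro harm_span_add harm_span_harm[OF h] s)
    moreover have "f x = h x + s x" if "norm2 N x = 1" for x
      using s(2)[OF that] that by (simp add: h_def)
    ultimately show ?thesis by blast
  qed
qed

text \<open>All polynomials. Unlike homogeneous ones of fixed degree they form an algebra, as
  Stone-Weierstrass requires.\<close>

inductive psum :: "nat \<Rightarrow> ((nat \<Rightarrow> real) \<Rightarrow> real) \<Rightarrow> bool" for N where
  psum_hpoly: "hpoly N n f \<Longrightarrow> psum N f"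
| psum_add: "psum N f \<Longrightarrow> psum N g \<Longrightarrow> psum N (\<lambda>x. f x + g x)"

lemma psum_mult_hpoly: "psum N f \<Longrightarrow> hpoly N n g \<Longrightarrow> psum N (\<lambda>x. f x * g x)"
  by (induction rule: psum.induct) (auto intro: psum_hpoly hpoly_mult psum_add simp: distrib_right)

lemma psum_mult: "psum N g \<Longrightarrow> psum N f \<Longrightarrow> psum N (\<lambda>x. f x * g x)"
  by (induction rule: psum.induct) (auto intro: psum_mult_hpoly psum_add simp: distrib_left)

lemma continuous_on_psum: "psum N f \<Longrightarrow> continuous_on A f"
  by (induction rule: psum.induct) (auto intro: continuous_on_hpoly continuous_intros)

lemma psum_harm_span:
  assumes "0 < N" "psum N f"
  shows "\<exists>h. harm_span N h \<and> (\<forall>x. norm2 N x = 1 \<longrightarrow> f x = h x)"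
  using assms(2)
proof (induction rule: psum.induct)
  case (psum_hpoly n f)
  then show ?case by (rule fischer_decomposition[OF assms(1)])
next
  case (psum_add f g)
  then obtain a b where "harm_span N a" "\<forall>x. norm2 N x = 1 \<longrightarrow> f x = a x" "harm_span N b" "\<forall>x. norm2 N x = 1 \<longrightarrow> g x = b x"
    by blast
  then show ?case by (intro exI[of _ "\<lambda>x. a x + b x"]) (auto intro: harm_span_add)
qed

lemma continuous_on_solid_harmonic: "solid_harmonic N n f \<Longrightarrow> continuous_on A f"
  unfolding solid_harmonic_def using continuous_on_hpoly by blast

section \<open>Lebesgue measure and polar coordinates\<close>

lemma Rn_iff: "x \<in> Rn N \<longleftrightarrow> (\<forall>i\<ge>N. x i = undefined)"
  by (auto simp: Rn_def PiE_def extensional_def)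

lemma escale_in_Rn: "escale N t x \<in> Rn N"
  by (simp add: Rn_iff escale_def)

lemma fun_upd_in_Rn: "x \<in> Rn N \<Longrightarrow> i < N \<Longrightarrow> x(i := t) \<in> Rn N"
  by (auto simp: Rn_iff)

lemma enorm_nonneg: "enorm N x \<ge> 0"
  by (simp add: enorm_def)

lemma norm2_enorm: "norm2 N x = (enorm N x)\<^sup>2"
  by (simp add: norm2_def enorm_def L2_set_def sum_nonneg)

lemma enorm_eq: "enorm N x = sqrt (norm2 N x)"
  by (simp add: norm2_enorm enorm_nonneg)

lemma escale_escale: "escale N s (escale N t x) = escale N (s * t) x"
  by (auto simp: escale_def fun_eq_iff)

lemma escale_1: "x \<in> Rn N \<Longrightarrow> escale N 1 x = x"
  by (auto simp: escale_def Rn_iff fun_eq_iff restrict_def)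

lemma continuous_on_coord: "continuous_on A (\<lambda>x :: nat \<Rightarrow> real. x i)"
  by (rule continuous_on_subset[OF continuous_on_product_coordinates]) simp

lemma continuous_on_norm2: "continuous_on A (norm2 N)"
  unfolding norm2_def[abs_def] by (intro continuous_intros continuous_on_coord)

lemma continuous_on_enorm: "continuous_on A (enorm N)"
  unfolding enorm_eq[abs_def] by (intro continuous_intros continuous_on_norm2)

lemma continuous_on_escale:
  fixes t :: "'a :: topological_space \<Rightarrow> real" and x :: "'a \<Rightarrow> nat \<Rightarrow> real"
  assumes "continuous_on A t" "continuous_on A x"
  shows "continuous_on A (\<lambda>z. escale N (t z) (x z))"
proof (rule continuous_on_coordinatewise_then_product)
  fix i
  have "continuous_on A (\<lambda>z. x z i)"
    by (rule continuous_on_compose2[OF continuous_on_coord[of UNIV i] assms(2)]) simp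
  then show "continuous_on A (\<lambda>z. escale N (t z) (x z) i)"
    by (cases "i < N") (auto simp: escale_def restrict_def intro!: continuous_intros assms(1))
qed

lemma compact_PiE_nat:
  assumes "\<And>i. compact (K i)"
  shows "compact (PiE UNIV K :: (nat \<Rightarrow> real) set)"
proof -
  have "compactin (product_topology (\<lambda>_. euclidean) UNIV) (PiE UNIV K)"
    using assms by (subst compactin_PiE) auto
  then show ?thesis by (simp add: euclidean_product_topology)
qed

lemma abs_le_enorm:
  assumes "i < N"
  shows "\<bar>x i\<bar> \<le> enorm N x"
proof -
  have "(x i)\<^sup>2 \<le> norm2 N x"
    unfolding norm2_def using assms by (intro member_le_sum) auto
  then show ?thesis unfolding enorm_eq by (intro real_le_rsqrt) simp
qed

lemma closed_Rn: "closed (Rn N)"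
proof -
  have "Rn N = PiE UNIV (\<lambda>i. if i < N then UNIV else {undefined})"
    by (auto simp: Rn_iff PiE_def Pi_def)
  also have "closed \<dots>"
    using closedin_product_topology[of "\<lambda>_. euclidean" UNIV "\<lambda>i. if i < N then UNIV else {undefined :: real}"]
    by (auto simp: euclidean_product_topology)
  finally show ?thesis .
qed

text \<open>The coordinates from \<open>N\<close> on are pinned to \<open>undefined\<close>, so the
  set lies in a product of compact factors, intervals or singletons, and Tychonoff's theorem
  applies.\<close>

lemma compact_annulus: "compact {x \<in> Rn N. a \<le> enorm N x \<and> enorm N x \<le> b}"
proof -
  have "compact (PiE UNIV (\<lambda>i. if i < N then {-b..b} else {undefined :: real}))"
    by (rule compact_PiE_nat) auto
  moreover have "closed (Rn N \<inter> {x. a \<le> enorm N x} \<inter> {x. enorm N x \<le> b})"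
    by (intro closed_Int closed_Rn closed_Collect_le continuous_on_enorm continuous_on_const)
  ultimately have "compact (PiE UNIV (\<lambda>i. if i < N then {-b..b} else {undefined :: real}) \<inter> (Rn N \<inter> {x. a \<le> enorm N x} \<inter> {x. enorm N x \<le> b}))"
    by (rule compact_Int_closed)
  also have "PiE UNIV (\<lambda>i. if i < N then {-b..b} else {undefined :: real}) \<inter> (Rn N \<inter> {x. a \<le> enorm N x} \<inter> {x. enorm N x \<le> b})
      = {x \<in> Rn N. a \<le> enorm N x \<and> enorm N x \<le> b}"
  proof -
    have "x i \<in> {-b..b}" if "enorm N x \<le> b" "i < N" for x i
      using abs_le_enorm[OF that(2), of x] that(1) by auto
    then show ?thesis by (auto simp: Rn_iff PiE_def Pi_def)
  qed
  finally show ?thesis .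
qed

lemma compact_esphere: "compact (esphere N r)"
proof -
  have "esphere N r = {x \<in> Rn N. r \<le> enorm N x \<and> enorm N x \<le> r}" by (auto simp: esphere_def)
  then show ?thesis by (simp add: compact_annulus)
qed

text \<open>Links the product sigma-algebra over the first \<open>N\<close> coordinates with the
  Borel sets of the whole function space: on \<open>Rn N\<close> the other coordinates are constant.
  Through it continuous functions become integrands.\<close>

lemma measurable_id_lebN: "(\<lambda>x. x) \<in> borel_measurable (lebN N)"
proof (rule measurable_coordinatewise_then_product)
  fix i
  show "(\<lambda>x. x i) \<in> borel_measurable (lebN N)"
  proof (cases "i < N")
    case True
    then show ?thesis
      using measurable_component_singleton[of i "{..<N}" "\<lambda>_. lborel :: real measure"] by (simp add: lebN_def)
  next
    case False
    have "(\<lambda>x. undefined :: real) \<in> borel_measurable (lebN N)" by simp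
    also have "?this \<longleftrightarrow> ?thesis"
      using False by (intro measurable_cong) (auto simp: space_lebN Rn_iff)
    finally show ?thesis .
  qed
qed

lemma measurable_lebN_of_borel: "f \<in> borel_measurable borel \<Longrightarrow> f \<in> borel_measurable (lebN N)"
  using measurable_compose[OF measurable_id_lebN] by blast

lemma exterior_ball_borel: "exterior_ball N R \<in> sets borel"
proof -
  have "exterior_ball N R = Rn N \<inter> {x. enorm N x > R}" by (auto simp: exterior_ball_def)
  moreover have "open {x. enorm N x > R}" by (intro open_Collect_less continuous_on_enorm continuous_on_const)
  ultimately show ?thesis using closed_Rn by auto
qed

lemma emeasure_ball_finite: "emeasure (lebN N) {x \<in> Rn N. enorm N x \<le> b} < \<infinity>"
proof -
  interpret product_sigma_finite "\<lambda>_. lborel :: real measure"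
    by (rule product_sigma_finite.intro) (rule sigma_finite_lborel)
  have "{x \<in> Rn N. enorm N x \<le> b} \<subseteq> PiE {..<N} (\<lambda>_. {-b..b})"
  proof (intro subsetI PiE_I)
    fix x i assume x: "x \<in> {x \<in> Rn N. enorm N x \<le> b}"
    show "x i \<in> {-b..b}" if "i \<in> {..<N}" using abs_le_enorm[of i N x] that x by auto
    show "x i = undefined" if "i \<notin> {..<N}" using that x by (auto simp: Rn_iff)
  qed
  then have "emeasure (lebN N) {x \<in> Rn N. enorm N x \<le> b} \<le> emeasure (lebN N) (PiE {..<N} (\<lambda>_. {-b..b}))"
    unfolding lebN_def by (intro emeasure_mono sets_PiM_I_finite) auto
  also have "\<dots> = (\<Prod>i<N. emeasure lborel {-b..b})"
    unfolding lebN_def by (rule emeasure_PiM) auto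
  also have "\<dots> < \<infinity>" by (simp add: emeasure_lborel_Icc_eq power_less_top_ennreal)
  finally show ?thesis .
qed

lemma integrable_annulus:
  fixes f :: "(nat \<Rightarrow> real) \<Rightarrow> complex"
  assumes f: "continuous_on (exterior_ball N R) f" and R: "R < a"
    and supp: "\<And>x. x \<in> Rn N \<Longrightarrow> \<not> (a \<le> enorm N x \<and> enorm N x \<le> b) \<Longrightarrow> f x = 0"
  shows "integrable (lebN N) f"
proof -
  let ?K = "{x \<in> Rn N. a \<le> enorm N x \<and> enorm N x \<le> b}"
  have K: "?K \<subseteq> exterior_ball N R" using R by (auto simp: exterior_ball_def)
  have Ks: "?K \<in> sets (lebN N)"
  proof -
    have "?K = {x \<in> space (lebN N). a \<le> enorm N x \<and> enorm N x \<le> b}" by (simp add: space_lebN)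
    then show ?thesis by simp
  qed
  have "compact (f ` ?K)"
    by (rule compact_continuous_image[OF continuous_on_subset[OF f K] compact_annulus])
  then have "bounded (f ` ?K)" by (rule compact_imp_bounded)
  then obtain B where B: "\<And>x. x \<in> ?K \<Longrightarrow> norm (f x) \<le> B"
    unfolding bounded_iff by blast
  have "(\<lambda>x. indicator (exterior_ball N R) x *\<^sub>R f x) \<in> borel_measurable (lebN N)"
    by (rule measurable_lebN_of_borel[OF borel_measurable_continuous_on_indicator[OF exterior_ball_borel f]])
  also have "?this \<longleftrightarrow> f \<in> borel_measurable (lebN N)"
  proof (rule measurable_cong)
    fix x assume x: "x \<in> space (lebN N)"
    show "indicator (exterior_ball N R) x *\<^sub>R f x = f x"
    proof (cases "x \<in> exterior_ball N R")
      case False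
      then have "f x = 0" using supp[of x] x R by (auto simp: space_lebN exterior_ball_def)
      then show ?thesis by simp
    qed simp
  qed
  finally have meas: "f \<in> borel_measurable (lebN N)" .
  have fin: "emeasure (lebN N) ?K < \<infinity>"
  proof -
    have "{x \<in> Rn N. enorm N x \<le> b} = {x \<in> space (lebN N). enorm N x \<le> b}" by (simp add: space_lebN)
    then have "emeasure (lebN N) ?K \<le> emeasure (lebN N) {x \<in> Rn N. enorm N x \<le> b}"
      by (intro emeasure_mono) auto
    then show ?thesis using emeasure_ball_finite by (rule le_less_trans)
  qed
  show ?thesis
  proof (rule Bochner_Integration.integrable_bound)
    show "integrable (lebN N) (\<lambda>x. indicator ?K x * B)"
      using Ks fin by (intro integrable_mult_left integrable_real_indicator)
    show "AE x in lebN N. norm (f x) \<le> norm (indicator ?K x * B)"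
    proof (rule AE_I2)
      fix x assume "x \<in> space (lebN N)"
      then show "norm (f x) \<le> norm (indicator ?K x * B)"
        using B[of x] supp[of x] by (cases "x \<in> ?K") (auto simp: space_lebN)
    qed
  qed (rule meas)
qed

section \<open>Dilations and the surface measure\<close>

text \<open>Both measures are compared on boxes, where each side contributes one factor from the
  dilation of the line.\<close>

lemma lebN_scaling:
  assumes t: "t > 0"
  shows "lebN N = scale_measure (ennreal (t ^ N)) (distr (lebN N) (lebN N) (escale N t))"
proof -
  interpret product_sigma_finite "\<lambda>_. lborel :: real measure"
    by (rule product_sigma_finite.intro) (rule sigma_finite_lborel)
  have m: "escale N t \<in> measurable (lebN N) (lebN N)"
    unfolding escale_def[abs_def] lebN_def by measurable
  have 1: "emeasure lborel ((*) t -` A) = ennreal (1 / t) * emeasure lborel A" if "A \<in> sets borel" for A :: "real set"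
  proof -
    have "emeasure (distr lborel borel ((*) t)) A = emeasure lborel ((*) t -` A)"
      using that by (subst emeasure_distr) auto
    moreover have "emeasure (distr lborel borel ((*) t)) A = ennreal (1 / t) * emeasure lborel A"
      using that t by (subst lborel_distr_mult) (auto simp: emeasure_density nn_integral_cmult_indicator inverse_eq_divide)
    ultimately show ?thesis by simp
  qed
  have "scale_measure (ennreal (t ^ N)) (distr (lebN N) (lebN N) (escale N t)) = PiM {..<N} (\<lambda>_. lborel)"
  proof (rule PiM_eqI)
    fix A :: "nat \<Rightarrow> real set" assume A: "\<And>i. i \<in> {..<N} \<Longrightarrow> A i \<in> sets lborel"
    have "PiE {..<N} A \<in> sets (lebN N)" unfolding lebN_def using A by (intro sets_PiM_I_finite) auto
    then have "emeasure (distr (lebN N) (lebN N) (escale N t)) (PiE {..<N} A) = emeasure (lebN N) (escale N t -` PiE {..<N} A \<inter> space (lebN N))"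
      by (rule emeasure_distr[OF m])
    also have "escale N t -` PiE {..<N} A \<inter> space (lebN N) = PiE {..<N} (\<lambda>i. (*) t -` A i)"
      by (auto simp: space_lebN Rn_def escale_def PiE_def Pi_def extensional_def)
    also have "emeasure (lebN N) (PiE {..<N} (\<lambda>i. (*) t -` A i)) = (\<Prod>i<N. emeasure lborel ((*) t -` A i))"
      unfolding lebN_def
    proof (rule emeasure_PiM)
      show "(*) t -` A i \<in> sets lborel" if "i \<in> {..<N}" for i
        using A[OF that] measurable_sets[of "(*) t" borel borel "A i"] by simp
    qed simp
    also have "\<dots> = (\<Prod>i<N. ennreal (1 / t) * emeasure lborel (A i))"
      using A 1 by (intro prod.cong) auto
    also have "\<dots> = ennreal (1 / t) ^ N * (\<Prod>i<N. emeasure lborel (A i))"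
      by (simp add: prod.distrib)
    finally have "emeasure (scale_measure (ennreal (t ^ N)) (distr (lebN N) (lebN N) (escale N t))) (PiE {..<N} A)
        = (ennreal (t ^ N) * ennreal (1 / t) ^ N) * (\<Prod>i<N. emeasure lborel (A i))"
      by (simp add: mult.assoc)
    also have "ennreal (t ^ N) * ennreal (1 / t) ^ N = 1"
      using t by (simp add: ennreal_power power_divide flip: ennreal_mult)
    finally show "emeasure (scale_measure (ennreal (t ^ N)) (distr (lebN N) (lebN N) (escale N t))) (PiE {..<N} A) = (\<Prod>i<N. emeasure lborel (A i))"
      by simp
  qed (auto simp: lebN_def)
  then show ?thesis by (simp add: lebN_def)
qed

lemma measurable_escale: "escale N t \<in> measurable (lebN N) (lebN N)"
  unfolding escale_def[abs_def] lebN_def by measurable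

lemma nn_integral_lebN_scaling:
  assumes "t > 0" "f \<in> borel_measurable (lebN N)"
  shows "(\<integral>\<^sup>+x. f x \<partial>lebN N) = ennreal (t ^ N) * (\<integral>\<^sup>+x. f (escale N t x) \<partial>lebN N)"
proof -
  have "(\<integral>\<^sup>+x. f x \<partial>lebN N) = (\<integral>\<^sup>+x. f x \<partial>scale_measure (ennreal (t ^ N)) (distr (lebN N) (lebN N) (escale N t)))"
    using lebN_scaling[OF assms(1)] by simp
  also have "\<dots> = ennreal (t ^ N) * (\<integral>\<^sup>+x. f x \<partial>distr (lebN N) (lebN N) (escale N t))"
    using assms(2) by (intro nn_integral_scale_measure) simp
  also have "(\<integral>\<^sup>+x. f x \<partial>distr (lebN N) (lebN N) (escale N t)) = (\<integral>\<^sup>+x. f (escale N t x) \<partial>lebN N)"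
    using assms(2) by (intro nn_integral_distr measurable_escale) simp
  finally show ?thesis .
qed

lemma space_sphere_measure: "space (sphere_measure N r) = esphere N r"
  by (simp add: sphere_measure_def space_scale_measure space_restrict_space space_lebN Int_absorb2 esphere_def)

lemma sets_sphere_measure: "sets (sphere_measure N r) = sets (restrict_space (lebN N) (esphere N r))"
  by (simp add: sphere_measure_def)

lemma punctured_ball_sets: "{x \<in> Rn N. 0 < enorm N x \<and> enorm N x \<le> r} \<in> sets (lebN N)"
proof -
  have "{x \<in> Rn N. 0 < enorm N x \<and> enorm N x \<le> r} = {x \<in> space (lebN N). 0 < enorm N x \<and> enorm N x \<le> r}"
    by (simp add: space_lebN)
  then show ?thesis by simp
qed

lemma measurable_radial_extension:
  assumes "r > 0" "g \<in> borel_measurable (restrict_space (lebN N) (esphere N r))"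
  shows "(\<lambda>x. g (escale N (r / enorm N x) x) * indicator {x \<in> Rn N. 0 < enorm N x \<and> enorm N x \<le> r} x :: ennreal) \<in> borel_measurable (lebN N)"
proof -
  have "(\<lambda>x. g (escale N (r / enorm N x) x)) \<in> borel_measurable (restrict_space (lebN N) {x \<in> Rn N. 0 < enorm N x \<and> enorm N x \<le> r})"
    by (rule measurable_compose[OF radial_projection_measurable[OF assms(1)] assms(2)])
  then show ?thesis
    by (subst (asm) borel_measurable_restrict_space_iff_ennreal[OF sets.Int[OF punctured_ball_sets sets.top]])
qed

lemma nn_integral_sphere_measure:
  assumes r: "r > 0" and g: "g \<in> borel_measurable (restrict_space (lebN N) (esphere N r))"
  shows "(\<integral>\<^sup>+x. g x \<partial>sphere_measure N r) =
    ennreal (real N / r) * (\<integral>\<^sup>+x. g (escale N (r / enorm N x) x) * indicator {x \<in> Rn N. 0 < enorm N x \<and> enorm N x \<le> r} x \<partial>lebN N)"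
proof -
  have "(\<integral>\<^sup>+x. g x \<partial>sphere_measure N r) = ennreal (real N / r) *
      (\<integral>\<^sup>+x. g x \<partial>distr (restrict_space (lebN N) {x \<in> Rn N. 0 < enorm N x \<and> enorm N x \<le> r})
              (restrict_space (lebN N) (esphere N r)) (\<lambda>x. escale N (r / enorm N x) x))"
    unfolding sphere_measure_def using g by (intro nn_integral_scale_measure) simp
  also have "(\<integral>\<^sup>+x. g x \<partial>distr (restrict_space (lebN N) {x \<in> Rn N. 0 < enorm N x \<and> enorm N x \<le> r})
              (restrict_space (lebN N) (esphere N r)) (\<lambda>x. escale N (r / enorm N x) x))
     = (\<integral>\<^sup>+x. g (escale N (r / enorm N x) x) \<partial>restrict_space (lebN N) {x \<in> Rn N. 0 < enorm N x \<and> enorm N x \<le> r})"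
    using g by (intro nn_integral_distr radial_projection_measurable r) simp
  also have "\<dots> = (\<integral>\<^sup>+x. g (escale N (r / enorm N x) x) * indicator {x \<in> Rn N. 0 < enorm N x \<and> enorm N x \<le> r} x \<partial>lebN N)"
    by (rule nn_integral_restrict_space[OF sets.Int[OF punctured_ball_sets sets.top]])
  finally show ?thesis .
qed

lemma measurable_escale_sphere:
  assumes "r > 0"
  shows "escale N r \<in> measurable (restrict_space (lebN N) (esphere N 1)) (restrict_space (lebN N) (esphere N r))"
  by (rule measurable_restrict_space3[OF measurable_escale])
     (use assms in \<open>auto simp: esphere_def enorm_escale escale_in_Rn\<close>)

text \<open>Dilation of volume gives r^N, and the factor N/r in the surface measure takes one power
  back.\<close>

lemma nn_integral_sphere_scaling:
  assumes N: "N > 0" and r: "r > 0" and g: "g \<in> borel_measurable (restrict_space (lebN N) (esphere N r))"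
  shows "(\<integral>\<^sup>+x. g x \<partial>sphere_measure N r) = ennreal (r ^ (N - 1)) * (\<integral>\<^sup>+w. g (escale N r w) \<partial>sphere_measure N 1)"
proof -
  let ?B = "\<lambda>r. {x \<in> Rn N. 0 < enorm N x \<and> enorm N x \<le> r}"
  have eq: "g (escale N (r / enorm N (escale N r x)) (escale N r x)) * indicator (?B r) (escale N r x)
      = g (escale N r (escale N (1 / enorm N x) x)) * indicator (?B 1) x" if "x \<in> space (lebN N)" for x
  proof -
    have "indicator (?B r) (escale N r x) = (indicator (?B 1) x :: ennreal)"
      using r that by (auto simp: indicator_def escale_in_Rn enorm_escale zero_less_mult_iff space_lebN mult_le_cancel_left2)
    moreover have "escale N (r / enorm N (escale N r x)) (escale N r x) = escale N r (escale N (1 / enorm N x) x)"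
      using r by (simp add: escale_escale enorm_escale)
    ultimately show ?thesis by simp
  qed
  have "(\<integral>\<^sup>+x. g x \<partial>sphere_measure N r) = ennreal (real N / r) * (\<integral>\<^sup>+x. g (escale N (r / enorm N x) x) * indicator (?B r) x \<partial>lebN N)"
    by (rule nn_integral_sphere_measure[OF r g])
  also have "(\<integral>\<^sup>+x. g (escale N (r / enorm N x) x) * indicator (?B r) x \<partial>lebN N)
     = ennreal (r ^ N) * (\<integral>\<^sup>+x. g (escale N r (escale N (1 / enorm N x) x)) * indicator (?B 1) x \<partial>lebN N)"
    by (subst nn_integral_lebN_scaling[OF r measurable_radial_extension[OF r g]]) (use eq in \<open>simp cong: nn_integral_cong\<close>)
  also have "ennreal (real N / r) * (ennreal (r ^ N) * (\<integral>\<^sup>+x. g (escale N r (escale N (1 / enorm N x) x)) * indicator (?B 1) x \<partial>lebN N))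
     = ennreal (r ^ (N - 1)) * (ennreal (real N / 1) * (\<integral>\<^sup>+x. g (escale N r (escale N (1 / enorm N x) x)) * indicator (?B 1) x \<partial>lebN N))"
  proof -
    have "real N / r * r ^ N = r ^ (N - 1) * real N" using N r by (cases N) auto
    then have "ennreal (real N / r) * ennreal (r ^ N) = ennreal (r ^ (N - 1)) * ennreal (real N / 1)"
      using r by (simp flip: ennreal_mult)
    then show ?thesis by (simp only: mult.assoc[symmetric])
  qed
  also have "ennreal (real N / 1) * (\<integral>\<^sup>+x. g (escale N r (escale N (1 / enorm N x) x)) * indicator (?B 1) x \<partial>lebN N)
     = (\<integral>\<^sup>+w. g (escale N r w) \<partial>sphere_measure N 1)"
    by (rule nn_integral_sphere_measure[OF _ measurable_compose[OF measurable_escale_sphere[OF r] g], symmetric]) simp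
  finally show ?thesis .
qed

lemma finite_measure_sphere:
  assumes "r > 0"
  shows "finite_measure (sphere_measure N r)"
proof (rule finite_measureI)
  let ?B = "{x \<in> Rn N. 0 < enorm N x \<and> enorm N x \<le> r}"
  have "emeasure (sphere_measure N r) (space (sphere_measure N r)) = (\<integral>\<^sup>+x. 1 \<partial>sphere_measure N r)" by simp
  also have "\<dots> = ennreal (real N / r) * (\<integral>\<^sup>+x. 1 * indicator ?B x \<partial>lebN N)"
    by (rule nn_integral_sphere_measure[OF assms]) simp
  also have "(\<integral>\<^sup>+x. 1 * indicator ?B x \<partial>lebN N) = emeasure (lebN N) ?B" using punctured_ball_sets by simp
  also have "ennreal (real N / r) * emeasure (lebN N) ?B < \<infinity>"
  proof -
    have "{x \<in> Rn N. enorm N x \<le> r} = {x \<in> space (lebN N). enorm N x \<le> r}" by (simp add: space_lebN)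
    then have "emeasure (lebN N) ?B \<le> emeasure (lebN N) {x \<in> Rn N. enorm N x \<le> r}"
      by (intro emeasure_mono) auto
    then have "emeasure (lebN N) ?B < \<infinity>" using emeasure_ball_finite by (rule le_less_trans)
    then show ?thesis by (simp add: ennreal_mult_less_top)
  qed
  finally show "emeasure (sphere_measure N r) (space (sphere_measure N r)) \<noteq> \<infinity>" by simp
qed

lemma measurable_sphere_continuous:
  fixes f :: "(nat \<Rightarrow> real) \<Rightarrow> 'b :: {second_countable_topology, t2_space}"
  assumes "continuous_on (esphere N r) f"
  shows "f \<in> borel_measurable (restrict_space (lebN N) (esphere N r))"
proof -
  have "(\<lambda>x. x) \<in> measurable (restrict_space (lebN N) (esphere N r)) (restrict_space borel (esphere N r))"
    by (rule measurable_restrict_space3[OF measurable_id_lebN]) simp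
  from measurable_compose[OF this borel_measurable_continuous_on_restrict[OF assms]] show ?thesis .
qed

lemma borel_measurable_sphere_measure:
  fixes f :: "(nat \<Rightarrow> real) \<Rightarrow> 'b :: {second_countable_topology, t2_space}"
  assumes "continuous_on (esphere N r) f"
  shows "f \<in> borel_measurable (sphere_measure N r)"
  using measurable_sphere_continuous[OF assms] by (simp add: sphere_measure_def)

lemma continuous_sphere_bounded:
  fixes f :: "(nat \<Rightarrow> real) \<Rightarrow> 'b :: real_normed_vector"
  assumes "continuous_on (esphere N r) f"
  obtains B where "\<And>x. x \<in> esphere N r \<Longrightarrow> norm (f x) \<le> B" "B \<ge> 0"
proof -
  have "bounded (f ` esphere N r)"
    by (rule compact_imp_bounded[OF compact_continuous_image[OF assms compact_esphere]])
  then obtain B where B: "\<And>x. x \<in> esphere N r \<Longrightarrow> norm (f x) \<le> B" unfolding bounded_iff by blast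
  show thesis by (rule that[of "max B 0"]) (use order_trans[OF B max.cobounded1] in auto)
qed

lemma integrable_sphere:
  fixes f :: "(nat \<Rightarrow> real) \<Rightarrow> 'b :: {banach, second_countable_topology}"
  assumes "r > 0" "continuous_on (esphere N r) f"
  shows "integrable (sphere_measure N r) f"
proof -
  interpret finite_measure "sphere_measure N r" by (rule finite_measure_sphere[OF assms(1)])
  obtain B where "\<And>x. x \<in> esphere N r \<Longrightarrow> norm (f x) \<le> B" using continuous_sphere_bounded[OF assms(2)] by blast
  then show ?thesis
    by (intro integrable_const_bound[of _ B] borel_measurable_sphere_measure assms(2) AE_I2)
       (simp add: space_sphere_measure)
qed

lemma escale_exterior: "0 \<le> R \<Longrightarrow> R < r \<Longrightarrow> w \<in> esphere N 1 \<Longrightarrow> escale N r w \<in> exterior_ball N R"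
  by (simp add: esphere_def exterior_ball_def escale_in_Rn enorm_escale)

lemma continuous_on_escale_sphere:
  assumes "continuous_on (exterior_ball N R) f" "0 \<le> R" "R < r"
  shows "continuous_on (esphere N 1) (\<lambda>w. f (escale N r w))"
  by (rule continuous_on_compose2[OF assms(1) continuous_on_escale])
     (auto intro!: continuous_intros escale_exterior assms(2,3))

text \<open>Moves every sphere to the unit sphere, so that one orthonormal system serves all radii.
  The scaling is done with nonnegative integrals, where it holds without integrability
  conditions.\<close>

lemma L2_norm_sphere_sq:
  assumes N: "N > 0" and f: "continuous_on (exterior_ball N R) f" and r: "0 \<le> R" "R < r"
  shows "(L2_norm_sphere N r f)\<^sup>2 = r ^ (N - 1) * (\<integral>w. (norm (f (escale N r w)))\<^sup>2 \<partial>sphere_measure N 1)"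
proof -
  have r0: "r > 0" using r by simp
  have cf: "continuous_on (esphere N r) f"
    by (rule continuous_on_subset[OF f]) (use r in \<open>auto simp: esphere_def exterior_ball_def\<close>)
  have "(L2_norm_sphere N r f)\<^sup>2 = (\<integral>x. (norm (f x))\<^sup>2 \<partial>sphere_measure N r)"
    unfolding L2_norm_sphere_def by (intro real_sqrt_pow2 integral_nonneg) simp
  also have "\<dots> = enn2real (\<integral>\<^sup>+x. ennreal ((norm (f x))\<^sup>2) \<partial>sphere_measure N r)"
    using cf by (intro integral_eq_nn_integral borel_measurable_sphere_measure continuous_intros) auto
  also have "(\<integral>\<^sup>+x. ennreal ((norm (f x))\<^sup>2) \<partial>sphere_measure N r)
     = ennreal (r ^ (N - 1)) * (\<integral>\<^sup>+w. ennreal ((norm (f (escale N r w)))\<^sup>2) \<partial>sphere_measure N 1)"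
  proof (rule nn_integral_sphere_scaling[OF N r0])
    have "(\<lambda>x. (norm (f x))\<^sup>2) \<in> borel_measurable (restrict_space (lebN N) (esphere N r))"
      using cf by (intro measurable_sphere_continuous continuous_intros)
    then show "(\<lambda>x. ennreal ((norm (f x))\<^sup>2)) \<in> borel_measurable (restrict_space (lebN N) (esphere N r))" by simp
  qed
  also have "enn2real \<dots> = r ^ (N - 1) * enn2real (\<integral>\<^sup>+w. ennreal ((norm (f (escale N r w)))\<^sup>2) \<partial>sphere_measure N 1)"
    using r0 by (simp add: enn2real_mult)
  also have "enn2real (\<integral>\<^sup>+w. ennreal ((norm (f (escale N r w)))\<^sup>2) \<partial>sphere_measure N 1) = (\<integral>w. (norm (f (escale N r w)))\<^sup>2 \<partial>sphere_measure N 1)"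
    by (rule integral_eq_nn_integral[symmetric])
       (use continuous_on_escale_sphere[OF f r] in \<open>auto intro!: borel_measurable_sphere_measure continuous_intros\<close>)
  finally show ?thesis .
qed

section \<open>Integration in polar coordinates\<close>

definition radial_measure :: "nat \<Rightarrow> real measure" where
  "radial_measure N = density lborel (\<lambda>x. ennreal (indicator {0<..} x * x ^ (N - 1)))"

definition punctured_space :: "nat \<Rightarrow> (nat \<Rightarrow> real) set" where
  "punctured_space N = {x \<in> Rn N. 0 < enorm N x}"

lemma sigma_finite_radial_measure: "sigma_finite_measure (radial_measure N)"
  unfolding radial_measure_def
  by (subst sigma_finite_measure.sigma_finite_iff_density_finite) (auto intro: sigma_finite_lborel)

lemma emeasure_radial_measure_atMost:
  assumes "N > 0"
  shows "emeasure (radial_measure N) {..b} = ennreal (if b > 0 then b ^ N / real N else 0)"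
proof -
  have "emeasure (radial_measure N) {..b} = (\<integral>\<^sup>+x. ennreal (indicator {0<..} x * x ^ (N - 1)) * indicator {..b} x \<partial>lborel)"
    unfolding radial_measure_def by (rule emeasure_density) auto
  also have "\<dots> = (\<integral>\<^sup>+x. ennreal (x ^ (N - 1)) * indicator {0..b} x \<partial>lborel)"
  proof (rule nn_integral_cong_AE)
    have "AE x in lborel. x \<noteq> (0 :: real)" by (rule AE_lborel_singleton)
    then show "AE x in lborel. ennreal (indicator {0<..} x * x ^ (N - 1)) * indicator {..b} x = ennreal (x ^ (N - 1)) * indicator {0..b} x"
      by eventually_elim (auto simp: indicator_def)
  qed
  also have "\<dots> = ennreal (if b > 0 then b ^ N / real N else 0)"
  proof (cases "b > 0")
    case True
    have "(\<integral>\<^sup>+x. ennreal (x ^ (N - 1)) * indicator {0..b} x \<partial>lborel) = ennreal (b ^ N / real N - 0 ^ N / real N)"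
    proof (rule nn_integral_FTC_Icc)
      show "((\<lambda>x. x ^ N / real N) has_real_derivative x ^ (N - 1)) (at x)" for x
        using assms by (auto intro!: derivative_eq_intros)
    qed (use True in auto)
    then show ?thesis using True assms by (simp add: zero_power)
  next
    case False
    then have "b \<noteq> 0 \<Longrightarrow> {0..b} = {}" "b = 0 \<Longrightarrow> {0..b} = {0}" by auto
    then have "emeasure lborel {0..b} = 0" by (cases "b = 0") auto
    then have "AE x in lborel. x \<notin> {0..b}" by (intro AE_not_in) (auto simp: null_sets_def)
    then have "AE x in lborel. ennreal (x ^ (N - 1)) * indicator {0..b} x = 0" by eventually_elim simp
    from nn_integral_cong_AE[OF this]
    have "(\<integral>\<^sup>+x. ennreal (x ^ (N - 1)) * indicator {0..b} x \<partial>lborel) = (\<integral>\<^sup>+x. 0 \<partial>(lborel :: real measure))" .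
    then show ?thesis using False by simp
  qed
  finally show ?thesis .
qed

lemma punctured_space_sets: "punctured_space N \<in> sets (lebN N)"
proof -
  have "punctured_space N = {x \<in> space (lebN N). 0 < enorm N x}" by (simp add: punctured_space_def space_lebN)
  then show ?thesis by simp
qed

lemma measurable_direction:
  "(\<lambda>x. escale N (1 / enorm N x) x) \<in> measurable (restrict_space (lebN N) (punctured_space N)) (sphere_measure N 1)"
proof -
  have "(\<lambda>x. escale N (1 / enorm N x) x) \<in> measurable (restrict_space (lebN N) (punctured_space N)) (restrict_space (lebN N) (esphere N 1))"
  proof (rule measurable_restrict_space3)
    show "(\<lambda>x. escale N (1 / enorm N x) x) \<in> measurable (lebN N) (lebN N)"
      unfolding escale_def enorm_def L2_set_def lebN_def by measurable
    show "(\<lambda>x. escale N (1 / enorm N x) x) \<in> punctured_space N \<rightarrow> esphere N 1"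
      by (auto simp: punctured_space_def esphere_def escale_in_Rn enorm_escale)
  qed
  then show ?thesis by (subst measurable_cong_sets[OF refl sets_sphere_measure])
qed

text \<open>It suffices to compare rectangles A x B. For fixed B both sides are measures in A, and
  half-lines determine them: the cone over B truncated at radius b has b^N times the volume of the
  one truncated at 1, which by definition of the surface measure is the measure of B divided by
  N.\<close>

lemma polar_measure:
  assumes N: "N > 0"
  shows "radial_measure N \<Otimes>\<^sub>M sphere_measure N 1 =
    distr (restrict_space (lebN N) (punctured_space N)) (borel \<Otimes>\<^sub>M sphere_measure N 1) (\<lambda>x. (enorm N x, escale N (1 / enorm N x) x))"
    (is "_ = distr ?L _ ?Q")
proof (rule pair_measure_eqI)
  interpret F: finite_measure "sphere_measure N 1" by (rule finite_measure_sphere) simp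
  show "sigma_finite_measure (sphere_measure N 1)" by unfold_locales
  show "sigma_finite_measure (radial_measure N)" by (rule sigma_finite_radial_measure)
  show "sets (radial_measure N \<Otimes>\<^sub>M sphere_measure N 1) = sets (distr ?L (borel \<Otimes>\<^sub>M sphere_measure N 1) ?Q)"
    by (simp add: radial_measure_def cong: sets_pair_measure_cong)
  have me: "enorm N \<in> borel_measurable ?L" by (intro measurable_restrict_space1 enorm_measurable)
  have mQ: "?Q \<in> measurable ?L (borel \<Otimes>\<^sub>M sphere_measure N 1)"
    by (rule measurable_Pair[OF me measurable_direction])
  fix A B assume A: "A \<in> sets (radial_measure N)" and B: "B \<in> sets (sphere_measure N 1)"
  \<comment> \<open>The infinite cone over \<open>B\<close>, without its apex.\<close>
  define X where "X = {x \<in> punctured_space N. escale N (1 / enorm N x) x \<in> B}"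
  have XL: "X \<in> sets (lebN N)"
  proof -
    have "(\<lambda>x. escale N (1 / enorm N x) x) -` B \<inter> space ?L \<in> sets ?L" by (rule measurable_sets[OF measurable_direction B])
    moreover have "(\<lambda>x. escale N (1 / enorm N x) x) -` B \<inter> space ?L = X"
      by (auto simp: X_def space_restrict_space punctured_space_def space_lebN)
    ultimately show ?thesis using punctured_space_sets by (simp add: sets_restrict_space_iff)
  qed
  have "scale_measure (emeasure (sphere_measure N 1) B) (radial_measure N) = distr (restrict_space (lebN N) X) borel (enorm N)"
  proof (rule measure_eqI_generator_eq[where \<Omega> = UNIV and E = "range atMost" and A = "\<lambda>n. {..real n}"])
    show "Int_stable (range (atMost :: real \<Rightarrow> _))" by (auto simp: Int_stable_def)
    show "sets (scale_measure (emeasure (sphere_measure N 1) B) (radial_measure N)) = sigma_sets UNIV (range atMost)"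
      by (simp add: radial_measure_def borel_eq_atMost)
    show "sets (distr (restrict_space (lebN N) X) borel (enorm N)) = sigma_sets UNIV (range atMost)"
      by (simp add: borel_eq_atMost)
    show "(\<Union>i. {..real i}) = UNIV" by (auto intro: real_arch_simple)
    show "emeasure (scale_measure (emeasure (sphere_measure N 1) B) (radial_measure N)) {..real i} \<noteq> \<infinity>" for i
      using F.emeasure_finite by (simp add: emeasure_radial_measure_atMost[OF N] ennreal_mult_eq_top_iff)
  next
    fix Y :: "real set" assume "Y \<in> range atMost"
    then obtain b where Y: "Y = {..b}" by auto
    have "emeasure (distr (restrict_space (lebN N) X) borel (enorm N)) Y = emeasure (restrict_space (lebN N) X) (enorm N -` Y \<inter> space (restrict_space (lebN N) X))"
      by (rule emeasure_distr) (auto simp: Y intro: measurable_restrict_space1)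
    also have "enorm N -` Y \<inter> space (restrict_space (lebN N) X) = {x \<in> X. enorm N x \<le> b}"
      using sets.sets_into_space[OF XL] by (auto simp: Y space_restrict_space)
    also have "emeasure (restrict_space (lebN N) X) {x \<in> X. enorm N x \<le> b} = emeasure (lebN N) {x \<in> X. enorm N x \<le> b}"
      using XL sets.sets_into_space[OF XL] by (intro emeasure_restrict_space) (auto simp: Int_absorb2)
    also have "\<dots> = ennreal (if b > 0 then b ^ N / real N else 0) * emeasure (sphere_measure N 1) B"
    proof (cases "b > 0")
      case True
      let ?g = "indicator B :: _ \<Rightarrow> ennreal"
      let ?Bb = "\<lambda>b. {x \<in> Rn N. 0 < enorm N x \<and> enorm N x \<le> b}"
      have gm: "?g \<in> borel_measurable (restrict_space (lebN N) (esphere N 1))"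
        using B by (simp add: sets_sphere_measure)
      have Xb: "{x \<in> X. enorm N x \<le> b} \<in> sets (lebN N)"
      proof -
        have "{x \<in> X. enorm N x \<le> b} = X \<inter> {x \<in> space (lebN N). enorm N x \<le> b}"
          using sets.sets_into_space[OF XL] by auto
        then show ?thesis using XL by simp
      qed
      have "emeasure (lebN N) {x \<in> X. enorm N x \<le> b} = (\<integral>\<^sup>+x. indicator {x \<in> X. enorm N x \<le> b} x \<partial>lebN N)"
        using Xb by simp
      also have "\<dots> = ennreal (b ^ N) * (\<integral>\<^sup>+x. indicator {x \<in> X. enorm N x \<le> b} (escale N b x) \<partial>lebN N)"
        using Xb by (intro nn_integral_lebN_scaling True) simp
      also have "(\<integral>\<^sup>+x. indicator {x \<in> X. enorm N x \<le> b} (escale N b x) \<partial>lebN N)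
         = (\<integral>\<^sup>+x. ?g (escale N (1 / enorm N x) x) * indicator (?Bb 1) x \<partial>lebN N)"
      proof (rule nn_integral_cong)
        fix x assume x: "x \<in> space (lebN N)"
        have "escale N (1 / enorm N (escale N b x)) (escale N b x) = escale N (1 / enorm N x) x"
          using True by (simp add: escale_escale enorm_escale)
        then show "indicator {x \<in> X. enorm N x \<le> b} (escale N b x) = ?g (escale N (1 / enorm N x) x) * indicator (?Bb 1) x"
          using True x by (auto simp: indicator_def X_def punctured_space_def escale_in_Rn enorm_escale space_lebN
              zero_less_mult_iff mult_le_cancel_left2)
      qed
      also have "emeasure (sphere_measure N 1) B = ennreal (real N / 1) * (\<integral>\<^sup>+x. ?g (escale N (1 / enorm N x) x) * indicator (?Bb 1) x \<partial>lebN N)"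
        using nn_integral_sphere_measure[OF zero_less_one gm] B by simp
      then have "ennreal (b ^ N / real N) * emeasure (sphere_measure N 1) B =
          (ennreal (b ^ N / real N) * ennreal (real N / 1)) * (\<integral>\<^sup>+x. ?g (escale N (1 / enorm N x) x) * indicator (?Bb 1) x \<partial>lebN N)"
        by (simp only: mult.assoc)
      moreover have "ennreal (b ^ N / real N) * ennreal (real N / 1) = ennreal (b ^ N)"
        using N True by (simp flip: ennreal_mult)
      ultimately show ?thesis using True by simp
    next
      case False
      then have *: "{x \<in> X. enorm N x \<le> b} = {}" by (auto simp: X_def punctured_space_def)
      show ?thesis unfolding * using False by simp
    qed
    also have "\<dots> = emeasure (scale_measure (emeasure (sphere_measure N 1) B) (radial_measure N)) Y"
      by (simp add: Y emeasure_radial_measure_atMost[OF N] mult.commute)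
    finally show "emeasure (scale_measure (emeasure (sphere_measure N 1) B) (radial_measure N)) Y =
      emeasure (distr (restrict_space (lebN N) X) borel (enorm N)) Y" by simp
  qed (auto)
  then have "emeasure (sphere_measure N 1) B * emeasure (radial_measure N) A = emeasure (distr (restrict_space (lebN N) X) borel (enorm N)) A"
    by (metis emeasure_scale_measure)
  also have "\<dots> = emeasure (restrict_space (lebN N) X) (enorm N -` A \<inter> space (restrict_space (lebN N) X))"
    using A by (intro emeasure_distr) (auto simp: radial_measure_def intro: measurable_restrict_space1)
  also have "enorm N -` A \<inter> space (restrict_space (lebN N) X) = {x \<in> X. enorm N x \<in> A}"
    using sets.sets_into_space[OF XL] by (auto simp: space_restrict_space)
  also have "emeasure (restrict_space (lebN N) X) {x \<in> X. enorm N x \<in> A} = emeasure (lebN N) {x \<in> X. enorm N x \<in> A}"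
    using XL sets.sets_into_space[OF XL] by (intro emeasure_restrict_space) (auto simp: Int_absorb2)
  also have "\<dots> = emeasure ?L {x \<in> X. enorm N x \<in> A}"
    using punctured_space_sets sets.sets_into_space[OF punctured_space_sets]
    by (intro emeasure_restrict_space[symmetric]) (auto simp: Int_absorb2 X_def)
  also have "{x \<in> X. enorm N x \<in> A} = ?Q -` (A \<times> B) \<inter> space ?L"
    by (auto simp: X_def space_restrict_space punctured_space_def space_lebN)
  also have "emeasure ?L (?Q -` (A \<times> B) \<inter> space ?L) = emeasure (distr ?L (borel \<Otimes>\<^sub>M sphere_measure N 1) ?Q) (A \<times> B)"
    using A B by (intro emeasure_distr[symmetric] mQ) (auto simp: radial_measure_def)
  finally show "emeasure (radial_measure N) A * emeasure (sphere_measure N 1) B = emeasure (distr ?L (borel \<Otimes>\<^sub>M sphere_measure N 1) ?Q) (A \<times> B)"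
    by (simp add: mult.commute)
qed


text \<open>Push-forward along \<open>polar_measure\<close> followed by Fubini. The value 0 at the
  origin lets the integral be restricted to the punctured space, on which the polar map is inverted
  by \<open>escale\<close>.\<close>

lemma polar_integral:
  fixes f :: "(nat \<Rightarrow> real) \<Rightarrow> complex"
  assumes N: "N > 0" and f: "integrable (lebN N) f" and f0: "\<And>x. x \<in> Rn N \<Longrightarrow> enorm N x = 0 \<Longrightarrow> f x = 0"
  shows "(\<integral>x. f x \<partial>lebN N) = (\<integral>t. (indicator {0<..} t * t ^ (N - 1)) *\<^sub>R (\<integral>w. f (escale N t w) \<partial>sphere_measure N 1) \<partial>lborel)"
proof -
  let ?S = "sphere_measure N 1" and ?L = "restrict_space (lebN N) (punctured_space N)"
  let ?Q = "\<lambda>x. (enorm N x, escale N (1 / enorm N x) x)"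
  let ?M = "radial_measure N \<Otimes>\<^sub>M ?S"
  interpret F: finite_measure ?S by (rule finite_measure_sphere) simp
  interpret R: sigma_finite_measure "radial_measure N" by (rule sigma_finite_radial_measure)
  interpret pair_sigma_finite "radial_measure N" ?S ..
  have me: "enorm N \<in> borel_measurable ?L" by (intro measurable_restrict_space1 enorm_measurable)
  have mQ: "?Q \<in> measurable ?L (borel \<Otimes>\<^sub>M ?S)"
    by (rule measurable_Pair[OF me measurable_direction])
  have mP: "(\<lambda>z. escale N (fst z) (snd z)) \<in> measurable (borel \<Otimes>\<^sub>M ?S) (lebN N)"
  proof -
    have "(\<lambda>z. \<lambda>i\<in>{..<N}. fst z * snd z i) \<in> measurable (borel \<Otimes>\<^sub>M ?S) (Pi\<^sub>M {..<N} (\<lambda>_. lborel :: real measure))"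
    proof (rule measurable_restrict)
      fix i assume i: "i \<in> {..<N}"
      have "(\<lambda>x. x i) \<in> borel_measurable (lebN N)"
        using measurable_component_singleton[OF i, of "\<lambda>_. lborel :: real measure"] by (simp add: lebN_def)
      then have "(\<lambda>x. x i) \<in> borel_measurable (restrict_space (lebN N) (esphere N 1))" by (rule measurable_restrict_space1)
      then have "(\<lambda>x. x i) \<in> borel_measurable ?S" by (subst measurable_cong_sets[OF sets_sphere_measure refl])
      then have "(\<lambda>z. snd z i) \<in> borel_measurable (borel \<Otimes>\<^sub>M ?S)" by (rule measurable_compose[OF measurable_snd])
      with measurable_fst have "(\<lambda>z. fst z * snd z i) \<in> borel_measurable (borel \<Otimes>\<^sub>M ?S)"
        by (rule borel_measurable_times)
      then show "(\<lambda>z. fst z * snd z i) \<in> measurable (borel \<Otimes>\<^sub>M ?S) lborel" by simp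
    qed
    then show ?thesis by (simp add: escale_def lebN_def)
  qed
  have fP: "(\<lambda>z. f (escale N (fst z) (snd z))) \<in> borel_measurable (borel \<Otimes>\<^sub>M ?S)"
    by (rule measurable_compose[OF mP borel_measurable_integrable[OF f]])
  have PQ: "escale N (fst (?Q x)) (snd (?Q x)) = x" if "x \<in> space ?L" for x
    using that by (simp add: space_restrict_space punctured_space_def escale_escale escale_1)
  have "(\<integral>x. f x \<partial>lebN N) = (\<integral>x. indicator (punctured_space N) x *\<^sub>R f x \<partial>lebN N)"
  proof (rule Bochner_Integration.integral_cong[OF refl])
    fix x assume "x \<in> space (lebN N)"
    then show "f x = indicator (punctured_space N) x *\<^sub>R f x"
      using f0[of x] enorm_nonneg[of N x] by (auto simp: indicator_def punctured_space_def space_lebN)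
  qed
  also have "\<dots> = (\<integral>x. f x \<partial>?L)"
    by (rule integral_restrict_space[symmetric, OF sets.Int[OF punctured_space_sets sets.top]])
  also have "\<dots> = (\<integral>x. f (escale N (fst (?Q x)) (snd (?Q x))) \<partial>?L)"
    by (rule Bochner_Integration.integral_cong[OF refl]) (use PQ in simp)
  also have "\<dots> = (\<integral>z. f (escale N (fst z) (snd z)) \<partial>distr ?L (borel \<Otimes>\<^sub>M ?S) ?Q)"
    by (rule integral_distr[OF mQ fP, symmetric])
  also have "\<dots> = (\<integral>z. f (escale N (fst z) (snd z)) \<partial>?M)"
    by (simp only: polar_measure[OF N])
  finally have 1: "(\<integral>x. f x \<partial>lebN N) = (\<integral>z. f (escale N (fst z) (snd z)) \<partial>?M)" .
  have "integrable ?L f"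
    using integrable_mult_indicator[OF punctured_space_sets f]
    by (simp add: integrable_restrict_space[OF sets.Int[OF punctured_space_sets sets.top]])
  then have "integrable ?L (\<lambda>x. f (escale N (fst (?Q x)) (snd (?Q x))))"
    using PQ by (simp cong: Bochner_Integration.integrable_cong)
  then have "integrable (distr ?L (borel \<Otimes>\<^sub>M ?S) ?Q) (\<lambda>z. f (escale N (fst z) (snd z)))"
    by (subst integrable_distr_eq[OF mQ fP])
  then have int: "integrable ?M (\<lambda>z. f (escale N (fst z) (snd z)))" by (simp only: polar_measure[OF N])
  have "(\<integral>z. f (escale N (fst z) (snd z)) \<partial>?M) = (\<integral>t. (\<integral>w. f (escale N t w) \<partial>?S) \<partial>radial_measure N)"
    using integral_fst'[OF int] by simp
  also have "\<dots> = (\<integral>t. (indicator {0<..} t * t ^ (N - 1)) *\<^sub>R (\<integral>w. f (escale N t w) \<partial>?S) \<partial>lborel)"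
    unfolding radial_measure_def
  proof (rule integral_density)
    have "(\<lambda>t. \<integral>w. f (escale N t w) \<partial>?S) \<in> borel_measurable (radial_measure N)"
      using borel_measurable_integrable[OF integrable_fst'[OF int]] by simp
    then show "(\<lambda>t. \<integral>w. f (escale N t w) \<partial>?S) \<in> borel_measurable lborel" by (simp add: radial_measure_def)
    show "AE t in lborel. 0 \<le> indicator {0<..} (t :: real) * t ^ (N - 1)" by (intro AE_I2) (auto simp: indicator_def)
  qed auto
  finally show ?thesis using 1 by simp
qed

section \<open>The weak Helmholtz equation\<close>

lemma continuous_on_fun_upd: "continuous_on A (\<lambda>t :: real. (x :: nat \<Rightarrow> real)(i := t))"
proof (rule continuous_on_coordinatewise_then_product)
  fix j
  show "continuous_on A (\<lambda>t. (x(i := t)) j)" by (cases "j = i") (auto intro: continuous_intros)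
qed

text \<open>The gap between \<open>R\<close> and \<open>a\<close> leaves room to glue:
  \<open>f\<close> is 0 up to a radius in between and continuous beyond.\<close>

lemma continuous_on_Rn_of_annulus:
  fixes f :: "(nat \<Rightarrow> real) \<Rightarrow> 'b :: real_normed_vector"
  assumes f: "continuous_on (exterior_ball N R) f" and R: "R < a"
    and supp: "\<And>x. x \<in> Rn N \<Longrightarrow> \<not> (a \<le> enorm N x \<and> enorm N x \<le> b) \<Longrightarrow> f x = 0"
  shows "continuous_on (Rn N) f"
proof -
  define c where "c = (R + a) / 2"
  have c: "R < c" "c < a" using R by (auto simp: c_def)
  have "continuous_on (Rn N) (\<lambda>x. if enorm N x \<le> c then 0 else f x)"
  proof (rule continuous_on_cases_le)
    show "continuous_on {x \<in> Rn N. c \<le> enorm N x} f"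
      by (rule continuous_on_subset[OF f]) (use c in \<open>auto simp: exterior_ball_def\<close>)
    show "0 = f x" if "x \<in> Rn N" "enorm N x = c" for x using supp[OF that(1)] that c by simp
  qed (auto intro: continuous_on_enorm)
  also have "?this \<longleftrightarrow> continuous_on (Rn N) f"
    by (rule continuous_on_cong) (use supp c in auto)
  finally show ?thesis .
qed

text \<open>Integrate in the coordinate \<open>i\<close> first: on each line the integral is a
  difference of values of \<open>F\<close> outside its support.\<close>

lemma integral_partial_derivative_eq_0:
  fixes F G :: "(nat \<Rightarrow> real) \<Rightarrow> complex"
  assumes i: "i < N"
    and d: "\<And>x. x \<in> Rn N \<Longrightarrow> ((\<lambda>t. F (x(i := t))) has_vector_derivative G x) (at (x i))"
    and int: "integrable (lebN N) G" and cont: "continuous_on (Rn N) G"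
    and supp: "\<And>x. x \<in> Rn N \<Longrightarrow> enorm N x > b \<Longrightarrow> F x = 0" "\<And>x. x \<in> Rn N \<Longrightarrow> enorm N x > b \<Longrightarrow> G x = 0"
  shows "(\<integral>x. G x \<partial>lebN N) = 0"
proof -
  interpret product_sigma_finite "\<lambda>_. lborel :: real measure"
    by (rule product_sigma_finite.intro) (rule sigma_finite_lborel)
  let ?I = "{..<N} - {i}"
  have ins: "insert i ?I = {..<N}" using i by auto
  have "(\<integral>x. G x \<partial>lebN N) = (\<integral>x. (\<integral>y. G (x(i := y)) \<partial>lborel) \<partial>Pi\<^sub>M ?I (\<lambda>_. lborel))"
    using product_integral_insert[of ?I i G, unfolded ins] int by (simp add: lebN_def)
  also have "\<dots> = (\<integral>x. 0 \<partial>Pi\<^sub>M ?I (\<lambda>_. lborel :: real measure))"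
  proof (rule Bochner_Integration.integral_cong[OF refl])
    fix x assume "x \<in> space (Pi\<^sub>M ?I (\<lambda>_. lborel :: real measure))"
    then have x: "x(i := y) \<in> Rn N" for y
      using i by (auto simp: space_PiM Rn_iff PiE_def extensional_def)
    define B where "B = \<bar>b\<bar> + 1"
    have big: "enorm N (x(i := y)) > b" if "\<bar>y\<bar> \<ge> B" for y
      using abs_le_enorm[OF i, of "x(i := y)"] that by (auto simp: B_def)
    have dF: "((\<lambda>t. F (x(i := t))) has_vector_derivative G (x(i := y))) (at y)" for y
      using d[OF x[of y]] by simp
    have "(\<integral>y. G (x(i := y)) \<partial>lborel) = (\<integral>y. indicator {-B..B} y *\<^sub>R G (x(i := y)) \<partial>lborel)"
    proof (rule Bochner_Integration.integral_cong[OF refl])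
      fix y
      show "G (x(i := y)) = indicator {-B..B} y *\<^sub>R G (x(i := y))"
        using supp(2)[OF x big, of y] by (auto simp: indicator_def abs_le_iff)
    qed
    also have "\<dots> = F (x(i := B)) - F (x(i := - B))"
    proof (rule integral_FTC_Icc[where F = "\<lambda>y. F (x(i := y))"])
      show "- B \<le> B" by (simp add: B_def)
      show "((\<lambda>y. F (x(i := y))) has_vector_derivative G (x(i := y))) (at y within {- B..B})" for y
        by (rule has_vector_derivative_at_within[OF dF])
      show "continuous_on {-B..B} (\<lambda>y. G (x(i := y)))"
        by (rule continuous_on_compose2[OF cont continuous_on_fun_upd]) (use x in auto)
    qed
    also have "\<dots> = 0" using supp(1)[OF x big] by (simp add: B_def)
    finally show "(\<integral>y. G (x(i := y)) \<partial>lborel) = 0" .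
  qed
  finally show ?thesis by simp
qed

text \<open>Radial functions are written in |x|^2 rather than |x|: this is a polynomial, so the
  chain rule needs no exception at the origin.\<close>

lemma has_pd_radial:
  assumes "i < N" and \<psi>: "\<And>s. (\<psi> has_real_derivative \<psi>' s) (at s)"
  shows "has_pd i (\<lambda>x. \<psi> (norm2 N x)) (\<lambda>x. \<psi>' (norm2 N x) * (2 * x i))"
  unfolding has_pd_def
proof (intro allI)
  fix x s
  have "((\<lambda>t. norm2 N (x(i := t))) has_real_derivative 2 * (x(i := s)) i) (at s)"
    using hpoly_has_pd[OF hpoly_norm2[of N], of i] assms(1) unfolding pd_norm2[OF assms(1)] has_pd_def by blast
  from DERIV_chain2[where f = \<psi>, OF \<psi> this]
  show "((\<lambda>t. \<psi> (norm2 N (x(i := t)))) has_real_derivative \<psi>' (norm2 N (x(i := s))) * (2 * (x(i := s)) i)) (at s)" .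
qed

lemma has_pd_of_real:
  assumes "has_pd i f g"
  shows "((\<lambda>t. complex_of_real (f (x(i := t)))) has_vector_derivative of_real (g x)) (at (x i))"
proof -
  have "((\<lambda>t. f (x(i := t))) has_real_derivative g (x(i := x i))) (at (x i))"
    using assms unfolding has_pd_def by blast
  then show ?thesis
    by (intro has_vector_derivative_of_real) (simp add: has_real_derivative_iff_has_vector_derivative)
qed

text \<open>Only the pure second derivatives enter. The constant \<open>K\<close> is free so that
  two cases share the theory: the square of the wave number for the field, and 0 for solid
  harmonics.\<close>

locale helmholtz_exterior =
  fixes N :: nat and R :: real and K :: complex and u :: "(nat \<Rightarrow> real) \<Rightarrow> complex"
    and u' u'' :: "nat \<Rightarrow> (nat \<Rightarrow> real) \<Rightarrow> complex"
  assumes N: "N > 0" and R: "R > 0"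
    and cu: "continuous_on (exterior_ball N R) u"
    and cu': "\<And>i. i < N \<Longrightarrow> continuous_on (exterior_ball N R) (u' i)"
    and cu'': "\<And>i. i < N \<Longrightarrow> continuous_on (exterior_ball N R) (u'' i)"
    and du: "\<And>i x. i < N \<Longrightarrow> x \<in> exterior_ball N R \<Longrightarrow> ((\<lambda>t. u (x(i := t))) has_vector_derivative u' i x) (at (x i))"
    and du': "\<And>i x. i < N \<Longrightarrow> x \<in> exterior_ball N R \<Longrightarrow> ((\<lambda>t. u' i (x(i := t))) has_vector_derivative u'' i x) (at (x i))"
    and eq: "\<And>x. x \<in> exterior_ball N R \<Longrightarrow> (\<Sum>i<N. u'' i x) + K * u x = 0"
begin

text \<open>Green's second identity with the test function \<phi> = \<psi>(|x|^2) Y(x). The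
  components \<open>F i\<close> of (grad u) \<phi> - u grad \<phi> vanish off an annulus, so their
  divergence integrates to 0, and the equation turns that divergence into -(K u \<phi> + u lap
  \<phi>). Since \<open>Y\<close> is harmonic and homogeneous, lap \<phi> is \<open>Y\<close> times
  the stated radial expression.\<close>

lemma weak_helmholtz:
  assumes Y: "solid_harmonic N n Y" and a: "R < a"
    and \<psi>: "\<And>s. (\<psi> has_real_derivative \<psi>' s) (at s)" and \<psi>': "\<And>s. (\<psi>' has_real_derivative \<psi>'' s) (at s)"
    and c\<psi>'': "continuous_on UNIV \<psi>''"
    and supp: "\<And>x. x \<in> Rn N \<Longrightarrow> \<not> (a \<le> enorm N x \<and> enorm N x \<le> b) \<Longrightarrow>
      \<psi> (norm2 N x) = 0 \<and> \<psi>' (norm2 N x) = 0 \<and> \<psi>'' (norm2 N x) = 0"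
  shows "(\<integral>x. u x * of_real (Y x * (4 * norm2 N x * \<psi>'' (norm2 N x) + (2 * real N + 4 * real n) * \<psi>' (norm2 N x)))
      + K * (u x * of_real (Y x * \<psi> (norm2 N x))) \<partial>lebN N) = 0" (is "(\<integral>x. ?h x \<partial>_) = 0")
proof -
  have hY: "hpoly N n Y" and lapY: "\<And>x. lap N Y x = 0" using Y by (auto simp: solid_harmonic_def)
  define \<phi> where "\<phi> x = \<psi> (norm2 N x) * Y x" for x
  define \<phi>' where "\<phi>' i x = (\<psi>' (norm2 N x) * (2 * x i)) * Y x + pd i Y x * \<psi> (norm2 N x)" for i x
  define \<phi>'' where "\<phi>'' i x = (((\<psi>'' (norm2 N x) * (2 * x i)) * (2 * x i) + 2 * \<psi>' (norm2 N x)) * Y x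
      + pd i Y x * (\<psi>' (norm2 N x) * (2 * x i)))
      + (pd i (pd i Y) x * \<psi> (norm2 N x) + (\<psi>' (norm2 N x) * (2 * x i)) * pd i Y x)" for i x
  have hp: "has_pd i Y (pd i Y)" "has_pd i (pd i Y) (pd i (pd i Y))" for i
    using hpoly_has_pd[OF hY] hpoly_pd_ex[OF N hY, of i] hpoly_has_pd by blast+
  have d\<phi>: "has_pd i \<phi> (\<phi>' i)" if "i < N" for i
    unfolding \<phi>_def[abs_def] \<phi>'_def[abs_def] by (rule has_pd_mult[OF has_pd_radial[OF that \<psi>] hp(1)])
  have d\<phi>': "has_pd i (\<phi>' i) (\<phi>'' i)" if "i < N" for i
  proof -
    have "has_pd i (\<lambda>x. 2 * x i) (\<lambda>x. 2)"
      using has_pd_mult[OF has_pd_const[of i 2] has_pd_coord[of i i]] by simp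
    from has_pd_add[OF has_pd_mult[OF has_pd_mult[OF has_pd_radial[OF that \<psi>'] this] hp(1)] has_pd_mult[OF hp(2) has_pd_radial[OF that \<psi>]]]
    show ?thesis unfolding \<phi>'_def[abs_def] \<phi>''_def[abs_def] .
  qed
  have supp\<phi>: "\<phi> x = 0" "\<phi>' i x = 0" "\<phi>'' i x = 0" if "x \<in> Rn N" "\<not> (a \<le> enorm N x \<and> enorm N x \<le> b)" for x i
    using supp[OF that] by (auto simp: \<phi>_def \<phi>'_def \<phi>''_def)
  have cpsi: "continuous_on A (\<lambda>x. f (norm2 N x))" if "continuous_on UNIV f" for f :: "real \<Rightarrow> real" and A
    by (rule continuous_on_compose2[OF that continuous_on_norm2]) simp
  have c\<psi>: "continuous_on UNIV \<psi>" "continuous_on UNIV \<psi>'"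
    using \<psi> \<psi>' by (auto intro!: continuous_at_imp_continuous_on DERIV_isCont)
  have cY: "continuous_on A Y" "continuous_on A (pd i Y)" "continuous_on A (pd i (pd i Y))" for A i
  proof -
    obtain m where m: "hpoly N m (pd i Y)" using hpoly_pd_ex[OF N hY] by blast
    obtain l where l: "hpoly N l (pd i (pd i Y))" using hpoly_pd_ex[OF N m] by blast
    show "continuous_on A Y" "continuous_on A (pd i Y)" "continuous_on A (pd i (pd i Y))"
      using hY m l by (auto intro: continuous_on_hpoly)
  qed
  have c\<phi>: "continuous_on A \<phi>" "continuous_on A (\<phi>' i)" "continuous_on A (\<phi>'' i)" for A i
    unfolding \<phi>_def[abs_def] \<phi>'_def[abs_def] \<phi>''_def[abs_def]
    by (intro continuous_intros cpsi c\<psi> c\<psi>'' cY continuous_on_coord)+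
  define F where "F i x = u' i x * of_real (\<phi> x) - u x * of_real (\<phi>' i x)" for i x
  define G where "G i x = u'' i x * of_real (\<phi> x) - u x * of_real (\<phi>'' i x)" for i x
  have F0: "F i x = 0" "G i x = 0" if "x \<in> Rn N" "\<not> (a \<le> enorm N x \<and> enorm N x \<le> b)" for i x
    using supp\<phi>[OF that] by (simp_all add: F_def G_def)
  have dF: "((\<lambda>t. F i (x(i := t))) has_vector_derivative G i x) (at (x i))" if i: "i < N" and x: "x \<in> Rn N" for i x
  proof (cases "x \<in> exterior_ball N R")
    case True
    have "((\<lambda>t. F i (x(i := t))) has_vector_derivative
      (u' i (x(i := x i)) * of_real (\<phi>' i x) + u'' i x * of_real (\<phi> (x(i := x i))))
      - (u (x(i := x i)) * of_real (\<phi>'' i x) + u' i x * of_real (\<phi>' i (x(i := x i))))) (at (x i))"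
      unfolding F_def
      by (rule has_vector_derivative_diff[OF has_vector_derivative_mult[OF du'[OF i True] has_pd_of_real[OF d\<phi>[OF i], of x]]
          has_vector_derivative_mult[OF du[OF i True] has_pd_of_real[OF d\<phi>'[OF i], of x]]])
    then show ?thesis by (simp add: G_def)
  next
    case False
    then have xa: "enorm N x < a" using x a by (auto simp: exterior_ball_def)
    \<comment> \<open>Off the exterior domain nothing is known about \<open>u\<close>. There
      \<open>F i\<close> is 0 because of its test factors, and on a whole neighbourhood in the line
      since \<open>enorm N x < a\<close> is an open condition.\<close>
    have "open {t. enorm N (x(i := t)) < a}"
      by (intro open_Collect_less continuous_on_const continuous_on_compose2[OF continuous_on_enorm[of UNIV] continuous_on_fun_upd]) simp
    moreover have "((\<lambda>t. 0) has_vector_derivative 0) (at (x i))" by simp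
    ultimately have "((\<lambda>t. F i (x(i := t))) has_vector_derivative 0) (at (x i))"
      using xa F0(1)[OF fun_upd_in_Rn[OF x i]]
      by (intro has_vector_derivative_transform_within_open[of "\<lambda>t. 0" 0 "x i" "{t. enorm N (x(i := t)) < a}" "\<lambda>t. F i (x(i := t))"]) auto
    moreover have "G i x = 0" using F0(2)[OF x] xa by simp
    ultimately show ?thesis by simp
  qed
  have cG: "continuous_on (exterior_ball N R) (G i)" if "i < N" for i
    unfolding G_def[abs_def] by (intro continuous_intros cu'' cu c\<phi> that)
  have intG: "integrable (lebN N) (G i)" if "i < N" for i
    by (rule integrable_annulus[OF cG[OF that] a F0(2)])
  have "(\<integral>x. G i x \<partial>lebN N) = 0" if "i < N" for i
  proof (rule integral_partial_derivative_eq_0[OF that dF[OF that] intG[OF that] continuous_on_Rn_of_annulus[OF cG[OF that] a F0(2)]])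
    show "F i x = 0" "G i x = 0" if "x \<in> Rn N" "b < enorm N x" for x using F0[OF that(1)] that(2) by simp_all
  qed
  then have "(\<integral>x. (\<Sum>i<N. G i x) \<partial>lebN N) = 0"
    using intG by (simp add: Bochner_Integration.integral_sum)
  moreover have "(\<integral>x. ?h x \<partial>lebN N) = (\<integral>x. - (\<Sum>i<N. G i x) \<partial>lebN N)"
  proof (rule Bochner_Integration.integral_cong[OF refl])
    fix x assume "x \<in> space (lebN N)"
    then have x: "x \<in> Rn N" by (simp add: space_lebN)
    show "?h x = - (\<Sum>i<N. G i x)"
    proof (cases "x \<in> exterior_ball N R")
      case True
      have "(\<Sum>i<N. \<phi>'' i x) = (\<Sum>i<N. 4 * \<psi>'' (norm2 N x) * Y x * (x i)\<^sup>2 + 2 * \<psi>' (norm2 N x) * Y x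
          + 4 * \<psi>' (norm2 N x) * (x i * pd i Y x) + \<psi> (norm2 N x) * pd i (pd i Y) x)"
        by (rule sum.cong) (auto simp: \<phi>''_def power2_eq_square algebra_simps)
      also have "\<dots> = 4 * \<psi>'' (norm2 N x) * Y x * norm2 N x + 2 * real N * \<psi>' (norm2 N x) * Y x
          + 4 * \<psi>' (norm2 N x) * (\<Sum>i<N. x i * pd i Y x) + \<psi> (norm2 N x) * lap N Y x"
        by (simp add: sum.distrib sum_distrib_left norm2_def lap_def)
      also have "\<dots> = Y x * (4 * norm2 N x * \<psi>'' (norm2 N x) + (2 * real N + 4 * real n) * \<psi>' (norm2 N x))"
        unfolding euler_identity[OF N hY] lapY by (simp add: algebra_simps)
      finally have s: "(\<Sum>i<N. \<phi>'' i x) = Y x * (4 * norm2 N x * \<psi>'' (norm2 N x) + (2 * real N + 4 * real n) * \<psi>' (norm2 N x))" .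
      have "(\<Sum>i<N. G i x) = (\<Sum>i<N. u'' i x) * of_real (\<phi> x) - u x * of_real (\<Sum>i<N. \<phi>'' i x)"
        by (simp add: G_def sum_subtractf sum_distrib_left sum_distrib_right)
      also have "(\<Sum>i<N. u'' i x) = - (K * u x)" using eq[OF True] by (simp add: add_eq_0_iff2)
      finally show ?thesis unfolding s by (simp add: \<phi>_def mult_ac)
    next
      case False
      then have "\<not> (a \<le> enorm N x \<and> enorm N x \<le> b)" using x a by (auto simp: exterior_ball_def)
      then show ?thesis using F0(2)[OF x] supp[OF x] by simp
    qed
  qed
  ultimately show ?thesis by simp
qed

end

section \<open>The radial equation of a mode\<close>

lemma hpoly_homogeneous: "hpoly N n f \<Longrightarrow> f (escale N t x) = t ^ n * f x"
proof (induction rule: hpoly.induct)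
  case (hpoly_var i n f)
  then show ?case by (simp add: escale_def)
qed (auto simp: distrib_left)

text \<open>\<open>h'\<close> is the derivative with respect to t^2. Because \<open>h\<close>
  vanishes below the positive \<open>a\<close>, the composition is locally 0 at s \<le> 0, where the
  root is zero or negative, and the singularity of the root at 0 is never met.\<close>

lemma deriv_compose_sqrt:
  fixes h h' :: "real \<Rightarrow> real"
  assumes h: "\<And>t. t > 0 \<Longrightarrow> (h has_real_derivative 2 * t * h' t) (at t)"
    and a: "a > 0" and z: "\<And>t. t < a \<Longrightarrow> h t = 0" "\<And>t. t < a \<Longrightarrow> h' t = 0"
  shows "((\<lambda>s. h (sqrt s)) has_real_derivative h' (sqrt s)) (at s)"
proof (cases "s > 0")
  case True
  have "((\<lambda>s. h (sqrt s)) has_real_derivative (2 * sqrt s * h' (sqrt s)) * (inverse (sqrt s) / 2)) (at s)"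
    by (rule DERIV_chain2[where f = h and g = sqrt, OF h DERIV_real_sqrt]) (use True in auto)
  then show ?thesis by (rule DERIV_cong) (use True in \<open>simp add: field_simps\<close>)
next
  case False
  have lt: "sqrt y < a" if "y < a\<^sup>2" for y using that a by (simp add: real_less_lsqrt real_sqrt_less_mono[of y "a\<^sup>2", simplified])
  have s: "s < a\<^sup>2" using False a by (smt (verit) zero_less_power)
  have "((\<lambda>_. 0 :: real) has_real_derivative 0) (at s)" by simp
  then have "((\<lambda>s. h (sqrt s)) has_real_derivative 0) (at s)"
    by (rule has_field_derivative_transform_within_open[of _ _ _ "{..<a\<^sup>2}"]) (use s z(1) lt in auto)
  then show ?thesis using z(2)[OF lt[OF s]] by simp
qed

text \<open>Radial test functions: with \<open>\<chi>\<^sub>0 (t) = t powr (- m) * z t\<close>, the functions \<open>\<chi>\<^sub>1\<close> and \<open>\<chi>\<^sub>2\<close> are the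
  first two derivatives of \<open>\<chi>\<^sub>0 (sqrt s)\<close> with respect to \<open>s\<close>, evaluated at \<open>s = t\<^sup>2\<close>.\<close>

lemma radial_test_function:
  fixes z z' z'' :: "real \<Rightarrow> real" and m :: real
  assumes ab: "0 < \<alpha>"
    and z: "\<And>x. (z has_real_derivative z' x) (at x)" and z': "\<And>x. (z' has_real_derivative z'' x) (at x)"
    and cz'': "continuous_on UNIV z''" and supp: "\<forall>x. x \<notin> {\<alpha>..\<beta>} \<longrightarrow> z x = 0"
  obtains \<chi>\<^sub>0 \<chi>\<^sub>1 \<chi>\<^sub>2 :: "real \<Rightarrow> real"
  where "\<And>s. ((\<lambda>s. \<chi>\<^sub>0 (sqrt s)) has_real_derivative \<chi>\<^sub>1 (sqrt s)) (at s)"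
    and "\<And>s. ((\<lambda>s. \<chi>\<^sub>1 (sqrt s)) has_real_derivative \<chi>\<^sub>2 (sqrt s)) (at s)"
    and "continuous_on UNIV (\<lambda>s. \<chi>\<^sub>2 (sqrt s))"
    and "\<And>t. t \<notin> {\<alpha>..\<beta>} \<Longrightarrow> \<chi>\<^sub>0 t = 0 \<and> \<chi>\<^sub>1 t = 0 \<and> \<chi>\<^sub>2 t = 0"
    and "\<And>t c. t > 0 \<Longrightarrow> 4 * t\<^sup>2 * \<chi>\<^sub>2 t + (4 * m + 2) * \<chi>\<^sub>1 t + c * \<chi>\<^sub>0 t = t powr (- m) * (z'' t - (m * (m - 1) / t\<^sup>2 - c) * z t)"
proof -
  define \<chi>\<^sub>0 where "\<chi>\<^sub>0 = (\<lambda>t. t powr (- m) * z t)"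
  define \<chi>\<^sub>1 where "\<chi>\<^sub>1 = (\<lambda>t. t powr (- m - 2) / 2 * (t * z' t - m * z t))"
  define \<chi>\<^sub>2 where "\<chi>\<^sub>2 = (\<lambda>t. t powr (- m - 4) / 4 * (m * (m + 2) * z t - (2 * m + 1) * (t * z' t) + t\<^sup>2 * z'' t))"
  have supp': "z' x = 0" if "x \<notin> {\<alpha>..\<beta>}" for x by (rule compact_support_deriv_eq_0[OF z _ that]) (use supp in blast)
  have supp'': "z'' x = 0" if "x \<notin> {\<alpha>..\<beta>}" for x by (rule compact_support_deriv_eq_0[OF z' _ that]) (use supp' in blast)
  have s0: "\<chi>\<^sub>0 t = 0 \<and> \<chi>\<^sub>1 t = 0 \<and> \<chi>\<^sub>2 t = 0" if "t \<notin> {\<alpha>..\<beta>}" for t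
    using supp that supp'[OF that] supp''[OF that] by (simp add: \<chi>\<^sub>0_def \<chi>\<^sub>1_def \<chi>\<^sub>2_def)
  have pw: "t powr (- m - 1) = t powr (- m - 2) * t" "t powr (- m) = t powr (- m - 2) * t\<^sup>2"
      "t powr (- m - 3) = t powr (- m - 4) * t" "t powr (- m - 2) = t powr (- m - 4) * t\<^sup>2" if "t > 0" for t
    using that by (simp_all add: powr_diff powr_numeral power2_eq_square field_simps power_numeral_reduce)
  have d0: "(\<chi>\<^sub>0 has_real_derivative 2 * t * \<chi>\<^sub>1 t) (at t)" if t: "t > 0" for t
  proof -
    have "(\<chi>\<^sub>0 has_real_derivative (- m * t powr (- m - 1)) * z t + z' t * t powr (- m)) (at t)"
      unfolding \<chi>\<^sub>0_def using DERIV_mult[OF DERIV_fun_powr[OF DERIV_ident t, of "- m"] z] by simp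
    also have "(- m * t powr (- m - 1)) * z t + z' t * t powr (- m) = 2 * t * \<chi>\<^sub>1 t"
      unfolding \<chi>\<^sub>1_def pw(1,2)[OF t] by (simp add: algebra_simps power2_eq_square)
    finally show ?thesis .
  qed
  have d1: "(\<chi>\<^sub>1 has_real_derivative 2 * t * \<chi>\<^sub>2 t) (at t)" if t: "t > 0" for t
  proof -
    have p: "((\<lambda>t. t powr (- m - 2) / 2) has_real_derivative (- m - 2) * t powr (- m - 3) / 2) (at t)"
      by (rule DERIV_cong[OF DERIV_cdivide[OF DERIV_fun_powr[OF DERIV_ident t, of "- m - 2"], of 2]]) (simp add: algebra_simps)
    have q: "((\<lambda>t. t * z' t - m * z t) has_real_derivative (1 * z' t + z'' t * t) - m * z' t) (at t)"
      by (rule DERIV_diff[OF DERIV_mult[OF DERIV_ident z'] DERIV_cmult[OF z]])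
    have "(\<chi>\<^sub>1 has_real_derivative ((- m - 2) * t powr (- m - 3) / 2) * (t * z' t - m * z t)
        + ((1 * z' t + z'' t * t) - m * z' t) * (t powr (- m - 2) / 2)) (at t)"
      unfolding \<chi>\<^sub>1_def by (rule DERIV_mult[OF p q])
    also have "((- m - 2) * t powr (- m - 3) / 2) * (t * z' t - m * z t)
        + ((1 * z' t + z'' t * t) - m * z' t) * (t powr (- m - 2) / 2) = 2 * t * \<chi>\<^sub>2 t"
      unfolding \<chi>\<^sub>2_def pw(3,4)[OF t] by (simp add: algebra_simps power2_eq_square add_divide_distrib diff_divide_distrib)
    finally show ?thesis .
  qed
  have lt: "t \<notin> {\<alpha>..\<beta>}" if "t < \<alpha>" for t using that by simp
  have f0: "((\<lambda>s. \<chi>\<^sub>0 (sqrt s)) has_real_derivative \<chi>\<^sub>1 (sqrt s)) (at s)" for s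
    by (rule deriv_compose_sqrt[OF d0 ab]) (use s0[OF lt] in auto)
  have f1: "((\<lambda>s. \<chi>\<^sub>1 (sqrt s)) has_real_derivative \<chi>\<^sub>2 (sqrt s)) (at s)" for s
    by (rule deriv_compose_sqrt[OF d1 ab]) (use s0[OF lt] in auto)
  have cz: "isCont z t" "isCont z' t" "isCont z'' t" for t
    using DERIV_isCont[OF z] DERIV_isCont[OF z'] cz'' by (auto simp: continuous_on_eq_continuous_at)
  have "isCont \<chi>\<^sub>2 t" for t
  proof (cases "t > 0")
    case True
    then show ?thesis unfolding \<chi>\<^sub>2_def by (intro continuous_intros cz) auto
  next
    case False
    have "((\<lambda>_. 0) \<longlongrightarrow> \<chi>\<^sub>2 t) (at t)" using s0[OF lt, of t] False ab by simp
    then have "(\<chi>\<^sub>2 \<longlongrightarrow> \<chi>\<^sub>2 t) (at t)"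
      by (rule tendsto_cong[THEN iffD1, rotated])
         (use False ab s0[OF lt] in \<open>auto simp: eventually_at_topological intro!: exI[of _ "{..<\<alpha>}"]\<close>)
    then show ?thesis by (simp add: isCont_def)
  qed
  then have "continuous_on UNIV \<chi>\<^sub>2" by (simp add: continuous_on_eq_continuous_at)
  then have f2: "continuous_on UNIV (\<lambda>s. \<chi>\<^sub>2 (sqrt s))"
    by (rule continuous_on_compose2) (auto intro: continuous_intros)
  \<comment> \<open>The weight \<open>t powr (- m)\<close> makes the terms with \<open>z'\<close>
    cancel: \<open>\<chi>\<^sub>2\<close> contributes -(2m + 1) of them and
    \<open>\<chi>\<^sub>1\<close> the opposite. What is left is the radial operator in normal
    form.\<close>
  have f3: "4 * t\<^sup>2 * \<chi>\<^sub>2 t + (4 * m + 2) * \<chi>\<^sub>1 t + c * \<chi>\<^sub>0 t = t powr (- m) * (z'' t - (m * (m - 1) / t\<^sup>2 - c) * z t)"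
    if t: "t > 0" for t c
  proof -
    define p where "p = t powr (- m - 4)"
    have p: "t powr (- m - 2) = p * t\<^sup>2" "t powr (- m) = p * t ^ 4"
      using pw(2,4)[OF t] by (simp_all add: p_def power2_eq_square power4_eq_xxxx mult.assoc)
    define D where "D = m * (m - 1) / t\<^sup>2"
    have D: "m * (m - 1) = t\<^sup>2 * D" using t by (simp add: D_def)
    have 4: "(4 * m + 2) * (q / 2 * r) = (2 * m + 1) * (q * r)" for q r :: real by (simp add: field_simps)
    have A1: "4 * t\<^sup>2 * \<chi>\<^sub>2 t = p * t\<^sup>2 * (m * (m + 2) * z t - (2 * m + 1) * (t * z' t) + t\<^sup>2 * z'' t)"
      by (simp add: \<chi>\<^sub>2_def p_def)
    have A2: "(4 * m + 2) * \<chi>\<^sub>1 t = (2 * m + 1) * (p * t\<^sup>2 * (t * z' t - m * z t))"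
      unfolding \<chi>\<^sub>1_def p by (rule 4)
    have A3: "c * \<chi>\<^sub>0 t = c * (p * t ^ 4 * z t)" by (simp add: \<chi>\<^sub>0_def p)
    have "4 * t\<^sup>2 * \<chi>\<^sub>2 t + (4 * m + 2) * \<chi>\<^sub>1 t + c * \<chi>\<^sub>0 t
        = p * t ^ 4 * z'' t - p * t\<^sup>2 * (m * (m - 1)) * z t + c * (p * t ^ 4 * z t)"
      unfolding A1 A2 A3 by (simp add: algebra_simps power2_eq_square power4_eq_xxxx)
    also have "\<dots> = t powr (- m) * (z'' t - (D - c) * z t)"
      unfolding D p by (simp add: algebra_simps power2_eq_square power4_eq_xxxx)
    finally show ?thesis by (simp add: D_def)
  qed
  show thesis by (rule that[of \<chi>\<^sub>0 \<chi>\<^sub>1 \<chi>\<^sub>2]) (fact f0 f1 f2 s0 f3)+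
qed

text \<open>Dominated convergence on compact intervals of radii, on whose closed annuli
  \<open>f\<close> is bounded.\<close>

lemma continuous_sphere_integral:
  fixes f :: "(nat \<Rightarrow> real) \<Rightarrow> complex" and h :: "(nat \<Rightarrow> real) \<Rightarrow> complex"
  assumes f: "continuous_on (exterior_ball N R) f" and R: "R \<ge> 0" and h: "continuous_on (esphere N 1) h"
  shows "continuous_on {R<..} (\<lambda>t. \<integral>w. f (escale N t w) * h w \<partial>sphere_measure N 1)"
proof -
  interpret finite_measure "sphere_measure N 1" by (rule finite_measure_sphere) simp
  have "continuous_on {a..b} (\<lambda>t. \<integral>w. f (escale N t w) * h w \<partial>sphere_measure N 1)" if a: "R < a" for a b
    unfolding continuous_on_sequentially o_def
  proof (intro allI ballI impI)
    fix X t assume t: "t \<in> {a..b}" and X: "(\<forall>n. X n \<in> {a..b}) \<and> X \<longlonglongrightarrow> t"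
    let ?K = "{x \<in> Rn N. a \<le> enorm N x \<and> enorm N x \<le> b}"
    have K: "?K \<subseteq> exterior_ball N R" using a by (auto simp: exterior_ball_def)
    have "bounded (f ` ?K)"
      by (rule compact_imp_bounded[OF compact_continuous_image[OF continuous_on_subset[OF f K] compact_annulus]])
    then obtain B where B: "\<And>x. x \<in> ?K \<Longrightarrow> norm (f x) \<le> B" unfolding bounded_iff by blast
    obtain H where H: "\<And>w. w \<in> esphere N 1 \<Longrightarrow> norm (h w) \<le> H" "H \<ge> 0" using continuous_sphere_bounded[OF h] by blast
    have inK: "escale N s w \<in> ?K" if "s \<in> {a..b}" "w \<in> esphere N 1" for s w
      using that a R by (auto simp: esphere_def enorm_escale escale_in_Rn)
    have cf: "continuous_on (esphere N 1) (\<lambda>w. f (escale N s w) * h w)" if "s \<in> {a..b}" for s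
      using that a R by (intro continuous_intros h continuous_on_escale_sphere[OF f]) auto
    show "(\<lambda>n. \<integral>w. f (escale N (X n) w) * h w \<partial>sphere_measure N 1) \<longlonglongrightarrow> (\<integral>w. f (escale N t w) * h w \<partial>sphere_measure N 1)"
    proof (rule integral_dominated_convergence[where w = "\<lambda>_. B * H"])
      show "(\<lambda>w. f (escale N t w) * h w) \<in> borel_measurable (sphere_measure N 1)"
        "(\<lambda>w. f (escale N (X n) w) * h w) \<in> borel_measurable (sphere_measure N 1)" for n
        using X t by (auto intro!: borel_measurable_sphere_measure cf)
      show "integrable (sphere_measure N 1) (\<lambda>_. B * H)" by simp
      show "AE w in sphere_measure N 1. (\<lambda>n. f (escale N (X n) w) * h w) \<longlonglongrightarrow> f (escale N t w) * h w"
      proof (rule AE_I2)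
        fix w assume "w \<in> space (sphere_measure N 1)"
        then have w: "w \<in> esphere N 1" by (simp add: space_sphere_measure)
        have "continuous_on {a..b} (\<lambda>s. f (escale N s w))"
          by (rule continuous_on_compose2[OF f continuous_on_escale]) (use inK[OF _ w] K in \<open>auto intro: continuous_intros\<close>)
        then have "(\<lambda>n. f (escale N (X n) w)) \<longlonglongrightarrow> f (escale N t w)"
          using X t unfolding continuous_on_sequentially o_def by blast
        then show "(\<lambda>n. f (escale N (X n) w) * h w) \<longlonglongrightarrow> f (escale N t w) * h w" by (intro tendsto_intros)
      qed
      show "AE w in sphere_measure N 1. norm (f (escale N (X n) w) * h w) \<le> B * H" for n
      proof (rule AE_I2)
        fix w assume "w \<in> space (sphere_measure N 1)"
        then have w: "w \<in> esphere N 1" by (simp add: space_sphere_measure)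
        have "norm (f (escale N (X n) w)) \<le> B" using B[OF inK[OF _ w]] X by blast
        then show "norm (f (escale N (X n) w) * h w) \<le> B * H"
          unfolding norm_mult using H(1)[OF w] H(2) order_trans[OF norm_ge_zero \<open>norm (f (escale N (X n) w)) \<le> B\<close>] by (intro mult_mono)
              (auto simp: \<open>norm (f (escale N (X n) w)) \<le> B\<close>)
      qed
    qed
  qed
  note c = this
  have "isCont (\<lambda>t. \<integral>w. f (escale N t w) * h w \<partial>sphere_measure N 1) t" if "t > R" for t
    by (rule continuous_on_interior[OF c[of "(R + t) / 2" "t + 1"]]) (use that in \<open>auto simp: field_simps\<close>)
  then show ?thesis by (intro continuous_at_imp_continuous_on) auto
qed

text \<open>The weight serves twice: it removes the first-order term from the radial equation, and
  it compensates the decay of the field, so that the limit of the modulus at infinity is that of the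
  far-field coefficient.\<close>

definition mode_coeff :: "nat \<Rightarrow> ((nat \<Rightarrow> real) \<Rightarrow> complex) \<Rightarrow> ((nat \<Rightarrow> real) \<Rightarrow> real) \<Rightarrow> real \<Rightarrow> complex" where
  "mode_coeff N u Y t = of_real (t powr ((real N - 1) / 2)) * (\<integral>w. u (escale N t w) * of_real (Y w) \<partial>sphere_measure N 1)"

text \<open>Given a test function \<open>z\<close> on the half-line,
  \<open>radial_test_function\<close> supplies the radial factor for \<open>weak_helmholtz\<close>,
  and polar coordinates turn the vanishing integral over space into the weak form of the radial
  equation tested with \<open>z\<close>. The identity 2N + 4n = 4m + 2 matches the two
  operators.\<close>

lemma (in helmholtz_exterior) mode_ode:
  assumes Y: "solid_harmonic N n Y" and K: "K = of_real \<kappa>"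
  defines "m \<equiv> real n + (real N - 1) / 2"
  obtains v' where "\<And>t. t > R \<Longrightarrow> (mode_coeff N u Y has_vector_derivative v' t) (at t)"
    "\<And>t. t > R \<Longrightarrow> (v' has_vector_derivative of_real (m * (m - 1) / t\<^sup>2 - \<kappa>) * mode_coeff N u Y t) (at t)"
proof -
  let ?S = "sphere_measure N 1"
  have hY: "hpoly N n Y" using Y by (simp add: solid_harmonic_def)
  define g where "g t = (\<integral>w. u (escale N t w) * of_real (Y w) \<partial>?S)" for t
  define v where "v = mode_coeff N u Y"
  have vg: "v t = of_real (t powr ((real N - 1) / 2)) * g t" for t by (simp add: v_def mode_coeff_def g_def)
  have cg: "continuous_on {R<..} g"
    unfolding g_def[abs_def]
    by (rule continuous_sphere_integral[OF cu]) (use R in \<open>auto intro!: continuous_intros continuous_on_hpoly[OF hY]\<close>)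
  have cv: "continuous_on {R<..} v"
    unfolding vg[abs_def] using R by (intro continuous_intros cg) auto
  have cq: "continuous_on {R<..} (\<lambda>t. m * (m - 1) / t\<^sup>2 - \<kappa>)"
    using R by (intro continuous_intros) auto
  show thesis
  proof (rule ode_of_weak_ode[OF cv cq])
    fix z z' z'' :: "real \<Rightarrow> real" and \<alpha> \<beta> :: real
    assume ab: "R < \<alpha>" "\<alpha> \<le> \<beta>" and z: "\<And>x. (z has_real_derivative z' x) (at x)"
      and z': "\<And>x. (z' has_real_derivative z'' x) (at x)" and cz'': "continuous_on UNIV z''"
      and supp0: "\<And>x. x \<notin> {\<alpha>..\<beta>} \<Longrightarrow> z x = 0"
    have supp: "\<forall>x. x \<notin> {\<alpha>..\<beta>} \<longrightarrow> z x = 0" using supp0 by blast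
    have \<alpha>: "0 < \<alpha>" using ab R by simp
    obtain \<chi>\<^sub>0 \<chi>\<^sub>1 \<chi>\<^sub>2 where \<chi>: "\<And>s. ((\<lambda>s. \<chi>\<^sub>0 (sqrt s)) has_real_derivative \<chi>\<^sub>1 (sqrt s)) (at s)"
      "\<And>s. ((\<lambda>s. \<chi>\<^sub>1 (sqrt s)) has_real_derivative \<chi>\<^sub>2 (sqrt s)) (at s)" "continuous_on UNIV (\<lambda>s. \<chi>\<^sub>2 (sqrt s))"
      "\<And>t. t \<notin> {\<alpha>..\<beta>} \<Longrightarrow> \<chi>\<^sub>0 t = 0 \<and> \<chi>\<^sub>1 t = 0 \<and> \<chi>\<^sub>2 t = 0"
      "\<And>t c. t > 0 \<Longrightarrow> 4 * t\<^sup>2 * \<chi>\<^sub>2 t + (4 * m + 2) * \<chi>\<^sub>1 t + c * \<chi>\<^sub>0 t = t powr (- m) * (z'' t - (m * (m - 1) / t\<^sup>2 - c) * z t)"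
      by (rule radial_test_function[OF \<alpha> z z' cz'' supp, of m]) blast
    define \<Theta> where "\<Theta> t = 4 * t\<^sup>2 * \<chi>\<^sub>2 t + (4 * m + 2) * \<chi>\<^sub>1 t + \<kappa> * \<chi>\<^sub>0 t" for t
    define f where "f x = u x * of_real (Y x * \<Theta> (enorm N x))" for x
    have mN: "2 * real N + 4 * real n = 4 * m + 2" by (simp add: m_def field_simps)
    have sq: "sqrt (norm2 N x) = enorm N x" for x by (simp add: enorm_eq)
    have out: "\<chi>\<^sub>0 (enorm N x) = 0 \<and> \<chi>\<^sub>1 (enorm N x) = 0 \<and> \<chi>\<^sub>2 (enorm N x) = 0" if "\<not> (\<alpha> \<le> enorm N x \<and> enorm N x \<le> \<beta>)" for x
      using \<chi>(4)[of "enorm N x"] that by auto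
    have "(\<integral>x. u x * of_real (Y x * (4 * norm2 N x * \<chi>\<^sub>2 (sqrt (norm2 N x)) + (2 * real N + 4 * real n) * \<chi>\<^sub>1 (sqrt (norm2 N x))))
      + K * (u x * of_real (Y x * \<chi>\<^sub>0 (sqrt (norm2 N x)))) \<partial>lebN N) = 0"
      by (rule weak_helmholtz[OF Y ab(1) \<chi>(1,2,3), where b = \<beta>]) (use out in \<open>simp add: sq\<close>)
    also have "(\<integral>x. u x * of_real (Y x * (4 * norm2 N x * \<chi>\<^sub>2 (sqrt (norm2 N x)) + (2 * real N + 4 * real n) * \<chi>\<^sub>1 (sqrt (norm2 N x))))
      + K * (u x * of_real (Y x * \<chi>\<^sub>0 (sqrt (norm2 N x)))) \<partial>lebN N) = (\<integral>x. f x \<partial>lebN N)"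
      unfolding sq mN by (rule Bochner_Integration.integral_cong[OF refl]) (simp add: f_def \<Theta>_def K norm2_enorm algebra_simps)
    finally have f0: "(\<integral>x. f x \<partial>lebN N) = 0" .
    have \<Theta>0: "\<Theta> t = 0" if "t \<notin> {\<alpha>..\<beta>}" for t using \<chi>(4)[OF that] by (simp add: \<Theta>_def)
    have \<Theta>t: "\<Theta> t = t powr (- m) * (z'' t - (m * (m - 1) / t\<^sup>2 - \<kappa>) * z t)" if "t > 0" for t
      unfolding \<Theta>_def by (rule \<chi>(5)[OF that])
    have c\<Theta>: "continuous_on {0<..} \<Theta>"
    proof -
      have cz: "continuous_on A z" for A by (rule continuous_at_imp_continuous_on) (use z DERIV_isCont in blast)
      have "continuous_on {0<..} (\<lambda>t. t powr (- m) * (z'' t - (m * (m - 1) / t\<^sup>2 - \<kappa>) * z t))"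
        by (intro continuous_intros continuous_on_subset[OF cz''] cz) auto
      then show ?thesis by (rule continuous_on_eq) (use \<Theta>t in auto)
    qed
    have cf: "continuous_on (exterior_ball N R) f"
      unfolding f_def[abs_def]
      by (intro continuous_intros cu continuous_on_hpoly[OF hY] continuous_on_compose2[OF c\<Theta> continuous_on_enorm])
         (use R in \<open>auto simp: exterior_ball_def\<close>)
    have supf: "f x = 0" if "x \<in> Rn N" "\<not> (\<alpha> \<le> enorm N x \<and> enorm N x \<le> \<beta>)" for x
      using \<Theta>0[of "enorm N x"] that(2) by (auto simp: f_def)
    have "(\<integral>t. (indicator {0<..} t * t ^ (N - 1)) *\<^sub>R (\<integral>w. f (escale N t w) \<partial>?S) \<partial>lborel) = 0"
      using polar_integral[OF N integrable_annulus[OF cf ab(1) supf]] supf \<alpha> f0 by simp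
    also have "(\<integral>t. (indicator {0<..} t * t ^ (N - 1)) *\<^sub>R (\<integral>w. f (escale N t w) \<partial>?S) \<partial>lborel)
      = (\<integral>t. indicator {\<alpha>..\<beta>} t *\<^sub>R ((z'' t - (m * (m - 1) / t\<^sup>2 - \<kappa>) * z t) *\<^sub>R v t) \<partial>lborel)"
    proof (rule Bochner_Integration.integral_cong[OF refl])
      fix t :: real
      have inner: "(\<integral>w. f (escale N t w) \<partial>?S) = of_real (t ^ n * \<Theta> t) * g t" if "t \<ge> 0"
      proof -
        have "(\<integral>w. f (escale N t w) \<partial>?S) = (\<integral>w. of_real (t ^ n * \<Theta> t) * (u (escale N t w) * of_real (Y w)) \<partial>?S)"
        proof (rule Bochner_Integration.integral_cong[OF refl])
          fix w assume "w \<in> space ?S"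
          then have "enorm N (escale N t w) = t" using that by (simp add: space_sphere_measure esphere_def enorm_escale)
          then show "f (escale N t w) = of_real (t ^ n * \<Theta> t) * (u (escale N t w) * of_real (Y w))"
            by (simp add: f_def hpoly_homogeneous[OF hY] mult_ac)
        qed
        then show ?thesis by (simp add: g_def)
      qed
      show "(indicator {0<..} t * t ^ (N - 1)) *\<^sub>R (\<integral>w. f (escale N t w) \<partial>?S)
        = indicator {\<alpha>..\<beta>} t *\<^sub>R ((z'' t - (m * (m - 1) / t\<^sup>2 - \<kappa>) * z t) *\<^sub>R v t)"
      proof (cases "t \<in> {\<alpha>..\<beta>}")
        case True
        then have t: "t > 0" using \<alpha> by simp
        \<comment> \<open>The value of \<open>m\<close> is made for this: (N - 1) + n - m = (N -
          1)/2. The polar weight, the homogeneity of \<open>Y\<close> and the weight of the test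
          function combine to the weight of the mode.\<close>
        have "t ^ (N - 1) * (t ^ n * t powr (- m)) = t powr ((real N - 1) / 2)"
        proof -
          have "t ^ (N - 1) * (t ^ n * t powr (- m)) = t powr (real (N - 1) + (real n + (- m)))"
            by (simp only: powr_realpow[OF t, symmetric] powr_add[symmetric])
          also have "real (N - 1) + (real n + (- m)) = (real N - 1) / 2" using N by (simp add: m_def of_nat_diff field_simps)
          finally show ?thesis .
        qed
        then have "t ^ (N - 1) * (t ^ n * \<Theta> t) = t powr ((real N - 1) / 2) * (z'' t - (m * (m - 1) / t\<^sup>2 - \<kappa>) * z t)"
          unfolding \<Theta>t[OF t] by (simp only: mult.assoc[symmetric])
        note E = this
        have "t ^ (N - 1) *\<^sub>R (of_real (t ^ n * \<Theta> t) * g t) = of_real (t ^ (N - 1) * (t ^ n * \<Theta> t)) * g t"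
          by (simp add: scaleR_conv_of_real mult.assoc)
        also have "\<dots> = (z'' t - (m * (m - 1) / t\<^sup>2 - \<kappa>) * z t) *\<^sub>R v t"
          unfolding E by (simp add: vg scaleR_conv_of_real mult_ac)
        finally show ?thesis using True t inner by simp
      next
        case False
        then have "t > 0 \<Longrightarrow> (\<integral>w. f (escale N t w) \<partial>?S) = 0" using inner \<Theta>0[OF False] by simp
        then show ?thesis using False by (auto simp: indicator_def)
      qed
    qed
    also have "\<dots> = integral {\<alpha>..\<beta>} (\<lambda>t. (z'' t - (m * (m - 1) / t\<^sup>2 - \<kappa>) * z t) *\<^sub>R v t)"
    proof -
      have cz: "continuous_on A z" for A by (rule continuous_at_imp_continuous_on) (use z DERIV_isCont in blast)
      have "continuous_on {\<alpha>..\<beta>} (\<lambda>t. (z'' t - (m * (m - 1) / t\<^sup>2 - \<kappa>) * z t) *\<^sub>R v t)"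
        by (intro continuous_intros continuous_on_subset[OF cz''] cz continuous_on_subset[OF cv]) (use ab \<alpha> in auto)
      then have "set_integrable lborel {\<alpha>..\<beta>} (\<lambda>t. (z'' t - (m * (m - 1) / t\<^sup>2 - \<kappa>) * z t) *\<^sub>R v t)"
        by (rule borel_integrable_atLeastAtMost')
      from set_borel_integral_eq_integral(2)[OF this] show ?thesis by (simp add: set_lebesgue_integral_def)
    qed
    finally show "integral {\<alpha>..\<beta>} (\<lambda>t. (z'' t - (m * (m - 1) / t\<^sup>2 - \<kappa>) * z t) *\<^sub>R v t) = 0" .
  next
    fix v' assume "\<And>x. x > R \<Longrightarrow> (v has_vector_derivative v' x) (at x)"
      "\<And>x. x > R \<Longrightarrow> (v' has_vector_derivative (m * (m - 1) / x\<^sup>2 - \<kappa>) *\<^sub>R v x) (at x)"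
    then show thesis
      by (intro that[of v']) (simp_all add: v_def scaleR_conv_of_real)
  qed
qed

section \<open>Expansion in spherical harmonics\<close>

text \<open>Makes \<open>mode_ode\<close> applicable to a solid harmonic itself; the radius 1 is an
  arbitrary choice, since harmonicity holds everywhere.\<close>

lemma helmholtz_exterior_solid_harmonic:
  assumes N: "N > 0" and Y: "solid_harmonic N n Y"
  shows "helmholtz_exterior N 1 0 (\<lambda>x. of_real (Y x)) (\<lambda>i x. of_real (pd i Y x)) (\<lambda>i x. of_real (pd i (pd i Y) x))"
proof
  have hY: "hpoly N n Y" "\<And>x. lap N Y x = 0" using Y by (auto simp: solid_harmonic_def)
  fix i
  obtain m where m: "hpoly N m (pd i Y)" using hpoly_pd_ex[OF N hY(1)] by blast
  obtain l where l: "hpoly N l (pd i (pd i Y))" using hpoly_pd_ex[OF N m] by blast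
  show "continuous_on (exterior_ball N 1) (\<lambda>x. complex_of_real (pd i Y x))"
    "continuous_on (exterior_ball N 1) (\<lambda>x. complex_of_real (pd i (pd i Y) x))"
    by (intro continuous_intros continuous_on_hpoly[OF m] continuous_on_hpoly[OF l])+
  show "((\<lambda>t. complex_of_real (Y (x(i := t)))) has_vector_derivative complex_of_real (pd i Y x)) (at (x i))" for x
    by (rule has_pd_of_real[OF hpoly_has_pd[OF hY(1)]])
  show "((\<lambda>t. complex_of_real (pd i Y (x(i := t)))) has_vector_derivative complex_of_real (pd i (pd i Y) x)) (at (x i))" for x
    by (rule has_pd_of_real[OF hpoly_has_pd[OF m]])
  show "(\<Sum>i<N. complex_of_real (pd i (pd i Y) x)) + 0 * complex_of_real (Y x) = 0" for x
    using hY(2)[of x] by (simp add: lap_def flip: of_real_sum)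
  show "continuous_on (exterior_ball N 1) (\<lambda>x. complex_of_real (Y x))"
    by (intro continuous_intros continuous_on_hpoly[OF hY(1)])
qed (use N in auto)

text \<open>By homogeneity the coefficient of \<open>Y\<close> against \<open>Z\<close> is t^b times
  the inner product I, while by \<open>mode_ode\<close> it solves the radial equation belonging to
  the degree of \<open>Z\<close>. Comparing gives (a - b)(a + b - 1) I = 0, and a + b - 1 = m + n +
  N - 2 is positive for different degrees and N \<ge> 2.\<close>

lemma solid_harmonic_orthogonal:
  assumes N: "N \<ge> 2" and Y: "solid_harmonic N m Y" and Z: "solid_harmonic N n Z" and mn: "m \<noteq> n"
  shows "(\<integral>w. Y w * Z w \<partial>sphere_measure N 1) = 0"
proof -
  have N0: "N > 0" using N by simp
  interpret helmholtz_exterior N 1 0 "\<lambda>x. of_real (Y x)" "\<lambda>i x. of_real (pd i Y x)" "\<lambda>i x. of_real (pd i (pd i Y) x)"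
    by (rule helmholtz_exterior_solid_harmonic[OF N0 Y])
  have hY: "hpoly N m Y" using Y by (simp add: solid_harmonic_def)
  define I where "I = (\<integral>w. Y w * Z w \<partial>sphere_measure N 1)"
  define a b where "a = real n + (real N - 1) / 2" and "b = real m + (real N - 1) / 2"
  let ?v = "mode_coeff N (\<lambda>x. complex_of_real (Y x)) Z"
  obtain v' where v: "\<And>t. t > 1 \<Longrightarrow> (?v has_vector_derivative v' t) (at t)"
    and v': "\<And>t. t > 1 \<Longrightarrow> (v' has_vector_derivative of_real (a * (a - 1) / t\<^sup>2 - 0) * ?v t) (at t)"
    unfolding a_def by (rule mode_ode[OF Z, of 0]) (simp, blast)
  have vt: "?v t = of_real (t powr b * I)" if "t > 1" for t
  proof -
    have "(\<integral>w. complex_of_real (Y (escale N t w)) * complex_of_real (Z w) \<partial>sphere_measure N 1)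
        = (\<integral>w. complex_of_real (t ^ m) * complex_of_real (Y w * Z w) \<partial>sphere_measure N 1)"
      by (simp add: hpoly_homogeneous[OF hY] mult.assoc)
    also have "\<dots> = of_real (t ^ m * I)" by (simp add: I_def del: of_real_mult) simp
    finally show ?thesis
      using that by (simp add: mode_coeff_def b_def powr_add powr_realpow mult_ac)
  qed
  have 1: "v' t = of_real (b * t powr (b - 1) * I)" if t: "t > 1" for t
  proof -
    have "((\<lambda>t. complex_of_real (t powr b * I)) has_vector_derivative of_real (b * t powr (b - 1) * I)) (at t)"
      using t by (intro has_vector_derivative_of_real)
        (auto intro!: derivative_eq_intros simp flip: has_real_derivative_iff_has_vector_derivative)
    then have "(?v has_vector_derivative of_real (b * t powr (b - 1) * I)) (at t)"
      by (rule has_vector_derivative_transform_within_open[of _ _ _ "{1<..}"]) (use t vt in auto)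
    from vector_derivative_unique_at[OF v[OF t] this] show ?thesis .
  qed
  \<comment> \<open>The two forms of the second derivative are compared at one point; 2 is simply a
    radius above 1.\<close>
  have "((\<lambda>t. complex_of_real (b * t powr (b - 1) * I)) has_vector_derivative of_real (b * ((b - 1) * 2 powr (b - 2)) * I)) (at 2)"
    by (intro has_vector_derivative_of_real)
       (auto intro!: derivative_eq_intros simp flip: has_real_derivative_iff_has_vector_derivative)
  then have "(v' has_vector_derivative of_real (b * ((b - 1) * 2 powr (b - 2)) * I)) (at 2)"
    by (rule has_vector_derivative_transform_within_open[of _ _ _ "{1<..}"]) (use 1 in auto)
  from vector_derivative_unique_at[OF v'[of 2] this] vt[of 2]
  have "complex_of_real (a * (a - 1) / 4 * (2 powr b * I)) = of_real (b * ((b - 1) * 2 powr (b - 2)) * I)" by simp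
  then have "a * (a - 1) / 4 * (2 powr b * I) = b * ((b - 1) * 2 powr (b - 2)) * I" by (simp only: of_real_eq_iff)
  moreover have "2 powr (b - 2) = 2 powr b / (4 :: real)" by (simp add: powr_diff)
  ultimately have "a * (a - 1) / 4 * (2 powr b * I) = b * ((b - 1) * (2 powr b / 4)) * I" by (simp only:)
  then have "2 powr b * (a * (a - 1) * I) = 2 powr b * (b * (b - 1) * I)" by (simp add: mult_ac)
  then have "a * (a - 1) * I = b * (b - 1) * I" by simp
  then have "(a - b) * (a + b - 1) * I = 0" by (simp add: algebra_simps)
  moreover have "a - b \<noteq> 0" using mn by (simp add: a_def b_def)
  moreover have "a + b - 1 = real (m + n) + real N - 2" by (simp add: a_def b_def field_simps)
  then have "a + b - 1 \<noteq> 0" 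
  proof -
    have "1 \<le> m + n" using mn by linarith
    then have "1 \<le> real (m + n)" by simp
    moreover have "2 \<le> real N" using assms(1) by simp
    ultimately show ?thesis using \<open>a + b - 1 = _\<close> by linarith
  qed
  ultimately show ?thesis by (simp add: I_def)
qed

section \<open>Finite orthonormal systems on the sphere and completeness\<close>

definition ip :: "nat \<Rightarrow> ((nat \<Rightarrow> real) \<Rightarrow> real) \<Rightarrow> ((nat \<Rightarrow> real) \<Rightarrow> real) \<Rightarrow> real" where
  "ip N f g = (\<integral>w. f w * g w \<partial>sphere_measure N 1)"

abbreviation csphere :: "nat \<Rightarrow> ((nat \<Rightarrow> real) \<Rightarrow> real) \<Rightarrow> bool" where
  "csphere N f \<equiv> continuous_on (esphere N 1) f"

lemma ip_integrable: "csphere N f \<Longrightarrow> csphere N g \<Longrightarrow> integrable (sphere_measure N 1) (\<lambda>w. f w * g w)"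
  by (intro integrable_sphere continuous_intros) auto

lemma ip_commute: "ip N f g = ip N g f"
  by (simp add: ip_def mult.commute)

lemma ip_diff: "csphere N f \<Longrightarrow> csphere N g \<Longrightarrow> csphere N h \<Longrightarrow> ip N (\<lambda>w. f w - g w) h = ip N f h - ip N g h"
  using ip_integrable[of N f h] ip_integrable[of N g h] by (simp add: ip_def left_diff_distrib)

lemma ip_cmult: "ip N (\<lambda>w. c * f w) h = c * ip N f h"
  by (simp add: ip_def mult.assoc)

lemma ip_sum:
  assumes "\<And>i. i \<in> I \<Longrightarrow> csphere N (f i)" "csphere N h"
  shows "ip N (\<lambda>w. \<Sum>i\<in>I. f i w) h = (\<Sum>i\<in>I. ip N (f i) h)"
  using ip_integrable[OF assms(1) assms(2)] by (simp add: ip_def sum_distrib_right)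

definition orthonormal :: "nat \<Rightarrow> ((nat \<Rightarrow> real) \<Rightarrow> real) set \<Rightarrow> bool" where
  "orthonormal N E \<longleftrightarrow> finite E \<and> (\<forall>e\<in>E. \<exists>n. solid_harmonic N n e) \<and> (\<forall>e\<in>E. \<forall>e'\<in>E. ip N e e' = of_bool (e = e'))"

lemma orthonormal_csphere: "orthonormal N E \<Longrightarrow> e \<in> E \<Longrightarrow> csphere N e"
  unfolding orthonormal_def using continuous_on_solid_harmonic by blast

lemma orthonormal_csphere_mult: "orthonormal N E \<Longrightarrow> e \<in> E \<Longrightarrow> csphere N (\<lambda>w. c * e w)"
  by (intro continuous_intros orthonormal_csphere)

lemma orthonormal_ip_sum:
  assumes "orthonormal N E" "e \<in> E"
  shows "ip N (\<lambda>w. \<Sum>e'\<in>E. c e' * e' w) e = c e"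
proof -
  have "ip N (\<lambda>w. \<Sum>e'\<in>E. c e' * e' w) e = (\<Sum>e'\<in>E. ip N (\<lambda>w. c e' * e' w) e)"
    using assms by (intro ip_sum orthonormal_csphere_mult orthonormal_csphere)
  also have "\<dots> = (\<Sum>e'\<in>E. if e' = e then c e else 0)"
    using assms by (intro sum.cong) (auto simp: ip_cmult orthonormal_def)
  also have "\<dots> = c e" using assms by (simp add: orthonormal_def)
  finally show ?thesis .
qed

text \<open>Pythagoras in a form that serves twice: with the Fourier coefficients as
  \<open>c\<close> it yields Bessel's inequality, and with arbitrary \<open>c\<close> it shows that
  no combination approximates \<open>f\<close> better than the defect in Bessel's
  inequality.\<close>

lemma orthonormal_distance:
  assumes E: "orthonormal N E" and f: "csphere N f"
  shows "ip N (\<lambda>w. f w - (\<Sum>e\<in>E. c e * e w)) (\<lambda>w. f w - (\<Sum>e\<in>E. c e * e w))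
    = ip N f f - (\<Sum>e\<in>E. (ip N f e)\<^sup>2) + (\<Sum>e\<in>E. (c e - ip N f e)\<^sup>2)"
proof -
  let ?s = "\<lambda>w. \<Sum>e\<in>E. c e * e w"
  have s: "csphere N ?s" by (intro continuous_intros orthonormal_csphere[OF E])
  have sf: "ip N ?s f = (\<Sum>e\<in>E. c e * ip N f e)"
  proof -
    have "ip N ?s f = (\<Sum>e\<in>E. ip N (\<lambda>w. c e * e w) f)"
      using f by (intro ip_sum orthonormal_csphere_mult[OF E])
    then show ?thesis by (simp add: ip_cmult ip_commute[of N f])
  qed
  have se: "ip N (\<lambda>w. c e * e w) ?s = c e * c e" if "e \<in> E" for e
    unfolding ip_cmult by (subst ip_commute) (simp only: orthonormal_ip_sum[OF E that])
  have "ip N ?s ?s = (\<Sum>e\<in>E. ip N (\<lambda>w. c e * e w) ?s)"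
    using s by (intro ip_sum orthonormal_csphere_mult[OF E])
  also have "\<dots> = (\<Sum>e\<in>E. c e * c e)" by (rule sum.cong[OF refl se])
  finally have ss: "ip N ?s ?s = (\<Sum>e\<in>E. c e * c e)" .
  let ?h = "\<lambda>w. f w - ?s w"
  have h: "csphere N ?h" by (intro continuous_on_diff f s)
  have "ip N ?h ?h = ip N f ?h - ip N ?s ?h" by (rule ip_diff[OF f s h])
  also have "ip N f ?h = ip N f f - ip N ?s f" by (subst ip_commute) (rule ip_diff[OF f s f])
  also have "ip N ?s ?h = ip N f ?s - ip N ?s ?s" by (subst ip_commute) (rule ip_diff[OF f s s])
  also have "ip N f ?s = ip N ?s f" by (rule ip_commute)
  also have "ip N f f - ip N ?s f - (ip N ?s f - ip N ?s ?s) = ip N f f - 2 * ip N ?s f + ip N ?s ?s" by simp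
  also have "\<dots> = ip N f f - (\<Sum>e\<in>E. (ip N f e)\<^sup>2) + (\<Sum>e\<in>E. (c e - ip N f e)\<^sup>2)"
    unfolding sf ss by (simp add: power2_diff sum.distrib sum_subtractf sum_distrib_left power2_eq_square algebra_simps)
  finally show ?thesis .
qed

lemma ip_self_nonneg: "ip N f f \<ge> 0"
  by (simp add: ip_def)

lemma bessel_real:
  assumes "orthonormal N E" "csphere N f"
  shows "(\<Sum>e\<in>E. (ip N f e)\<^sup>2) \<le> ip N f f"
  using orthonormal_distance[OF assms, of "ip N f"] ip_self_nonneg[of N "\<lambda>w. f w - (\<Sum>e\<in>E. ip N f e * e w)"] by simp

text \<open>Almost everywhere, because Gram-Schmidt only learns that a remainder has norm 0; this is
  all that integrals see.\<close>

definition in_span :: "nat \<Rightarrow> ((nat \<Rightarrow> real) \<Rightarrow> real) set \<Rightarrow> ((nat \<Rightarrow> real) \<Rightarrow> real) \<Rightarrow> bool" where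
  "in_span N E f \<longleftrightarrow> (\<exists>c. AE w in sphere_measure N 1. f w = (\<Sum>e\<in>E. c e * e w))"

lemma in_span_mono:
  assumes "in_span N E f" "E \<subseteq> E'" "finite E'"
  shows "in_span N E' f"
proof -
  obtain c where c: "AE w in sphere_measure N 1. f w = (\<Sum>e\<in>E. c e * e w)" using assms(1) by (auto simp: in_span_def)
  have "(\<Sum>e\<in>E. c e * e w) = (\<Sum>e\<in>E'. (if e \<in> E then c e else 0) * e w)" for w
    using assms(2,3) by (intro sum.mono_neutral_cong_left) auto
  then show ?thesis using c unfolding in_span_def by (intro exI[of _ "\<lambda>e. if e \<in> E then c e else 0"]) simp
qed

lemma in_span_add:
  assumes "in_span N E f" "in_span N E g"
  shows "in_span N E (\<lambda>w. f w + g w)"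
proof -
  obtain c d where "AE w in sphere_measure N 1. f w = (\<Sum>e\<in>E. c e * e w)" "AE w in sphere_measure N 1. g w = (\<Sum>e\<in>E. d e * e w)"
    using assms by (auto simp: in_span_def)
  then have "AE w in sphere_measure N 1. f w + g w = (\<Sum>e\<in>E. (c e + d e) * e w)"
    by eventually_elim (simp add: distrib_right sum.distrib)
  then show ?thesis unfolding in_span_def by (rule exI[of _ "\<lambda>e. c e + d e"])
qed

text \<open>The orthogonalised function must remain a solid harmonic of one degree. It does: members
  of \<open>E\<close> of another degree are orthogonal to \<open>f\<close>, so their terms in the
  projection vanish.\<close>

lemma gram_schmidt_step:
  assumes N: "N \<ge> 2" and E: "orthonormal N E" and f: "solid_harmonic N n f"
  obtains E' where "E \<subseteq> E'" "orthonormal N E'" "in_span N E' f"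
proof -
  have N0: "N > 0" using N by simp
  have fin: "finite E" using E by (simp add: orthonormal_def)
  have cf: "csphere N f" by (rule continuous_on_solid_harmonic[OF f])
  define g where "g w = f w - (\<Sum>e\<in>E. ip N f e * e w)" for w
  have he: "solid_harmonic N n (\<lambda>w. (- ip N f e) * e w)" if e: "e \<in> E" for e
  proof -
    obtain m where m: "solid_harmonic N m e" using E e by (auto simp: orthonormal_def)
    show ?thesis
    proof (cases "m = n")
      case True
      then show ?thesis using solid_harmonic_cmult[OF N0 m, of "- ip N f e"] by simp
    next
      case False
      then have "ip N f e = 0" using solid_harmonic_orthogonal[OF N f m] by (simp add: ip_def)
      then show ?thesis using solid_harmonic_zero[OF N0] by simp
    qed
  qed
  have "solid_harmonic N n (\<lambda>w. f w + (\<Sum>e\<in>E. (- ip N f e) * e w))"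
    by (intro solid_harmonic_add[OF N0 f] solid_harmonic_sum[OF N0 fin] he)
  then have hg: "solid_harmonic N n g" by (simp add: g_def[abs_def] sum_negf)
  have cg: "csphere N g" by (rule continuous_on_solid_harmonic[OF hg])
  have cs: "csphere N (\<lambda>w. \<Sum>e\<in>E. ip N f e * e w)" by (intro continuous_intros orthonormal_csphere[OF E])
  have ge: "ip N g e = 0" if "e \<in> E" for e
    unfolding g_def[abs_def] using ip_diff[OF cf cs orthonormal_csphere[OF E that]] orthonormal_ip_sum[OF E that] by simp
  show thesis
  proof (cases "ip N g g = 0")
    case True
    then have "AE w in sphere_measure N 1. g w * g w = 0"
      unfolding ip_def using integral_nonneg_eq_0_iff_AE[OF ip_integrable[OF cg cg]] by simp
    then have "AE w in sphere_measure N 1. f w = (\<Sum>e\<in>E. ip N f e * e w)"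
      by eventually_elim (simp add: g_def)
    then have "in_span N E f" unfolding in_span_def by (rule exI[of _ "ip N f"])
    then show thesis using that[of E] E by blast
  next
    case False
    then have q: "ip N g g > 0" using ip_self_nonneg[of N g] by simp
    define s where "s = sqrt (ip N g g)"
    have s: "s > 0" "s * s = ip N g g" using q by (auto simp: s_def)
    define e\<^sub>0 where "e\<^sub>0 w = (1 / s) * g w" for w
    have h0: "solid_harmonic N n e\<^sub>0" unfolding e\<^sub>0_def[abs_def] by (rule solid_harmonic_cmult[OF N0 hg])
    have 00: "ip N e\<^sub>0 e\<^sub>0 = 1"
    proof -
      have "ip N e\<^sub>0 e\<^sub>0 = (1 / s) * ip N g e\<^sub>0" unfolding e\<^sub>0_def[abs_def] by (rule ip_cmult)
      also have "ip N g e\<^sub>0 = ip N e\<^sub>0 g" by (rule ip_commute)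
      also have "ip N e\<^sub>0 g = (1 / s) * ip N g g" unfolding e\<^sub>0_def[abs_def] by (rule ip_cmult)
      finally show ?thesis unfolding s(2)[symmetric] using s(1) by simp
    qed
    have 0: "ip N e\<^sub>0 e = 0" if "e \<in> E" for e
      using ip_cmult[of N "1 / s" g e] ge[OF that] by (simp add: e\<^sub>0_def[abs_def])
    have notin: "e\<^sub>0 \<notin> E" using 0[of e\<^sub>0] 00 by auto
    have O: "orthonormal N (insert e\<^sub>0 E)"
      unfolding orthonormal_def
    proof (intro conjI ballI)
      show "finite (insert e\<^sub>0 E)" using fin by simp
      show "\<exists>n. solid_harmonic N n e" if "e \<in> insert e\<^sub>0 E" for e using that h0 E by (auto simp: orthonormal_def)
      show "ip N e e' = of_bool (e = e')" if "e \<in> insert e\<^sub>0 E" "e' \<in> insert e\<^sub>0 E" for e e'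
      proof (cases "e = e\<^sub>0")
        case True
        show ?thesis
        proof (cases "e' = e\<^sub>0")
          case False
          then show ?thesis using that True 0[of e'] by simp
        qed (simp add: True 00)
      next
        case False
        then have e: "e \<in> E" using that by simp
        show ?thesis
        proof (cases "e' = e\<^sub>0")
          case True
          then show ?thesis using False 0[OF e] by (simp add: ip_commute[of N e e\<^sub>0])
        next
          case False
          then have "e' \<in> E" using that by simp
          then show ?thesis using e E by (simp add: orthonormal_def)
        qed
      qed
    qed
    have "f w = (\<Sum>e\<in>insert e\<^sub>0 E. (if e = e\<^sub>0 then s else ip N f e) * e w)" for w
    proof -
      have "(\<Sum>e\<in>E. (if e = e\<^sub>0 then s else ip N f e) * e w) = (\<Sum>e\<in>E. ip N f e * e w)"
        using notin by (intro sum.cong) auto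
      then show ?thesis using fin notin s by (simp add: e\<^sub>0_def g_def)
    qed
    then have "in_span N (insert e\<^sub>0 E) f"
      unfolding in_span_def by (intro exI[of _ "\<lambda>e. if e = e\<^sub>0 then s else ip N f e"] AE_I2)
    then show thesis using that[of "insert e\<^sub>0 E"] O by blast
  qed
qed

lemma gram_schmidt:
  assumes N: "N \<ge> 2"
  shows "harm_span N f \<Longrightarrow> orthonormal N E \<Longrightarrow> \<exists>E'. E \<subseteq> E' \<and> orthonormal N E' \<and> in_span N E' f"
proof (induction arbitrary: E rule: harm_span.induct)
  case (harm_span_harm n f)
  obtain E' where "E \<subseteq> E'" "orthonormal N E'" "in_span N E' f"
    by (rule gram_schmidt_step[OF N harm_span_harm(2,1)])
  then show ?case by blast
next
  case (harm_span_add f g)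
  obtain E1 where E1: "E \<subseteq> E1" "orthonormal N E1" "in_span N E1 f" using harm_span_add(3)[OF harm_span_add(5)] by blast
  obtain E2 where E2: "E1 \<subseteq> E2" "orthonormal N E2" "in_span N E2 g" using harm_span_add(4)[OF E1(2)] by blast
  have "in_span N E2 f" using in_span_mono[OF E1(3) E2(1)] E2(2) by (simp add: orthonormal_def)
  then show ?case using in_span_add[OF _ E2(3)] E1(1) E2(1,2) by blast
qed

text \<open>Stone-Weierstrass gives a polynomial uniformly close to \<open>f\<close>; on the sphere
  it is a sum of harmonics, and Gram-Schmidt extends \<open>E\<close> until its span contains them.
  Starting from a given \<open>E\<close> allows a second function to be treated without losing the
  first.\<close>

lemma parseval_approx_real:
  assumes N: "N \<ge> 2" and E: "orthonormal N E" and f: "csphere N f" and \<eta>: "\<eta> > 0"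
  shows "\<exists>E'. E \<subseteq> E' \<and> orthonormal N E' \<and> ip N f f \<le> (\<Sum>e\<in>E'. (ip N f e)\<^sup>2) + \<eta>"
proof -
  interpret finite_measure "sphere_measure N 1" by (rule finite_measure_sphere) simp
  have N0: "N > 0" using N by simp
  define \<mu> where "\<mu> = measure (sphere_measure N 1) (space (sphere_measure N 1))"
  \<comment> \<open>Chosen so that the squared uniform error times the area \<mu> is at most \<eta>;
    the added 1 keeps the denominator positive.\<close>
  define d where "d = sqrt (\<eta> / (\<mu> + 1))"
  have \<mu>: "\<mu> \<ge> 0" by (simp add: \<mu>_def)
  have d: "d > 0" "d\<^sup>2 * \<mu> \<le> \<eta>" using \<eta> \<mu> by (auto simp: d_def field_simps)
  have "\<exists>g. psum N g \<and> (\<forall>x\<in>esphere N 1. \<bar>f x - g x\<bar> < d)"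
  proof (rule Stone_Weierstrass_HOL[OF compact_esphere])
    show "psum N (\<lambda>x. c)" for c by (rule psum_hpoly[OF hpoly_const])
    show "psum N g \<Longrightarrow> csphere N g" for g by (rule continuous_on_psum)
    show "psum N g \<and> psum N h \<Longrightarrow> psum N (\<lambda>x. g x + h x)" for g h by (blast intro: psum_add)
    show "psum N g \<and> psum N h \<Longrightarrow> psum N (\<lambda>x. g x * h x)" for g h by (blast intro: psum_mult)
    show "\<exists>g. psum N g \<and> g x \<noteq> g y" if xy: "x \<in> esphere N 1 \<and> y \<in> esphere N 1 \<and> x \<noteq> y" for x y
    proof -
      obtain i where i: "x i \<noteq> y i" using xy by auto
      have "i < N" using xy i by (cases "i < N") (auto simp: esphere_def Rn_iff)
      then show ?thesis using i psum_hpoly[OF hpoly_coord] by (intro exI[of _ "\<lambda>x. x i"]) auto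
    qed
  qed (rule f, rule d)
  then obtain g where g: "psum N g" "\<And>x. x \<in> esphere N 1 \<Longrightarrow> \<bar>f x - g x\<bar> < d" by blast
  obtain h where h: "harm_span N h" "\<And>x. norm2 N x = 1 \<Longrightarrow> g x = h x" using psum_harm_span[OF N0 g(1)] by blast
  obtain E' where E': "E \<subseteq> E'" "orthonormal N E'" "in_span N E' h" using gram_schmidt[OF N h(1) E] by blast
  obtain c where c: "AE w in sphere_measure N 1. h w = (\<Sum>e\<in>E'. c e * e w)" using E'(3) by (auto simp: in_span_def)
  let ?s = "\<lambda>w. \<Sum>e\<in>E'. c e * e w"
  have cs: "csphere N (\<lambda>w. f w - ?s w)" by (intro continuous_intros f orthonormal_csphere[OF E'(2)])
  have "ip N f f - (\<Sum>e\<in>E'. (ip N f e)\<^sup>2) \<le> ip N (\<lambda>w. f w - ?s w) (\<lambda>w. f w - ?s w)"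
    unfolding orthonormal_distance[OF E'(2) f] by (simp add: sum_nonneg)
  also have "\<dots> \<le> (\<integral>w. d\<^sup>2 \<partial>sphere_measure N 1)"
    unfolding ip_def
  proof (rule integral_mono_AE[OF ip_integrable[OF cs cs]])
    have "AE w in sphere_measure N 1. w \<in> esphere N 1" by (rule AE_I2) (simp add: space_sphere_measure)
    with c show "AE w in sphere_measure N 1. (f w - ?s w) * (f w - ?s w) \<le> d\<^sup>2"
    proof eventually_elim
      case (elim w)
      have "norm2 N w = 1" using elim(2) by (simp add: norm2_enorm esphere_def)
      then have "\<bar>f w - ?s w\<bar> \<le> \<bar>d\<bar>" using g(2)[OF elim(2)] h(2)[of w] elim(1) by simp
      then show ?case by (simp add: abs_le_square_iff power2_eq_square)
    qed
  qed simp
  also have "\<dots> = d\<^sup>2 * \<mu>" by (simp add: \<mu>_def)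
  also note d(2)
  finally show ?thesis using E' by (intro exI[of _ E']) auto
qed

lemma orthonormal_sum_mono:
  assumes "E \<subseteq> E'" "orthonormal N E'"
  shows "(\<Sum>e\<in>E. (ip N f e)\<^sup>2) \<le> (\<Sum>e\<in>E'. (ip N f e)\<^sup>2)"
  using assms by (intro sum_mono2) (auto simp: orthonormal_def)

lemma norm_coeff_sq:
  fixes f :: "(nat \<Rightarrow> real) \<Rightarrow> complex"
  assumes f: "continuous_on (esphere N 1) f" and e: "csphere N e"
  shows "(norm (\<integral>w. f w * of_real (e w) \<partial>sphere_measure N 1))\<^sup>2 = (ip N (\<lambda>w. Re (f w)) e)\<^sup>2 + (ip N (\<lambda>w. Im (f w)) e)\<^sup>2"
proof -
  have "integrable (sphere_measure N 1) (\<lambda>w. f w * of_real (e w))"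
    by (intro integrable_sphere continuous_intros f e) simp
  from integral_Re[OF this] integral_Im[OF this] show ?thesis
    by (simp add: cmod_power2 ip_def)
qed

lemma integral_norm_sq:
  fixes f :: "(nat \<Rightarrow> real) \<Rightarrow> complex"
  assumes f: "continuous_on (esphere N 1) f"
  shows "(\<integral>w. (norm (f w))\<^sup>2 \<partial>sphere_measure N 1) = ip N (\<lambda>w. Re (f w)) (\<lambda>w. Re (f w)) + ip N (\<lambda>w. Im (f w)) (\<lambda>w. Im (f w))"
proof -
  have c: "csphere N (\<lambda>w. Re (f w))" "csphere N (\<lambda>w. Im (f w))" by (intro continuous_intros f)+
  show ?thesis
    unfolding cmod_power2 using ip_integrable[OF c(1) c(1)] ip_integrable[OF c(2) c(2)]
    by (simp add: ip_def power2_eq_square)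
qed

lemma bessel_inequality:
  fixes f :: "(nat \<Rightarrow> real) \<Rightarrow> complex"
  assumes E: "orthonormal N E" and f: "continuous_on (esphere N 1) f"
  shows "(\<Sum>e\<in>E. (norm (\<integral>w. f w * of_real (e w) \<partial>sphere_measure N 1))\<^sup>2) \<le> (\<integral>w. (norm (f w))\<^sup>2 \<partial>sphere_measure N 1)"
proof -
  have c: "csphere N (\<lambda>w. Re (f w))" "csphere N (\<lambda>w. Im (f w))" by (intro continuous_intros f)+
  have "(\<Sum>e\<in>E. (norm (\<integral>w. f w * of_real (e w) \<partial>sphere_measure N 1))\<^sup>2)
      = (\<Sum>e\<in>E. (ip N (\<lambda>w. Re (f w)) e)\<^sup>2) + (\<Sum>e\<in>E. (ip N (\<lambda>w. Im (f w)) e)\<^sup>2)"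
    unfolding sum.distrib[symmetric] by (intro sum.cong refl norm_coeff_sq f orthonormal_csphere[OF E])
  then show ?thesis unfolding integral_norm_sq[OF f] using bessel_real[OF E c(1)] bessel_real[OF E c(2)] by linarith
qed

text \<open>The harmonics are real, so the real part is approximated first and its system enlarged
  for the imaginary part, which can only increase the first sum. Each part may err by half of
  \<eta>.\<close>

lemma parseval_approx:
  fixes f :: "(nat \<Rightarrow> real) \<Rightarrow> complex"
  assumes N: "N \<ge> 2" and f: "continuous_on (esphere N 1) f" and \<eta>: "\<eta> > 0"
  obtains E where "orthonormal N E"
    "(\<integral>w. (norm (f w))\<^sup>2 \<partial>sphere_measure N 1) \<le> (\<Sum>e\<in>E. (norm (\<integral>w. f w * of_real (e w) \<partial>sphere_measure N 1))\<^sup>2) + \<eta>"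
proof -
  have c: "csphere N (\<lambda>w. Re (f w))" "csphere N (\<lambda>w. Im (f w))" by (intro continuous_intros f)+
  have O: "orthonormal N {}" by (simp add: orthonormal_def)
  have h: "\<eta> / 2 > 0" using \<eta> by simp
  obtain E1 where E1: "orthonormal N E1" "ip N (\<lambda>w. Re (f w)) (\<lambda>w. Re (f w)) \<le> (\<Sum>e\<in>E1. (ip N (\<lambda>w. Re (f w)) e)\<^sup>2) + \<eta> / 2"
    using parseval_approx_real[OF N O c(1) h] by blast
  obtain E where E: "E1 \<subseteq> E" "orthonormal N E" "ip N (\<lambda>w. Im (f w)) (\<lambda>w. Im (f w)) \<le> (\<Sum>e\<in>E. (ip N (\<lambda>w. Im (f w)) e)\<^sup>2) + \<eta> / 2"
    using parseval_approx_real[OF N E1(1) c(2) h] by blast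
  have "(\<Sum>e\<in>E. (norm (\<integral>w. f w * of_real (e w) \<partial>sphere_measure N 1))\<^sup>2)
      = (\<Sum>e\<in>E. (ip N (\<lambda>w. Re (f w)) e)\<^sup>2) + (\<Sum>e\<in>E. (ip N (\<lambda>w. Im (f w)) e)\<^sup>2)"
    unfolding sum.distrib[symmetric] by (intro sum.cong refl norm_coeff_sq f orthonormal_csphere[OF E(2)])
  then have "(\<integral>w. (norm (f w))\<^sup>2 \<partial>sphere_measure N 1) \<le> (\<Sum>e\<in>E. (norm (\<integral>w. f w * of_real (e w) \<partial>sphere_measure N 1))\<^sup>2) + \<eta>"
    unfolding integral_norm_sq[OF f] using E1(2) E(3) orthonormal_sum_mono[OF E(1,2), of "\<lambda>w. Re (f w)"] by linarith
  then show thesis by (rule that[OF E(2)])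
qed

section \<open>The estimate\<close>

lemma helmholtz_exterior_of_solution:
  assumes N: "N > 0" and R: "R > 0" and sol: "helmholtz_solution N k (exterior_ball N R) u"
  shows "helmholtz_exterior N R (of_real (k\<^sup>2)) u (\<lambda>i. partial_deriv i u) (\<lambda>i. partial_deriv i (partial_deriv i u))"
proof
  have 1: "C1_on N (exterior_ball N R) u" "\<And>i. i < N \<Longrightarrow> C1_on N (exterior_ball N R) (partial_deriv i u)"
    using sol by (auto simp: helmholtz_solution_def C2_on_def)
  show "continuous_on (exterior_ball N R) u" using 1(1) by (simp add: C1_on_def)
  show "(\<Sum>i<N. partial_deriv i (partial_deriv i u) x) + complex_of_real (k\<^sup>2) * u x = 0" if "x \<in> exterior_ball N R" for x
    using sol that by (simp add: helmholtz_solution_def laplacian_def)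
  have d: "((\<lambda>t. f (x(i := t))) has_vector_derivative partial_deriv i f x) (at (x i))"
    if "C1_on N (exterior_ball N R) f" "i < N" "x \<in> exterior_ball N R" for f :: "(nat \<Rightarrow> real) \<Rightarrow> complex" and i x
    using that unfolding C1_on_def partial_deriv_def by (simp add: vector_derivative_works)
  fix i assume i: "i < N"
  show "continuous_on (exterior_ball N R) (partial_deriv i u)" using 1(1) i by (simp add: C1_on_def)
  show "continuous_on (exterior_ball N R) (partial_deriv i (partial_deriv i u))" using 1(2)[OF i] i by (simp add: C1_on_def)
  show "((\<lambda>t. u (x(i := t))) has_vector_derivative partial_deriv i u x) (at (x i))" if "x \<in> exterior_ball N R" for x
    by (rule d[OF 1(1) i that])
  show "((\<lambda>t. partial_deriv i u (x(i := t))) has_vector_derivative partial_deriv i (partial_deriv i u) x) (at (x i))"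
    if "x \<in> exterior_ball N R" for x
    by (rule d[OF 1(2)[OF i] i that])
qed (use N R in auto)

text \<open>Besides rewriting the expansion, this recovers continuity of the far-field pattern, as
  the uniform limit of the weighted field with its phase removed. Continuity makes its coefficients
  and Bessel's inequality available.\<close>

lemma far_field_expansion:
  assumes R: "R \<ge> 0" and u: "continuous_on (exterior_ball N R) u" and ff: "far_field_pattern N k u u_inf"
  obtains C \<rho>\<^sub>0 where "C \<ge> 0" "\<rho>\<^sub>0 > 0" "continuous_on (esphere N 1) u_inf"
    "\<And>t w. t \<ge> \<rho>\<^sub>0 \<Longrightarrow> w \<in> esphere N 1 \<Longrightarrow>
      norm (of_real (t powr ((real N - 1) / 2)) * u (escale N t w) - cis (k * t) * u_inf w) \<le> C / t"
proof -
  obtain g C \<rho>\<^sub>0 where \<rho>\<^sub>0: "\<rho>\<^sub>0 > 0" and g: "\<And>t w. t \<ge> \<rho>\<^sub>0 \<Longrightarrow> w \<in> esphere N 1 \<Longrightarrow>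
     u (escale N t w) = exp (\<i> * complex_of_real (k * t)) / complex_of_real (t powr ((real N - 1) / 2)) * (u_inf w + g t w)
     \<and> norm (g t w) \<le> C / t"
    using ff unfolding far_field_pattern_def by blast
  have est: "norm (of_real (t powr ((real N - 1) / 2)) * u (escale N t w) - cis (k * t) * u_inf w) \<le> \<bar>C\<bar> / t"
    if t: "t \<ge> \<rho>\<^sub>0" and w: "w \<in> esphere N 1" for t w
  proof -
    have "t powr ((real N - 1) / 2) \<noteq> 0" using t \<rho>\<^sub>0 by simp
    then have "of_real (t powr ((real N - 1) / 2)) * u (escale N t w) = cis (k * t) * (u_inf w + g t w)"
      using g[OF t w] by (simp add: cis_conv_exp)
    then have "norm (of_real (t powr ((real N - 1) / 2)) * u (escale N t w) - cis (k * t) * u_inf w) = norm (g t w)"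
      by (simp add: distrib_left norm_mult)
    also have "\<dots> \<le> C / t" using g[OF t w] by blast
    also have "\<dots> \<le> \<bar>C\<bar> / t" using t \<rho>\<^sub>0 by (intro divide_right_mono) auto
    finally show ?thesis .
  qed
  define \<Phi> where "\<Phi> t w = cis (- (k * t)) * (of_real (t powr ((real N - 1) / 2)) * u (escale N t w))" for t w
  have \<Phi>: "norm (\<Phi> t w - u_inf w) \<le> \<bar>C\<bar> / t" if t: "t \<ge> \<rho>\<^sub>0" and w: "w \<in> esphere N 1" for t w
  proof -
    have "cis (- (k * t)) * cis (k * t) = 1" by (simp add: cis_mult)
    then have "\<Phi> t w - u_inf w = cis (- (k * t)) * (of_real (t powr ((real N - 1) / 2)) * u (escale N t w) - cis (k * t) * u_inf w)"
      by (simp only: \<Phi>_def right_diff_distrib mult.assoc[symmetric]) simp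
    then show ?thesis using est[OF t w] by (simp only: norm_mult norm_cis mult_1)
  qed
  have "uniform_limit (esphere N 1) \<Phi> u_inf at_top"
  proof (rule uniform_limitI)
    fix e :: real assume e: "e > 0"
    have "((\<lambda>t. \<bar>C\<bar> / t) \<longlongrightarrow> 0) at_top" by real_asymp
    then have "\<forall>\<^sub>F t in at_top. \<bar>C\<bar> / t < e" using e by (rule order_tendstoD)
    with eventually_ge_at_top[of \<rho>\<^sub>0] show "\<forall>\<^sub>F t in at_top. \<forall>w\<in>esphere N 1. dist (\<Phi> t w) (u_inf w) < e"
    proof eventually_elim
      case (elim t)
      then show ?case using \<Phi>[of t] by (auto simp: dist_norm intro: le_less_trans)
    qed
  qed
  moreover have "\<forall>\<^sub>F t in at_top. continuous_on (esphere N 1) (\<Phi> t)"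
  proof (rule eventually_mono[OF eventually_gt_at_top[of R]])
    fix t assume "R < t"
    then show "continuous_on (esphere N 1) (\<Phi> t)"
      unfolding \<Phi>_def by (intro continuous_intros continuous_on_escale_sphere[OF u R])
  qed
  ultimately have "continuous_on (esphere N 1) u_inf"
    by (intro uniform_limit_theorem[OF _ _ trivial_limit_at_top_linorder])
  then show thesis using that[of "\<bar>C\<bar>" \<rho>\<^sub>0] est \<rho>\<^sub>0 by simp
qed

lemma norm_mode_coeff_sq:
  assumes "t > 0" "N > 0"
  shows "(norm (mode_coeff N u Y t))\<^sup>2 = t ^ (N - 1) * (norm (\<integral>w. u (escale N t w) * of_real (Y w) \<partial>sphere_measure N 1))\<^sup>2"
proof -
  have "(t powr ((real N - 1) / 2))\<^sup>2 = t powr real (N - 1)"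
    using assms by (simp add: power2_eq_square of_nat_diff flip: powr_add)
  also have "\<dots> = t ^ (N - 1)" by (rule powr_realpow[OF assms(1)])
  finally show ?thesis by (simp add: mode_coeff_def norm_mult power_mult_distrib)
qed

lemma sphere_norm_bound:
  assumes N2: "N \<ge> 2" and RR: "0 < R" "R < R\<^sub>0" and kR: "k > 0" "k * R\<^sub>0 \<ge> 4" and r: "r \<ge> 8 * R\<^sub>0"
    and rad: "radiating_solution N k R u" and ff: "far_field_pattern N k u u_inf"
  shows "(L2_norm_sphere N r u)\<^sup>2 \<le> 40000 * ((L2_norm_sphere N 1 u_inf)\<^sup>2 + exp (- (k * r / 2)) * (L2_norm_sphere N R\<^sub>0 u)\<^sup>2)"
proof -
  have N0: "N > 0" and R0: "R \<ge> 0" "R\<^sub>0 > 0" and r0: "r > 0" "R < r" using N2 RR r by auto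
  interpret F: finite_measure "sphere_measure N 1" by (rule finite_measure_sphere) simp
  interpret helmholtz_exterior N R "of_real (k\<^sup>2)" u "\<lambda>i. partial_deriv i u" "\<lambda>i. partial_deriv i (partial_deriv i u)"
    using rad helmholtz_exterior_of_solution[OF N0 RR(1)] by (simp add: radiating_solution_def)
  obtain C \<rho>\<^sub>0 where C: "C \<ge> 0" "\<rho>\<^sub>0 > 0" and ci: "continuous_on (esphere N 1) u_inf"
    and asy: "\<And>t w. t \<ge> \<rho>\<^sub>0 \<Longrightarrow> w \<in> esphere N 1 \<Longrightarrow>
      norm (of_real (t powr ((real N - 1) / 2)) * u (escale N t w) - cis (k * t) * u_inf w) \<le> C / t"
    by (rule far_field_expansion[OF R0(1) cu ff]) blast
  let ?S = "sphere_measure N 1"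
  let ?c = "\<lambda>t e. \<integral>w. u (escale N t w) * complex_of_real (e w) \<partial>?S"
  let ?a = "\<lambda>e. \<integral>w. u_inf w * complex_of_real (e w) \<partial>?S"
  have cs: "continuous_on (esphere N 1) (\<lambda>w. u (escale N t w))" if "t > R" for t
    by (rule continuous_on_escale_sphere[OF cu R0(1) that])
  have mode: "(norm (mode_coeff N u e r))\<^sup>2 \<le> 40000 * ((norm (?a e))\<^sup>2 + exp (- (k * r / 2)) * (norm (mode_coeff N u e R\<^sub>0))\<^sup>2)"
    if e: "solid_harmonic N n e" for e n
  proof -
    have ce: "continuous_on (esphere N 1) e" by (rule continuous_on_solid_harmonic[OF e])
    obtain B where B: "\<And>w. w \<in> esphere N 1 \<Longrightarrow> norm (e w) \<le> B" "B \<ge> 0" using continuous_sphere_bounded[OF ce] by blast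
    define m where "m = real n + (real N - 1) / 2"
    obtain v' where m_v: "\<And>t. t > R \<Longrightarrow> (mode_coeff N u e has_vector_derivative v' t) (at t)"
      and m_v': "\<And>t. t > R \<Longrightarrow> (v' has_vector_derivative of_real (m * (m - 1) / t\<^sup>2 - k\<^sup>2) * mode_coeff N u e t) (at t)"
      unfolding m_def by (rule mode_ode[OF e refl]) blast
    define C' where "C' = C * B * measure ?S (space ?S)"
    \<comment> \<open>The asymptotic bound starts where the expansion holds and the radius is safely
      outside the ball of radius \<open>R\<close>. Its constant is the error constant of the far
      field times the maximum of the harmonic and the area of the unit sphere.\<close>
    interpret radial_mode "mode_coeff N u e" v' "?a e" k "m * (m - 1)" R C' "max \<rho>\<^sub>0 (R + 1)"
    proof
      fix t assume t: "t \<ge> max \<rho>\<^sub>0 (R + 1)"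
      then have t': "t \<ge> \<rho>\<^sub>0" "t > R" "t > 0" using C by auto
      let ?d = "\<lambda>w. of_real (t powr ((real N - 1) / 2)) * u (escale N t w) - cis (k * t) * u_inf w"
      have cd: "continuous_on (esphere N 1) ?d" by (intro continuous_intros cs ci t')
      have "mode_coeff N u e t - cis (k * t) * ?a e = (\<integral>w. ?d w * of_real (e w) \<partial>?S)"
      proof -
        have i1: "integrable ?S (\<lambda>w. u (escale N t w) * of_real (e w))" "integrable ?S (\<lambda>w. u_inf w * of_real (e w))"
          by (intro integrable_sphere continuous_intros cs ci ce t' zero_less_one)+
        have "(\<integral>w. ?d w * of_real (e w) \<partial>?S) = (\<integral>w. of_real (t powr ((real N - 1) / 2)) * (u (escale N t w) * of_real (e w))
            - cis (k * t) * (u_inf w * of_real (e w)) \<partial>?S)"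
          by (simp only: left_diff_distrib mult.assoc)
        also have "\<dots> = (\<integral>w. of_real (t powr ((real N - 1) / 2)) * (u (escale N t w) * of_real (e w)) \<partial>?S)
            - (\<integral>w. cis (k * t) * (u_inf w * of_real (e w)) \<partial>?S)"
          by (intro Bochner_Integration.integral_diff integrable_mult_right i1)
        finally show ?thesis by (simp add: mode_coeff_def)
      qed
      also have "norm \<dots> \<le> (\<integral>w. C / t * B \<partial>?S)"
      proof (rule order_trans[OF integral_norm_bound integral_mono])
        show "integrable ?S (\<lambda>w. norm (?d w * of_real (e w)))"
          by (intro integrable_sphere continuous_on_norm continuous_on_mult cd continuous_on_of_real ce zero_less_one)
        show "norm (?d w * of_real (e w)) \<le> C / t * B" if "w \<in> space ?S" for w
        proof -
          have w: "w \<in> esphere N 1" using that by (simp add: space_sphere_measure)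
          have "0 \<le> C / t" using C t' by simp
          then show ?thesis unfolding norm_mult using asy[OF t'(1) w] B(1)[OF w] by (intro mult_mono) auto
        qed
      qed simp
      also have "\<dots> = C' / t" by (simp add: C'_def)
      finally show "norm (mode_coeff N u e t - cis (k * t) * ?a e) \<le> C' / t" .
    qed (use kR RR m_v m_v' in auto)
    have "m * (m - 1) \<ge> - 1 / 4" using zero_le_power2[of "m - 1 / 2"] by (simp add: power2_eq_square algebra_simps)
    from mode_bound[OF RR(2) kR(2) r this] show ?thesis .
  qed
  have main: "(L2_norm_sphere N r u)\<^sup>2 \<le> 40000 * ((L2_norm_sphere N 1 u_inf)\<^sup>2 + exp (- (k * r / 2)) * (L2_norm_sphere N R\<^sub>0 u)\<^sup>2) + d"
    if d: "d > 0" for d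
  proof -
    \<comment> \<open>Compensates the factor r^(N-1) between the unit sphere and the sphere of
      radius \<open>r\<close>. The system \<open>E\<close> depends on \<open>d\<close>, but the
      constant in \<open>mode\<close> does not, so \<open>d\<close> can be sent to 0.\<close>
    define \<eta> where "\<eta> = d / r ^ (N - 1)"
    have \<eta>: "\<eta> > 0" using d r0 by (simp add: \<eta>_def)
    obtain E where E: "orthonormal N E"
      and par: "(\<integral>w. (norm (u (escale N r w)))\<^sup>2 \<partial>?S) \<le> (\<Sum>e\<in>E. (norm (?c r e))\<^sup>2) + \<eta>"
      by (rule parseval_approx[OF N2 cs[OF r0(2)] \<eta>])
    have "(L2_norm_sphere N r u)\<^sup>2 = r ^ (N - 1) * (\<integral>w. (norm (u (escale N r w)))\<^sup>2 \<partial>?S)"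
      by (rule L2_norm_sphere_sq[OF N0 cu R0(1) r0(2)])
    also have "\<dots> \<le> r ^ (N - 1) * ((\<Sum>e\<in>E. (norm (?c r e))\<^sup>2) + \<eta>)"
      using par r0 by (intro mult_left_mono) auto
    also have "\<dots> = (\<Sum>e\<in>E. (norm (mode_coeff N u e r))\<^sup>2) + d"
      using r0 by (simp add: norm_mode_coeff_sq[OF r0(1) N0] distrib_left sum_distrib_left \<eta>_def)
    also have "(\<Sum>e\<in>E. (norm (mode_coeff N u e r))\<^sup>2)
        \<le> (\<Sum>e\<in>E. 40000 * ((norm (?a e))\<^sup>2 + exp (- (k * r / 2)) * (norm (mode_coeff N u e R\<^sub>0))\<^sup>2))"
    proof (rule sum_mono)
      fix e assume "e \<in> E"
      then obtain n where "solid_harmonic N n e" using E by (auto simp: orthonormal_def)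
      then show "(norm (mode_coeff N u e r))\<^sup>2 \<le> 40000 * ((norm (?a e))\<^sup>2 + exp (- (k * r / 2)) * (norm (mode_coeff N u e R\<^sub>0))\<^sup>2)"
        by (rule mode)
    qed
    also have "\<dots> = 40000 * ((\<Sum>e\<in>E. (norm (?a e))\<^sup>2) + exp (- (k * r / 2)) * (R\<^sub>0 ^ (N - 1) * (\<Sum>e\<in>E. (norm (?c R\<^sub>0 e))\<^sup>2)))"
      by (simp add: norm_mode_coeff_sq[OF R0(2) N0] sum.distrib sum_distrib_left)
    also have "\<dots> \<le> 40000 * ((\<integral>w. (norm (u_inf w))\<^sup>2 \<partial>?S) + exp (- (k * r / 2)) * (R\<^sub>0 ^ (N - 1) * (\<integral>w. (norm (u (escale N R\<^sub>0 w)))\<^sup>2 \<partial>?S)))"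
      using bessel_inequality[OF E ci] bessel_inequality[OF E cs[OF RR(2)]] R0
      by (intro mult_left_mono add_mono) auto
    also have "R\<^sub>0 ^ (N - 1) * (\<integral>w. (norm (u (escale N R\<^sub>0 w)))\<^sup>2 \<partial>?S) = (L2_norm_sphere N R\<^sub>0 u)\<^sup>2"
      by (rule L2_norm_sphere_sq[OF N0 cu R0(1) RR(2), symmetric])
    also have "(\<integral>w. (norm (u_inf w))\<^sup>2 \<partial>?S) = (L2_norm_sphere N 1 u_inf)\<^sup>2"
      by (simp add: L2_norm_sphere_def)
    finally show ?thesis by simp
  qed
  show ?thesis by (rule field_le_epsilon[OF main])
qed

text \<open>The inequality ln y \<le> y - 1 at y = b x/a, multiplied by \<open>a\<close> and
  exponentiated; the factor exp(-a) is given away.\<close>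

lemma powr_le_exp_mult:
  fixes x a b :: real
  assumes "x > 0" "a > 0" "b > 0"
  shows "x powr a \<le> (a / b) powr a * exp (b * x)"
proof -
  have "(b * x / a) powr a = exp (a * ln (b * x / a))" using assms by (simp add: powr_def)
  also have "\<dots> \<le> exp (a * (b * x / a - 1))"
    using assms ln_le_minus_one[of "b * x / a"] by simp
  also have "a * (b * x / a - 1) = b * x - a" using assms by (simp add: field_simps)
  also have "exp (b * x - a) \<le> exp (b * x)" using assms by simp
  finally have "(a / b) powr a * (b * x / a) powr a \<le> (a / b) powr a * exp (b * x)"
    by (rule mult_left_mono) simp
  moreover have "(a / b) powr a * (b * x / a) powr a = x powr a"
    using assms by (simp add: powr_mult[symmetric])
  ultimately show ?thesis by simp
qed

theorem corollary4p4:
  shows "\<exists>C\<^sub>3 :: real \<Rightarrow> real.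
    \<forall>(N::nat) (z\<^sub>0::real) (C\<^sub>0::real) (A\<^sub>0::real) (Ct::real).
      N \<ge> 2 \<and> hankel_constants N z\<^sub>0 C\<^sub>0 A\<^sub>0 Ct \<longrightarrow>
      (\<exists>A::real.
        \<forall>(R::real) (R\<^sub>0::real) (B\<^sub>0::real) (B\<^sub>1::real) (k\<^sub>0::real) (\<tau>::real) (C\<^sub>2::real)
         (u :: real \<Rightarrow> (nat \<Rightarrow> real) \<Rightarrow> complex) (u_inf :: real \<Rightarrow> (nat \<Rightarrow> real) \<Rightarrow> complex)
         (\<epsilon> :: real \<Rightarrow> real) (M :: real \<Rightarrow> real).
          0 < R \<and> R < R\<^sub>0 \<and>
          1 < B\<^sub>0 \<and> B\<^sub>0 < B\<^sub>1 \<and> B\<^sub>0 \<ge> 3 * exp 1 * Ct / 2 \<and>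
          k\<^sub>0 > 0 \<and> k\<^sub>0 * R\<^sub>0 \<ge> z\<^sub>0 \<and>
          (\<forall>k\<ge>k\<^sub>0.
             radiating_solution N k R (u k) \<and> far_field_pattern N k (u k) (u_inf k) \<and>
             \<epsilon> k = L2_norm_sphere N 1 (u_inf k) \<and> \<epsilon> k > 0 \<and>
             M k = L2_norm_sphere N R\<^sub>0 (u k) \<and> M k > 0) \<and>
          \<tau> > 0 \<and> (\<forall>k\<ge>k\<^sub>0. M k \<le> C\<^sub>2 * k powr \<tau>) \<longrightarrow>
          (\<forall>k\<ge>k\<^sub>0.
             \<epsilon> k \<le> 1 / exp 1 \<and> k \<ge> Ct / (ln (4/3) * B\<^sub>0 * R\<^sub>0) * ln (1 / \<epsilon> k) \<longrightarrow>
             (\<forall>r. B\<^sub>0 * R\<^sub>0 \<le> r \<and> r \<le> B\<^sub>1 * R\<^sub>0 \<longrightarrow>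
                L2_norm_sphere N r (u k) \<le>
                  sqrt (A * B\<^sub>1 * (1 + C\<^sub>2\<^sup>2 * (Ct / (B\<^sub>0 * R\<^sub>0)) powr (2 * \<tau>) * C\<^sub>3 \<tau>)) * \<epsilon> k)))"
\<comment> \<open>The 40000 is the constant of the mode estimate. The function for
  \<open>C\<^sub>3\<close> arises from trading the power 2\<tau> of a variable against the
  exponential of 2/5 of it, at the price (2\<tau>/(2/5)) to the power 2\<tau>.\<close>
proof (intro exI[of _ "\<lambda>\<tau>. (5 * \<tau>) powr (2 * \<tau>)"] allI impI, elim conjE, intro exI[of _ "40000"] allI impI, elim conjE)
  fix N :: nat and z\<^sub>0 C\<^sub>0 A\<^sub>0 Ct R R\<^sub>0 B\<^sub>0 B\<^sub>1 k\<^sub>0 \<tau> C\<^sub>2 :: real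
    and u u_inf :: "real \<Rightarrow> (nat \<Rightarrow> real) \<Rightarrow> complex" and \<epsilon> M :: "real \<Rightarrow> real" and k r :: real
  assume N: "N \<ge> 2" and hc: "hankel_constants N z\<^sub>0 C\<^sub>0 A\<^sub>0 Ct"
    and R: "0 < R" "R < R\<^sub>0" and B: "1 < B\<^sub>0" "B\<^sub>0 < B\<^sub>1" "3 * exp 1 * Ct / 2 \<le> B\<^sub>0"
    and k\<^sub>0: "0 < k\<^sub>0" "z\<^sub>0 \<le> k\<^sub>0 * R\<^sub>0"
    and sol: "\<forall>k\<ge>k\<^sub>0. radiating_solution N k R (u k) \<and> far_field_pattern N k (u k) (u_inf k) \<and>
             \<epsilon> k = L2_norm_sphere N 1 (u_inf k) \<and> 0 < \<epsilon> k \<and> M k = L2_norm_sphere N R\<^sub>0 (u k) \<and> 0 < M k"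
    and \<tau>: "0 < \<tau>" and M: "\<forall>k\<ge>k\<^sub>0. M k \<le> C\<^sub>2 * k powr \<tau>" and k: "k\<^sub>0 \<le> k"
    and kge: "Ct / (ln (4 / 3) * B\<^sub>0 * R\<^sub>0) * ln (1 / \<epsilon> k) \<le> k" and r: "B\<^sub>0 * R\<^sub>0 \<le> r"
  have Ct: "Ct \<ge> 2" "z\<^sub>0 \<ge> Ct * max 2 ((real N - 2) / 2)" using hc unfolding hankel_constants_def by blast+
  have R0: "R\<^sub>0 > 0" and k0: "k > 0" using R k k\<^sub>0 by auto
  have kR0: "k * R\<^sub>0 \<ge> 4"
  proof -
    have "4 \<le> Ct * 2" using Ct(1) by simp
    also have "\<dots> \<le> Ct * max 2 ((real N - 2) / 2)" using Ct(1) by (intro mult_left_mono) auto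
    also have "\<dots> \<le> k\<^sub>0 * R\<^sub>0" using Ct(2) k\<^sub>0(2) by linarith
    also have "\<dots> \<le> k * R\<^sub>0" using k R0 by simp
    finally show ?thesis .
  qed
  \<comment> \<open>As \<open>Ct \<ge> 2\<close>, \<open>B\<^sub>0\<close> is at least 3e, and 3e
    \<ge> 8 follows from the cubed Taylor bound 25/18 for exp(1/3).\<close>
  have r8: "r \<ge> 8 * R\<^sub>0"
  proof -
    have "(25 / 18) ^ 3 \<le> exp (1 / 3 :: real) ^ 3"
      using exp_lower_Taylor_quadratic[of "1 / 3 :: real"] by (intro power_mono) (auto simp: power2_eq_square)
    also have "\<dots> = exp 1" by (simp flip: exp_of_nat_mult)
    finally have "8 / 3 \<le> exp (1 :: real)" by (simp add: power3_eq_cube)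
    then have "8 \<le> 3 * exp 1 * (2 / 2 :: real)" by simp
    also have "\<dots> \<le> 3 * exp 1 * (Ct / 2)" using Ct(1) by (intro mult_left_mono) auto
    also have "\<dots> \<le> B\<^sub>0" using B(3) by simp
    finally have "8 * R\<^sub>0 \<le> B\<^sub>0 * R\<^sub>0" using R0 by simp
    then show ?thesis using r by linarith
  qed
  have s: "radiating_solution N k R (u k)" "far_field_pattern N k (u k) (u_inf k)" "\<epsilon> k = L2_norm_sphere N 1 (u_inf k)"
    "0 < \<epsilon> k" "M k = L2_norm_sphere N R\<^sub>0 (u k)" "0 < M k" using sol k by blast+
  \<comment> \<open>The natural unit of the wave number: the lower bound on \<open>k\<close> reads
    ln(1/\<epsilon>) \<le> ln(4/3) Z, and rewriting powers of \<open>k\<close> in \<open>Z\<close>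
    produces the factor with \<open>Ct / (B\<^sub>0 * R\<^sub>0)\<close>. By
    \<open>Ct \<ge> 2\<close> the decay exp(-k r/2) is at most exp(-Z).\<close>
  define Z where "Z = k * B\<^sub>0 * R\<^sub>0 / Ct"
  have Z: "Z > 0" using k0 B(1) R0 Ct(1) by (simp add: Z_def)
  have kZ: "k = (Ct / (B\<^sub>0 * R\<^sub>0)) * Z" using B(1) R0 Ct(1) by (simp add: Z_def)
  have expr: "exp (- (k * r / 2)) \<le> exp (- Z)"
  proof -
    have "Z * 2 \<le> Z * Ct" using Z Ct(1) by simp
    also have "\<dots> = k * (B\<^sub>0 * R\<^sub>0)" using Ct(1) by (simp add: Z_def)
    also have "\<dots> \<le> k * r" using r k0 by simp
    finally show ?thesis by simp
  qed
  \<comment> \<open>The decay exp(-Z) is shared out: 3/5 of the exponent buys the square of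
    \<epsilon>, because ln(4/3) \<le> 3/10, and the remaining 2/5 buys the power of \<open>k\<close>
    in the bound for \<open>M\<close>.\<close>
  have eps: "1 \<le> (\<epsilon> k)\<^sup>2 * exp (3 / 5 * Z)"
  proof -
    have l: "ln (4 / 3 :: real) > 0" by simp
    have "ln (1 / \<epsilon> k) \<le> ln (4 / 3) * Z"
      using kge l B(1) R0 Ct(1) by (simp add: Z_def field_simps)
    moreover have "ln (4 / 3 :: real) \<le> 3 / 10"
    proof -
      have "4 / 3 \<le> exp (3 / 10 :: real)" using exp_lower_Taylor_quadratic[of "3 / 10 :: real"] by (simp add: power2_eq_square)
      then have "ln (4 / 3) \<le> ln (exp (3 / 10 :: real))" by (intro ln_mono) auto
      then show ?thesis by simp
    qed
    then have "ln (4 / 3) * Z \<le> 3 / 10 * Z" using Z by (intro mult_right_mono) auto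
    ultimately have "exp (ln (1 / \<epsilon> k)) \<le> exp (3 / 10 * Z)" by simp
    then have "1 \<le> \<epsilon> k * exp (3 / 10 * Z)" using s(4) by (simp add: field_simps)
    then have "1\<^sup>2 \<le> (\<epsilon> k * exp (3 / 10 * Z))\<^sup>2" by (intro power_mono) auto
    then show ?thesis by (simp add: power_mult_distrib exp_double[symmetric])
  qed
  let ?D = "(Ct / (B\<^sub>0 * R\<^sub>0)) powr (2 * \<tau>)" and ?T = "(5 * \<tau>) powr (2 * \<tau>)"
  have "(M k)\<^sup>2 \<le> (C\<^sub>2 * k powr \<tau>)\<^sup>2" using M k s(6) by (intro power_mono) auto
  also have "\<dots> = C\<^sub>2\<^sup>2 * k powr (2 * \<tau>)" using k0 by (simp add: power_mult_distrib power2_eq_square flip: powr_add)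
  also have "k powr (2 * \<tau>) = ?D * Z powr (2 * \<tau>)"
    unfolding kZ using B(1) R0 Ct(1) Z by (subst powr_mult) auto
  also have "C\<^sub>2\<^sup>2 * (?D * Z powr (2 * \<tau>)) \<le> C\<^sub>2\<^sup>2 * (?D * (?T * exp (2 / 5 * Z)))"
    using powr_le_exp_mult[of Z "2 * \<tau>" "2 / 5"] Z \<tau> by (intro mult_left_mono) auto
  finally have M2: "(M k)\<^sup>2 \<le> C\<^sub>2\<^sup>2 * ?D * ?T * exp (2 / 5 * Z)" by (simp add: mult.assoc)
  have "exp (- (k * r / 2)) * (M k)\<^sup>2 \<le> exp (- Z) * (C\<^sub>2\<^sup>2 * ?D * ?T * exp (2 / 5 * Z))"
    by (intro mult_mono expr M2) auto
  also have "\<dots> = (C\<^sub>2\<^sup>2 * ?D * ?T * exp (- (3 / 5) * Z)) * 1"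
  proof -
    have "exp (- Z) * exp (2 / 5 * Z) = exp (- (3 / 5) * Z)" by (simp flip: exp_add)
    then show ?thesis by (simp add: mult_ac)
  qed
  also have "\<dots> \<le> (C\<^sub>2\<^sup>2 * ?D * ?T * exp (- (3 / 5) * Z)) * ((\<epsilon> k)\<^sup>2 * exp (3 / 5 * Z))"
    by (intro mult_left_mono eps) auto
  also have "\<dots> = C\<^sub>2\<^sup>2 * ?D * ?T * (\<epsilon> k)\<^sup>2"
  proof -
    have "exp (- (3 / 5) * Z) * exp (3 / 5 * Z) = 1" by (simp flip: exp_add)
    then show ?thesis by (simp add: mult_ac)
  qed
  finally have tail: "exp (- (k * r / 2)) * (M k)\<^sup>2 \<le> C\<^sub>2\<^sup>2 * ?D * ?T * (\<epsilon> k)\<^sup>2" .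
  have "(L2_norm_sphere N r (u k))\<^sup>2 \<le> 40000 * ((\<epsilon> k)\<^sup>2 + exp (- (k * r / 2)) * (M k)\<^sup>2)"
    using sphere_norm_bound[OF N R k0 kR0 r8 s(1,2)] s(3,5) by simp
  also have "\<dots> \<le> 40000 * ((1 + C\<^sub>2\<^sup>2 * ?D * ?T) * (\<epsilon> k)\<^sup>2)"
    using tail by (intro mult_left_mono) (auto simp: distrib_right)
  also have "\<dots> \<le> 40000 * B\<^sub>1 * ((1 + C\<^sub>2\<^sup>2 * ?D * ?T) * (\<epsilon> k)\<^sup>2)"
    using B by (intro mult_right_mono mult_nonneg_nonneg add_nonneg_nonneg) auto
  finally have "(L2_norm_sphere N r (u k))\<^sup>2 \<le> 40000 * B\<^sub>1 * (1 + C\<^sub>2\<^sup>2 * ?D * ?T) * (\<epsilon> k)\<^sup>2" by (simp only: mult.assoc)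
  then have "L2_norm_sphere N r (u k) \<le> sqrt (40000 * B\<^sub>1 * (1 + C\<^sub>2\<^sup>2 * ?D * ?T) * (\<epsilon> k)\<^sup>2)"
    by (rule real_le_rsqrt)
  also have "\<dots> = sqrt (40000 * B\<^sub>1 * (1 + C\<^sub>2\<^sup>2 * ?D * ?T)) * \<epsilon> k"
    using s(4) by (simp only: real_sqrt_mult real_sqrt_abs abs_of_pos)
  finally show "L2_norm_sphere N r (u k) \<le> sqrt (40000 * B\<^sub>1 * (1 + C\<^sub>2\<^sup>2 * ?D * ?T)) * \<epsilon> k" .
qed

end
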